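(* Consider the state-space model family, the measures $P_{\theta,\boldsymbol y}^{n}$, $Q_{\theta,\boldsymbol y}^{n}$ and the particle approximations $\hat\xi_n^\theta$, $\hat\zeta_n^\theta$ (with $N\ge 2$ particles) defined in the context. (i) Suppose there is $\varepsilon\in(0,1)$ such that $\varepsilon\le p_\theta(x'|x)\le 1/\varepsilon$ and $\varepsilon\le q_\theta(y|x)\le 1/\varepsilon$ for all $\theta\in\Theta$, $x,x'\in\mathcal X$, $y\in\mathcal Y$. Then there exists a real number $L\in[1,\infty)$, depending only on $\varepsilon$ (in particular independent of $N,\theta,\boldsymbol y,\varphi,n$), such that for every $\theta\in\Theta$, every sequence $\boldsymbol y=\{y_n\}_{n\ge0}$ in $\mathcal Y$, every Borel-measurable $\varphi:\mathcal X\to[-1,1]$ and every integer $n\ge1$, $$\left|E\left(\left.\hat\xi_n^\theta(\varphi)-P_{\theta,\boldsymbol Y}^{n}(\varphi)\right|\boldsymbol Y=\boldsymbol y\right)\right|\le\frac{L}{N}.$$ (ii) Suppose in addition that there is $K\in[1,\infty)$ such that $\max\{\|\nabla_\theta p_\theta(x'|x)\|,\|\nabla_\theta q_\theta(y|x)\|\}\le K$ for all $\theta\in\Theta$, $x,x'\in\mathcal X$, $y\in\mathcal Y$, and that $\|w_\theta\|=\sup_{x\in\mathcal X}\|w_\theta(x)\|<\infty$ for all $\theta\in\Theta$. Then there exist real numbers $\rho\in(0,1)$, $M\in[1,\infty)$, depending only on $\varepsilon,d,K$ (in particular independent of $N,\theta,\boldsymbol y,\varphi,n$), such that for every $\theta\in\Theta$,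 every sequence $\boldsymbol y$ in $\mathcal Y$, every Borel-measurable $\varphi:\mathcal X\to[-1,1]$ and every integer $n\ge1$, $$\left\|E\left(\left.\hat\zeta_n^\theta(\varphi)-Q_{\theta,\boldsymbol Y}^{n}(\varphi)\right|\boldsymbol Y=\boldsymbol y\right)\right\|\le\frac{M(1+\rho^n\|w_\theta\|)}{N}.$$
   Context: **Model.** $d,d_x,d_y\ge1$ are integers, $\Theta\subseteq\mathbb R^d$ is open, $\mathcal X\subseteq\mathbb R^{d_x}$ and $\mathcal Y\subseteq\mathbb R^{d_y}$ are Borel sets, $\mu(dx)$, $\nu(dy)$ are positive measures on $\mathcal X$, $\mathcal Y$. $p_\theta(x'|x)$ and $q_\theta(y|x)$ are Borel-measurable functions of $(\theta,x,x')$, resp. $(\theta,x,y)$, with values in $[0,\infty)$, which are probability densities in $x'$ w.r.t. $\mu$ and in $y$ w.r.t. $\nu$ (respectively) and are differentiable in $\theta$. $\xi_\theta(dx)$ is a probability measure on $\mathcal X$ for each $\theta$ (Borel-measurable in $\theta$), and $w_\theta(x)$ is a Borel-measurable function of $(\theta,x)\in\Theta\times\mathcal X$ with values in $\mathbb R^d$. $\boldsymbol Y=\{Y_n\}_{n\ge0}$ is a $\mathcal Y$-valued stochastic process (the observations) on a probability space $(\Omega,\mathcal F,P)$. **Norms and integrals.** For a vector $z$, $\|z\|$ is the $l_\infty$ norm; for a function $\psi_\theta$ of $x$, $\|\psi_\theta\|=\sup_{x\in\mathcal X}\|\psi_\theta(x)\|$. For a signed (vector) measure $\zeta$, $\langle\zeta\rangle$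 is its total mass (its value on the whole space) and $\zeta(\varphi)=\int\varphi\,d\zeta$. **Exact measures.** For a sequence $\boldsymbol y=\{y_n\}_{n\ge0}$ in $\mathcal Y$ and $n\ge1$, let $$r_{\theta,\boldsymbol y}^n(x'|x)=p_\theta(x'|x)q_\theta(y_{n-1}|x),\qquad t_{\theta,\boldsymbol y}^n(x'|x)=\nabla_\theta\log r_{\theta,\boldsymbol y}^n(x'|x),$$ $$r_{\theta,\boldsymbol y}^{0:n}(x_{0:n})=\prod_{k=1}^n r_{\theta,\boldsymbol y}^k(x_k|x_{k-1}),\qquad t_{\theta,\boldsymbol y}^{0:n}(x_{0:n})=w_\theta(x_0)+\sum_{k=1}^n t_{\theta,\boldsymbol y}^k(x_k|x_{k-1}).$$ For Borel $A\subseteq\mathcal X^{n+1}$ put $$\mathbb R_{\theta,\boldsymbol y}^n(A)=\int_A r_{\theta,\boldsymbol y}^{0:n}(x_{0:n})\,\xi_\theta(dx_0)\mu(dx_1)\cdots\mu(dx_n),\qquad \mathbb T_{\theta,\boldsymbol y}^n(A)=\int_A t_{\theta,\boldsymbol y}^{0:n}(x_{0:n})r_{\theta,\boldsymbol y}^{0:n}(x_{0:n})\,\xi_\theta(dx_0)\mu(dx_1)\cdots\mu(dx_n),$$ $$\mathbb P_{\theta,\boldsymbol y}^n(A)=\frac{\mathbb R_{\theta,\boldsymbol y}^n(A)}{\langle\mathbb R_{\theta,\boldsymbol y}^n\rangle},\qquad \mathbb Q_{\theta,\boldsymbol y}^n(A)=\frac{\mathbb T_{\theta,\boldsymbol y}^n(A)}{\langle\mathbb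 R_{\theta,\boldsymbol y}^n\rangle}-\mathbb P_{\theta,\boldsymbol y}^n(A)\frac{\langle\mathbb T_{\theta,\boldsymbol y}^n\rangle}{\langle\mathbb R_{\theta,\boldsymbol y}^n\rangle},$$ and for Borel $B\subseteq\mathcal X$: $P_{\theta,\boldsymbol y}^n(B)=\mathbb P_{\theta,\boldsymbol y}^n(\mathcal X^n\times B)$, $Q_{\theta,\boldsymbol y}^n(B)=\mathbb Q_{\theta,\boldsymbol y}^n(\mathcal X^n\times B)$ (the latter an $\mathbb R^d$-valued measure). **Particle approximation.** Fix an integer $N\ge2$. The particles $\hat X_{0,1}^\theta,\dots,\hat X_{0,N}^\theta$ are i.i.d. from $\xi_\theta$, independent of $\boldsymbol Y$; given $\boldsymbol Y$ and all particles up to time $n$, the particles $\hat X_{n+1,1}^\theta,\dots,\hat X_{n+1,N}^\theta$ are i.i.d. from $$\frac{\sum_{j=1}^N p_\theta(x|\hat X_{n,j}^\theta)q_\theta(Y_n|\hat X_{n,j}^\theta)\,\mu(dx)}{\sum_{j=1}^N q_\theta(Y_n|\hat X_{n,j}^\theta)}.$$ The $\mathbb R^d$-valued weights are $W_{0,i}^\theta=w_\theta(\hat X_{0,i}^\theta)$ and $$W_{n+1,i}^\theta=\frac{\sum_{j=1}^N\left(\nabla_\theta\left[p_\theta(x'|x)q_\theta(y|x)\right]_{x'=\hat X_{n+1,i}^\theta,\,x=\hat X_{n,j}^\theta,\,y=Y_n}+p_\theta(\hat X_{n+1,i}^\theta|\hat X_{n,j}^\theta)q_\theta(Y_n|\hat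 X_{n,j}^\theta)W_{n,j}^\theta\right)}{\sum_{j=1}^N p_\theta(\hat X_{n+1,i}^\theta|\hat X_{n,j}^\theta)q_\theta(Y_n|\hat X_{n,j}^\theta)}$$ (the gradient acts only on the explicit $\theta$-dependence of $p_\theta,q_\theta$). Then $$\hat\xi_n^\theta(dx)=\frac1N\sum_{i=1}^N\delta_{\hat X_{n,i}^\theta}(dx),\qquad \hat\zeta_n^\theta(dx)=\frac1N\sum_{i=1}^N\Big(W_{n,i}^\theta-\frac1N\sum_{j=1}^N W_{n,j}^\theta\Big)\delta_{\hat X_{n,i}^\theta}(dx).$$ $E(\cdot|\boldsymbol Y=\boldsymbol y)$ is the conditional expectation given $\boldsymbol Y=\boldsymbol y$, i.e. expectation for the particle system run with $Y_n$ replaced by the fixed value $y_n$ for all $n$. *)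

theory Defs
  imports "HOL-Probability.Probability"
begin

section \<open>The space \<open>\<real>\<^sup>n\<close> for a varying dimension\<close>

text \<open>
  The constants in the theorem must not depend on the dimensions of the state and observation
  spaces (and, in the first part, of the parameter space), so the dimensions have to be bound
  inside the formula.  A vector of \<open>\<real>\<^sup>n\<close> is therefore a function on \<open>{..<n}\<close>, extended by
  \<^const>\<open>undefined\<close>.
\<close>

type_synonym vec = "nat \<Rightarrow> real"

definition Rn :: "nat \<Rightarrow> vec measure" where
  "Rn n = (\<Pi>\<^sub>M i\<in>{..<n}. borel)"

text \<open>The \<open>l\<^sub>\<infinity>\<close> norm; only used for \<open>n \<ge> 1\<close>.\<close>

definition linf :: "nat \<Rightarrow> vec \<Rightarrow> real" where
  "linf n z = Max ((\<lambda>i. \<bar>z i\<bar>) ` {..<n})"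

text \<open>Partial derivative; the gradient at \<open>\<theta>\<close> is \<open>\<lambda>i. partial_deriv i f \<theta>\<close>, restricted to \<open>i < d\<close>.\<close>

definition partial_deriv :: "nat \<Rightarrow> (vec \<Rightarrow> real) \<Rightarrow> vec \<Rightarrow> real" where
  "partial_deriv i f \<theta> = deriv (\<lambda>s. f (\<theta>(i := s))) (\<theta> i)"

text \<open>
  Frechet differentiability on \<open>\<real>\<^sup>d\<close>.  The topology on functions is the product topology, whose
  trace on \<open>space (Rn d)\<close> is the usual one.
\<close>

definition differentiable_Rn :: "nat \<Rightarrow> (vec \<Rightarrow> real) \<Rightarrow> vec \<Rightarrow> bool" where
  "differentiable_Rn d f \<theta> \<longleftrightarrow>
     (\<exists>g :: vec. ((\<lambda>\<theta>'. (f \<theta>' - f \<theta> - (\<Sum>i<d. g i * (\<theta>' i - \<theta> i))) / linf d (\<lambda>i. \<theta>' i - \<theta> i))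
        \<longlongrightarrow> 0) (at \<theta> within space (Rn d)))"


section \<open>Integration against a finite signed measure\<close>

text \<open>
  A finite signed measure on the measurable space of \<open>M\<close> is given by its set function \<open>\<zeta>\<close>; the
  integral is defined through the Jordan decomposition, the positive part of \<open>\<zeta>\<close> being its upper
  variation.  Note that \<^const>\<open>ennreal\<close> maps negative numbers to \<open>0\<close>, which does not affect the
  supremum, as it includes the empty set.
\<close>

definition upper_variation :: "'a measure \<Rightarrow> ('a set \<Rightarrow> real) \<Rightarrow> 'a measure" where
  "upper_variation M \<zeta> =
     measure_of (space M) (sets M) (\<lambda>A. SUP B\<in>{B \<in> sets M. B \<subseteq> A}. ennreal (\<zeta> B))"

definition signed_integral :: "'a measure \<Rightarrow> ('a set \<Rightarrow> real) \<Rightarrow> ('a \<Rightarrow> real) \<Rightarrow> real" where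
  "signed_integral M \<zeta> f =
     (LINT x|upper_variation M \<zeta>. f x) - (LINT x|upper_variation M (\<lambda>A. - \<zeta> A). f x)"


section \<open>The family of state-space models\<close>

text \<open>
  Argument order: \<open>transd m \<theta> x' x\<close> is \<open>p\<^sub>\<theta>(x'|x)\<close> and \<open>obsd m \<theta> y x\<close> is \<open>q\<^sub>\<theta>(y|x)\<close>.  Reference
  measures: \<open>refX\<close> is \<open>\<mu>\<close>, \<open>refY\<close> is \<open>\<nu>\<close>; \<open>init m \<theta>\<close> is \<open>\<xi>\<^sub>\<theta>\<close> and \<open>wgt0 m \<theta> x\<close> is \<open>w\<^sub>\<theta>(x)\<close>.
\<close>

record ssm =
  dimT :: nat
  dimX :: nat
  dimY :: nat
  Theta :: "vec set"
  setX :: "vec set"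
  setY :: "vec set"
  refX :: "vec measure"
  refY :: "vec measure"
  transd :: "vec \<Rightarrow> vec \<Rightarrow> vec \<Rightarrow> real"
  obsd :: "vec \<Rightarrow> vec \<Rightarrow> vec \<Rightarrow> real"
  init :: "vec \<Rightarrow> vec measure"
  wgt0 :: "vec \<Rightarrow> vec \<Rightarrow> vec"

definition spT :: "ssm \<Rightarrow> vec measure" where
  "spT m = restrict_space (Rn (dimT m)) (Theta m)"

definition spX :: "ssm \<Rightarrow> vec measure" where
  "spX m = restrict_space (Rn (dimX m)) (setX m)"

definition spY :: "ssm \<Rightarrow> vec measure" where
  "spY m = restrict_space (Rn (dimY m)) (setY m)"

definition state_space_model :: "ssm \<Rightarrow> bool" where
  "state_space_model m \<longleftrightarrow>
     dimT m \<ge> 1 \<and> dimX m \<ge> 1 \<and> dimY m \<ge> 1 \<and>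
     openin (top_of_set (space (Rn (dimT m)))) (Theta m) \<and>
     setX m \<in> sets (Rn (dimX m)) \<and> setY m \<in> sets (Rn (dimY m)) \<and>
     sets (refX m) = sets (spX m) \<and> sets (refY m) = sets (spY m) \<and>
     (\<lambda>(\<theta>, x', x). transd m \<theta> x' x) \<in> borel_measurable (spT m \<Otimes>\<^sub>M spX m \<Otimes>\<^sub>M spX m) \<and>
     (\<lambda>(\<theta>, y, x). obsd m \<theta> y x) \<in> borel_measurable (spT m \<Otimes>\<^sub>M spY m \<Otimes>\<^sub>M spX m) \<and>
     (\<forall>\<theta>\<in>Theta m. \<forall>x\<in>setX m. \<forall>x'\<in>setX m.
        0 \<le> transd m \<theta> x' x \<and> differentiable_Rn (dimT m) (\<lambda>\<theta>. transd m \<theta> x' x) \<theta>) \<and>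
     (\<forall>\<theta>\<in>Theta m. \<forall>x\<in>setX m. \<forall>y\<in>setY m.
        0 \<le> obsd m \<theta> y x \<and> differentiable_Rn (dimT m) (\<lambda>\<theta>. obsd m \<theta> y x) \<theta>) \<and>
     (\<forall>\<theta>\<in>Theta m. \<forall>x\<in>setX m. (\<integral>\<^sup>+ x'. ennreal (transd m \<theta> x' x) \<partial>refX m) = 1) \<and>
     (\<forall>\<theta>\<in>Theta m. \<forall>x\<in>setX m. (\<integral>\<^sup>+ y. ennreal (obsd m \<theta> y x) \<partial>refY m) = 1) \<and>
     init m \<in> spT m \<rightarrow>\<^sub>M prob_algebra (spX m) \<and>
     (\<lambda>(\<theta>, x). wgt0 m \<theta> x) \<in> spT m \<Otimes>\<^sub>M spX m \<rightarrow>\<^sub>M Rn (dimT m)"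


section \<open>The exact measures\<close>

text \<open>A path \<open>x\<^sub>0\<^sub>:\<^sub>n\<close> is a function \<open>x\<close> on \<open>{..n}\<close>.\<close>

definition r_step :: "ssm \<Rightarrow> vec \<Rightarrow> (nat \<Rightarrow> vec) \<Rightarrow> nat \<Rightarrow> vec \<Rightarrow> vec \<Rightarrow> real" where
  "r_step m \<theta> y k x' x = transd m \<theta> x' x * obsd m \<theta> (y (k - 1)) x"

definition t_step :: "ssm \<Rightarrow> vec \<Rightarrow> (nat \<Rightarrow> vec) \<Rightarrow> nat \<Rightarrow> vec \<Rightarrow> vec \<Rightarrow> vec" where
  "t_step m \<theta> y k x' x = (\<lambda>c. partial_deriv c (\<lambda>\<theta>. ln (r_step m \<theta> y k x' x)) \<theta>)"

definition r_path :: "ssm \<Rightarrow> vec \<Rightarrow> (nat \<Rightarrow> vec) \<Rightarrow> nat \<Rightarrow> (nat \<Rightarrow> vec) \<Rightarrow> real" where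
  "r_path m \<theta> y n x = (\<Prod>k=1..n. r_step m \<theta> y k (x k) (x (k - 1)))"

definition t_path :: "ssm \<Rightarrow> vec \<Rightarrow> (nat \<Rightarrow> vec) \<Rightarrow> nat \<Rightarrow> (nat \<Rightarrow> vec) \<Rightarrow> vec" where
  "t_path m \<theta> y n x = (\<lambda>c. wgt0 m \<theta> (x 0) c + (\<Sum>k=1..n. t_step m \<theta> y k (x k) (x (k - 1)) c))"

text \<open>\<open>\<xi>\<^sub>\<theta>(dx\<^sub>0) \<mu>(dx\<^sub>1) \<dots> \<mu>(dx\<^sub>n)\<close>\<close>

definition path_base :: "ssm \<Rightarrow> vec \<Rightarrow> nat \<Rightarrow> (nat \<Rightarrow> vec) measure" where
  "path_base m \<theta> n = (\<Pi>\<^sub>M k\<in>{..n}. if k = 0 then init m \<theta> else refX m)"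

definition R_path :: "ssm \<Rightarrow> vec \<Rightarrow> (nat \<Rightarrow> vec) \<Rightarrow> nat \<Rightarrow> (nat \<Rightarrow> vec) measure" where
  "R_path m \<theta> y n = density (path_base m \<theta> n) (\<lambda>x. ennreal (r_path m \<theta> y n x))"

text \<open>
  The vector measures are families, indexed by the coordinate \<open>c\<close>, of signed set functions.
\<close>

definition T_path ::
  "ssm \<Rightarrow> vec \<Rightarrow> (nat \<Rightarrow> vec) \<Rightarrow> nat \<Rightarrow> nat \<Rightarrow> (nat \<Rightarrow> vec) set \<Rightarrow> real" where
  "T_path m \<theta> y n c A = (LINT x:A|path_base m \<theta> n. t_path m \<theta> y n x c * r_path m \<theta> y n x)"

definition P_path :: "ssm \<Rightarrow> vec \<Rightarrow> (nat \<Rightarrow> vec) \<Rightarrow> nat \<Rightarrow> (nat \<Rightarrow> vec) measure" where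
  "P_path m \<theta> y n =
     scale_measure (1 / emeasure (R_path m \<theta> y n) (space (R_path m \<theta> y n))) (R_path m \<theta> y n)"

definition Q_path ::
  "ssm \<Rightarrow> vec \<Rightarrow> (nat \<Rightarrow> vec) \<Rightarrow> nat \<Rightarrow> nat \<Rightarrow> (nat \<Rightarrow> vec) set \<Rightarrow> real" where
  "Q_path m \<theta> y n c A =
     (let mass_R = measure (R_path m \<theta> y n) (space (R_path m \<theta> y n));
          mass_T = T_path m \<theta> y n c (space (path_base m \<theta> n))
      in T_path m \<theta> y n c A / mass_R - measure (P_path m \<theta> y n) A * (mass_T / mass_R))"

definition P_meas :: "ssm \<Rightarrow> vec \<Rightarrow> (nat \<Rightarrow> vec) \<Rightarrow> nat \<Rightarrow> vec measure" where
  "P_meas m \<theta> y n = distr (P_path m \<theta> y n) (spX m) (\<lambda>x. x n)"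

definition Q_meas :: "ssm \<Rightarrow> vec \<Rightarrow> (nat \<Rightarrow> vec) \<Rightarrow> nat \<Rightarrow> nat \<Rightarrow> vec set \<Rightarrow> real" where
  "Q_meas m \<theta> y n c B = Q_path m \<theta> y n c {x \<in> space (path_base m \<theta> n). x n \<in> B}"


section \<open>The particle system\<close>

text \<open>
  The particle system is run with the observations \<open>Y\<^sub>n\<close> replaced by the fixed values \<open>y n\<close>.
  A history \<open>h\<close> up to time \<open>n\<close> consists of the particles \<open>h k i\<close> for \<open>k \<le> n\<close>, \<open>1 \<le> i \<le> N\<close>.
\<close>

definition particle_kernel :: "ssm \<Rightarrow> nat \<Rightarrow> vec \<Rightarrow> vec \<Rightarrow> (nat \<Rightarrow> vec) \<Rightarrow> vec measure" where
  "particle_kernel m N \<theta> yn X =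
     density (refX m)
       (\<lambda>x. ennreal ((\<Sum>j=1..N. transd m \<theta> x (X j) * obsd m \<theta> yn (X j)) / (\<Sum>j=1..N. obsd m \<theta> yn (X j))))"

definition history_space :: "ssm \<Rightarrow> nat \<Rightarrow> nat \<Rightarrow> (nat \<Rightarrow> nat \<Rightarrow> vec) measure" where
  "history_space m N n = (\<Pi>\<^sub>M k\<in>{..n}. \<Pi>\<^sub>M i\<in>{1..N}. spX m)"

primrec particle_law ::
  "ssm \<Rightarrow> nat \<Rightarrow> vec \<Rightarrow> (nat \<Rightarrow> vec) \<Rightarrow> nat \<Rightarrow> (nat \<Rightarrow> nat \<Rightarrow> vec) measure" where
  "particle_law m N \<theta> y 0 =
     distr (\<Pi>\<^sub>M i\<in>{1..N}. init m \<theta>) (history_space m N 0) (\<lambda>X. \<lambda>k\<in>{..0}. X)"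
| "particle_law m N \<theta> y (Suc n) =
     particle_law m N \<theta> y n \<bind>
       (\<lambda>h. distr (\<Pi>\<^sub>M i\<in>{1..N}. particle_kernel m N \<theta> (y n) (h n)) (history_space m N (Suc n))
              (\<lambda>X. h(Suc n := X)))"

primrec weight ::
  "ssm \<Rightarrow> nat \<Rightarrow> vec \<Rightarrow> (nat \<Rightarrow> vec) \<Rightarrow> (nat \<Rightarrow> nat \<Rightarrow> vec) \<Rightarrow> nat \<Rightarrow> nat \<Rightarrow> vec" where
  "weight m N \<theta> y h 0 = (\<lambda>i. wgt0 m \<theta> (h 0 i))"
| "weight m N \<theta> y h (Suc n) = (\<lambda>i c.
     (\<Sum>j=1..N.
        partial_deriv c (\<lambda>\<theta>. transd m \<theta> (h (Suc n) i) (h n j) * obsd m \<theta> (y n) (h n j)) \<theta>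
        + transd m \<theta> (h (Suc n) i) (h n j) * obsd m \<theta> (y n) (h n j) * weight m N \<theta> y h n j c)
     / (\<Sum>j=1..N. transd m \<theta> (h (Suc n) i) (h n j) * obsd m \<theta> (y n) (h n j)))"

text \<open>\<open>xi_hat\<close> is \<open>1/N \<Sum>\<^sub>i \<delta>\<close>, as the image of the uniform distribution on the particle indices.\<close>

definition xi_hat :: "ssm \<Rightarrow> nat \<Rightarrow> (nat \<Rightarrow> nat \<Rightarrow> vec) \<Rightarrow> nat \<Rightarrow> vec measure" where
  "xi_hat m N h n = distr (uniform_count_measure {1..N}) (spX m) (\<lambda>i. h n i)"

definition zeta_hat ::
  "ssm \<Rightarrow> nat \<Rightarrow> vec \<Rightarrow> (nat \<Rightarrow> vec) \<Rightarrow> (nat \<Rightarrow> nat \<Rightarrow> vec) \<Rightarrow> nat \<Rightarrow> nat \<Rightarrow> vec set \<Rightarrow> real" where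
  "zeta_hat m N \<theta> y h n c B =
     1 / real N * (\<Sum>i=1..N.
       (weight m N \<theta> y h n i c - 1 / real N * (\<Sum>j=1..N. weight m N \<theta> y h n j c))
       * indicator B (h n i))"

text \<open>\<open>E(\<xi>\<^sub>n(\<phi>) - P\<^sup>n(\<phi>) | Y = y)\<close> and, coordinatewise, \<open>E(\<zeta>\<^sub>n(\<phi>) - Q\<^sup>n(\<phi>) | Y = y)\<close>.\<close>

definition xi_bias ::
  "ssm \<Rightarrow> nat \<Rightarrow> vec \<Rightarrow> (nat \<Rightarrow> vec) \<Rightarrow> nat \<Rightarrow> (vec \<Rightarrow> real) \<Rightarrow> real" where
  "xi_bias m N \<theta> y n \<phi> =
     (LINT h|particle_law m N \<theta> y n. (LINT x|xi_hat m N h n. \<phi> x) - (LINT x|P_meas m \<theta> y n. \<phi> x))"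

definition zeta_bias ::
  "ssm \<Rightarrow> nat \<Rightarrow> vec \<Rightarrow> (nat \<Rightarrow> vec) \<Rightarrow> nat \<Rightarrow> (vec \<Rightarrow> real) \<Rightarrow> vec" where
  "zeta_bias m N \<theta> y n \<phi> = (\<lambda>c.
     LINT h|particle_law m N \<theta> y n.
       signed_integral (spX m) (zeta_hat m N \<theta> y h n c) \<phi>
       - signed_integral (spX m) (Q_meas m \<theta> y n c) \<phi>)"


definition bounded_densities :: "ssm \<Rightarrow> real \<Rightarrow> bool" where
  "bounded_densities m \<epsilon> \<longleftrightarrow>
     (\<forall>\<theta>\<in>Theta m. \<forall>x\<in>setX m. \<forall>x'\<in>setX m. \<forall>y\<in>setY m.
        \<epsilon> \<le> transd m \<theta> x' x \<and> transd m \<theta> x' x \<le> 1 / \<epsilon> \<and>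
        \<epsilon> \<le> obsd m \<theta> y x \<and> obsd m \<theta> y x \<le> 1 / \<epsilon>)"

definition bounded_gradients :: "ssm \<Rightarrow> real \<Rightarrow> bool" where
  "bounded_gradients m K \<longleftrightarrow>
     (\<forall>\<theta>\<in>Theta m. \<forall>x\<in>setX m. \<forall>x'\<in>setX m. \<forall>y\<in>setY m.
        max (linf (dimT m) (\<lambda>c. partial_deriv c (\<lambda>\<theta>. transd m \<theta> x' x) \<theta>))
            (linf (dimT m) (\<lambda>c. partial_deriv c (\<lambda>\<theta>. obsd m \<theta> y x) \<theta>)) \<le> K)"

definition bounded_weights :: "ssm \<Rightarrow> bool" where
  "bounded_weights m \<longleftrightarrow>
     (\<forall>\<theta>\<in>Theta m. bdd_above ((\<lambda>x. linf (dimT m) (wgt0 m \<theta> x)) ` setX m))"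

definition wgt0_norm :: "ssm \<Rightarrow> vec \<Rightarrow> real" where
  "wgt0_norm m \<theta> = (SUP x\<in>setX m. linf (dimT m) (wgt0 m \<theta> x))"

definition test_function :: "ssm \<Rightarrow> (vec \<Rightarrow> real) \<Rightarrow> bool" where
  "test_function m \<phi> \<longleftrightarrow> \<phi> \<in> borel_measurable (spX m) \<and> \<phi> ` setX m \<subseteq> {-1..1}"

end

theory Submission
  imports Defs
begin

text \<open>
  The bias telescopes along the time steps: replacing the particles at time \<open>k\<close> by the law from which
  they are drawn, and running the exact filter over the remaining \<open>j = n - k\<close> steps, changes the
  expectation by the bias of a smooth function of empirical means of independent particles. The first
  order term has mean zero, so what is left is of order \<open>1 / N\<close>, times the product of
  the oscillations of the functions averaged. By Doeblin's condition those of the normalised filter are of order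
  \<open>\<rho>\<^sup>j\<close>, and the sum over \<open>k\<close> is bounded.

  For the derivative, the terminal functional is the derivative of a quotient, which does not
  change when a constant is added to the test function or to the weights. Only the oscillation of the
  weights matters, and it obeys \<open>D' \<le> \<Gamma> + \<rho> D\<close>, which forgets the initial weights geometrically. After
  centring, every term is of order \<open>(j + 1) \<rho>\<^sup>j (1 + \<rho>\<^sup>k \<parallel>w\<parallel>)\<close>.
\<close>

section \<open>Integration against signed measures\<close>

text \<open>The telescope rests on an exact identity. Given the history, the next particles are an
  i.i.d. sample, and their weights are the values of one fixed function at the sampled points. The
  denominator of that function is, up to a constant, the density from which the particles are drawn,
  so integration over the new particle turns the weight recursion into the product rule for one step
  of the filter. Each term of the telescope is thus the bias of a quotient of empirical means of
  independent variables.

  The obstacle is the size of likelihoods, which may vary exponentially with the number of steps.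
  Only their ratios between two starting points are controlled, by 1/\<delta>^2 with \<delta> =
  \<epsilon>^2, so every estimate concerns quotients. The same \<delta> gives \<rho> = 1 -
  \<delta>^2, and bounded gradients give |g| \<le> \<Gamma> f with \<Gamma> = 2 K / \<epsilon>.

  The contributions of the initial weights all carry the factor \<rho>^n, whatever the time of the
  replacement. Summing them leaves a factor quadratic in n, which is absorbed by taking sqrt \<rho>
  as the final rate.\<close>

lemma upper_variation_density:
  assumes sets: "sets L = sets M" and s: "integrable L s"
    and \<zeta>: "\<And>B. B \<in> sets M \<Longrightarrow> \<zeta> B = (LINT x:B|L. s x)"
  shows "upper_variation M \<zeta> = density L (\<lambda>x. ennreal (s x))"
proof -
  have sp: "space L = space M" using sets by (rule sets_eq_imp_space_eq)
  have [measurable]: "s \<in> borel_measurable L" using s by auto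
  have eq: "(SUP B\<in>{B \<in> sets M. B \<subseteq> A}. ennreal (\<zeta> B)) = emeasure (density L (\<lambda>x. ennreal (s x))) A"
    if A: "A \<in> sets M" for A
  proof (rule SUP_eqI)
    have [measurable]: "A \<in> sets L" using A sets by simp
    have pos: "emeasure (density L (\<lambda>x. ennreal (s x))) B = ennreal (LINT x:B|L. max 0 (s x))"
      if [measurable]: "B \<in> sets L" for B
    proof -
      have "emeasure (density L (\<lambda>x. ennreal (s x))) B = (\<integral>\<^sup>+x. ennreal (indicator B x * max 0 (s x)) \<partial>L)"
        by (subst emeasure_density) (auto intro!: nn_integral_cong simp: indicator_def max_def ennreal_neg)
      also have "\<dots> = ennreal (LINT x|L. indicator B x * max 0 (s x))"
        by (rule nn_integral_eq_integral)
           (auto intro!: integrable_real_mult_indicator[of _ _ "\<lambda>x. max 0 (s x)", simplified mult.commute] s)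
      finally show ?thesis by (simp add: set_lebesgue_integral_def)
    qed
    have si: "set_integrable L B s" "set_integrable L B (\<lambda>x. max 0 (s x))" if "B \<in> sets L" for B
      using s that unfolding set_integrable_def by (intro integrable_mult_indicator; simp)+
    {
      fix B assume "B \<in> {B \<in> sets M. B \<subseteq> A}"
      then have B: "B \<in> sets L" "B \<subseteq> A" "B \<in> sets M" using sets by auto
      have "\<zeta> B \<le> (LINT x:B|L. max 0 (s x))"
        unfolding \<zeta>[OF B(3)] by (intro set_integral_mono si B) auto
      then have "ennreal (\<zeta> B) \<le> emeasure (density L (\<lambda>x. ennreal (s x))) B"
        unfolding pos[OF B(1)] by (rule ennreal_leI)
      also have "\<dots> \<le> emeasure (density L (\<lambda>x. ennreal (s x))) A"
        using B by (intro emeasure_mono) auto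
      finally show "ennreal (\<zeta> B) \<le> emeasure (density L (\<lambda>x. ennreal (s x))) A" .
    }
    fix y assume y: "\<And>i. i \<in> {B \<in> sets M. B \<subseteq> A} \<Longrightarrow> ennreal (\<zeta> i) \<le> y"
    \<comment> \<open>The positive set of a Hahn decomposition, cut down to \<open>A\<close>: the
      supremum is attained there, which gives the reverse inequality.\<close>
    define B where "B = {x \<in> space L. 0 \<le> s x} \<inter> A"
    have B: "B \<in> sets L" unfolding B_def by measurable
    have "\<zeta> B = (LINT x:A|L. max 0 (s x))"
      using B sets \<zeta> sets.sets_into_space[OF A] sp
      by (auto simp: set_lebesgue_integral_def B_def indicator_def max_def intro!: Bochner_Integration.integral_cong)
    with y[of B] B sets show "emeasure (density L (\<lambda>x. ennreal (s x))) A \<le> y"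
      by (auto simp: pos B_def)
  qed
  have "upper_variation M \<zeta> =
      measure_of (space L) (sets L) (emeasure (density L (\<lambda>x. ennreal (s x))))"
    unfolding upper_variation_def sp sets
    by (rule measure_of_eq) (auto simp: sets.space_closed sets.sigma_sets_eq eq)
  also have "\<dots> = density L (\<lambda>x. ennreal (s x))"
    using measure_of_of_measure[of "density L (\<lambda>x. ennreal (s x))"] by simp
  finally show ?thesis .
qed

text \<open>The two variations have the densities s^+ and s^- with respect to \<open>L\<close>, and
  s^+ - s^- = s. Boundedness of \<open>f\<close> makes both integrals finite, so that they may be
  subtracted.\<close>

lemma signed_integral_density:
  assumes sets: "sets L = sets M" and s: "integrable L s"
    and \<zeta>: "\<And>B. B \<in> sets M \<Longrightarrow> \<zeta> B = (LINT x:B|L. s x)"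
    and f[measurable]: "f \<in> borel_measurable M" and b: "\<And>x. x \<in> space M \<Longrightarrow> \<bar>f x\<bar> \<le> C"
  shows "signed_integral M \<zeta> f = (LINT x|L. s x * f x)"
proof -
  have sp: "space L = space M" using sets by (rule sets_eq_imp_space_eq)
  have [measurable]: "s \<in> borel_measurable L" using s by auto
  have fm[measurable]: "f \<in> borel_measurable L" using f sets by (simp cong: measurable_cong_sets)
  have 1: "upper_variation M \<zeta> = density L (\<lambda>x. ennreal (s x))"
    by (rule upper_variation_density[OF sets s \<zeta>])
  have 2: "upper_variation M (\<lambda>A. - \<zeta> A) = density L (\<lambda>x. ennreal (- s x))"
    by (rule upper_variation_density[OF sets]) (use s \<zeta> in \<open>auto simp: set_lebesgue_integral_def\<close>)
  have d: "(LINT x|density L (\<lambda>x. ennreal (t x)). f x) = (LINT x|L. max 0 (t x) * f x)"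
    if [measurable]: "t \<in> borel_measurable L" for t
  proof -
    \<comment> \<open>\<open>ennreal\<close> already sends negative values to 0. Writing this as
      \<open>max 0\<close> supplies the nonnegative density that the integral formula asks
      for.\<close>
    have "density L (\<lambda>x. ennreal (t x)) = density L (\<lambda>x. ennreal (max 0 (t x)))"
      by (rule density_cong) (auto simp: max_def ennreal_neg)
    then show ?thesis by (subst integral_real_density[symmetric]) auto
  qed
  have i: "integrable L (\<lambda>x. t x * f x)" if t: "integrable L t" for t
  proof (rule Bochner_Integration.integrable_bound)
    show "integrable L (\<lambda>x. C * t x)" using t by simp
    show "(\<lambda>x. t x * f x) \<in> borel_measurable L" using t by simp
    show "AE x in L. norm (t x * f x) \<le> norm (C * t x)"
    proof (intro AE_I2)
      fix x assume "x \<in> space L"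
      then have "\<bar>f x\<bar> \<le> \<bar>C\<bar>" using b sp by force
      then have "\<bar>f x\<bar> * \<bar>t x\<bar> \<le> \<bar>C\<bar> * \<bar>t x\<bar>" by (rule mult_right_mono) auto
      then show "norm (t x * f x) \<le> norm (C * t x)" by (simp add: abs_mult mult.commute)
    qed
  qed
  show ?thesis
    unfolding signed_integral_def 1 2
  proof (subst (1 2) d, simp, simp, subst Bochner_Integration.integral_diff[symmetric])
    show "integrable L (\<lambda>x. max 0 (s x) * f x)" "integrable L (\<lambda>x. max 0 (- s x) * f x)"
      using s by (intro i; simp)+
  qed (auto intro!: Bochner_Integration.integral_cong simp: max_def)
qed

text \<open>The conditional expectation of \<open>g\<close> given \<open>X\<close> supplies a density of the signed measure.\<close>

lemma signed_integral_distr: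
  fixes g :: "'b \<Rightarrow> real"
  assumes g: "integrable P g" and X[measurable]: "X \<in> P \<rightarrow>\<^sub>M M"
    and \<zeta>: "\<And>B. B \<in> sets M \<Longrightarrow> \<zeta> B = (LINT \<omega>|P. g \<omega> * indicator B (X \<omega>))"
    and f[measurable]: "f \<in> borel_measurable M" and b: "\<And>x. x \<in> space M \<Longrightarrow> \<bar>f x\<bar> \<le> C"
  shows "signed_integral M \<zeta> f = (LINT \<omega>|P. g \<omega> * f (X \<omega>))"
proof -
  have [measurable]: "g \<in> borel_measurable P" using g by auto
  define im where "im t = distr (density P (\<lambda>\<omega>. ennreal (t \<omega>))) M X" for t :: "'b \<Rightarrow> real"
  have fin: "finite_measure (im t)" if t: "integrable P t" "\<And>\<omega>. 0 \<le> t \<omega>" for t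
  proof
    have [measurable]: "t \<in> borel_measurable P" using t by auto
    have "emeasure (im t) (space (im t)) = (\<integral>\<^sup>+\<omega>. ennreal (t \<omega>) \<partial>P)"
      unfolding im_def
      by (auto simp: emeasure_distr emeasure_density measurable_space[OF X] intro!: nn_integral_cong split: split_indicator)
    also have "\<dots> \<noteq> \<infinity>" using t by (simp add: nn_integral_eq_integral)
    finally show "emeasure (im t) (space (im t)) \<noteq> \<infinity>" .
  qed
  have int_im: "(LINT x|im t. h x) = (LINT \<omega>|P. t \<omega> * h (X \<omega>))"
    if [measurable]: "t \<in> borel_measurable P" "h \<in> borel_measurable M" and "\<And>\<omega>. 0 \<le> t \<omega>" for t h
    unfolding im_def by (simp add: integral_distr integral_real_density that)
  define gp gn where "gp \<omega> = max 0 (g \<omega>)" and "gn \<omega> = max 0 (- g \<omega>)" for \<omega>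
  have gpn: "integrable P gp" "integrable P gn" using g unfolding gp_def gn_def by simp_all
  note [measurable] = borel_measurable_integrable[OF gpn(1)] borel_measurable_integrable[OF gpn(2)]
  \<comment> \<open>The image of |g| P under \<open>X\<close> is finite and dominates the images of
    g^+ P and g^- P, so both have Radon-Nikodym derivatives with respect to it. Their difference is
    a density of \<zeta>, also when \<open>X\<close> is not injective.\<close>
  define L where "L = im (\<lambda>\<omega>. \<bar>g \<omega>\<bar>)"
  interpret L: finite_measure L unfolding L_def by (rule fin) (use g in auto)
  have sets: "sets L = sets M" unfolding L_def im_def by simp
  have ac: "absolutely_continuous L (im t)"
    if [measurable]: "t \<in> borel_measurable P" and t: "\<And>\<omega>. 0 \<le> t \<omega>" "\<And>\<omega>. t \<omega> \<le> \<bar>g \<omega>\<bar>" for t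
  proof (unfold absolutely_continuous_def, rule subsetI)
    fix B assume "B \<in> null_sets L"
    then have B: "B \<in> sets M" "emeasure L B = 0" using sets by auto
    have "emeasure (im t) B \<le> emeasure L B"
      unfolding im_def L_def using B
      by (auto simp: emeasure_distr emeasure_density intro!: nn_integral_mono ennreal_leI mult_right_mono t)
    with B show "B \<in> null_sets (im t)" by (auto simp: im_def null_sets_def)
  qed
  have acs: "absolutely_continuous L (im gp)" "absolutely_continuous L (im gn)"
    by (auto intro!: ac simp: gp_def gn_def)
  interpret p: finite_measure "im gp" by (rule fin) (use gpn in \<open>auto simp: gp_def\<close>)
  interpret n: finite_measure "im gn" by (rule fin) (use gpn in \<open>auto simp: gn_def\<close>)
  define s where "s x = enn2real (RN_deriv L (im gp) x) - enn2real (RN_deriv L (im gn) x)" for x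
  have setsim: "sets (im t) = sets L" for t by (simp add: sets) (simp add: im_def)
  have hL: "h \<in> borel_measurable L" if "h \<in> borel_measurable M" for h :: "'a \<Rightarrow> real"
    using that sets by (simp cong: measurable_cong_sets)
  have sint: "integrable L (\<lambda>x. s x * h x)" "(LINT x|L. s x * h x) = (LINT \<omega>|P. g \<omega> * h (X \<omega>))"
    if [measurable]: "h \<in> borel_measurable M" and hb: "\<And>x. x \<in> space M \<Longrightarrow> \<bar>h x\<bar> \<le> D" for h D
  proof -
    have ih: "integrable (im gp) h" "integrable (im gn) h"
    proof -
      have m: "h \<in> borel_measurable (im t)" "space (im t) = space M" for t
        unfolding im_def by simp_all
      show "integrable (im gp) h" "integrable (im gn) h"
        by (rule p.integrable_const_bound[of _ D] n.integrable_const_bound[of _ D]; auto simp: m hb)+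
    qed
    have ip: "integrable L (\<lambda>x. enn2real (RN_deriv L (im gp) x) * h x)"
      using L.RN_deriv_integrable[OF p.sigma_finite_measure_axioms acs(1) setsim hL] ih by simp
    have inn: "integrable L (\<lambda>x. enn2real (RN_deriv L (im gn) x) * h x)"
      using L.RN_deriv_integrable[OF n.sigma_finite_measure_axioms acs(2) setsim hL] ih by simp
    show "integrable L (\<lambda>x. s x * h x)"
      unfolding s_def left_diff_distrib using ip inn by simp
    have "(LINT x|L. s x * h x) = (LINT x|im gp. h x) - (LINT x|im gn. h x)"
      unfolding s_def left_diff_distrib
      using ip inn L.RN_deriv_integral[OF p.sigma_finite_measure_axioms acs(1) setsim hL, of h]
         L.RN_deriv_integral[OF n.sigma_finite_measure_axioms acs(2) setsim hL, of h] by simp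
    also have "\<dots> = (LINT \<omega>|P. gp \<omega> * h (X \<omega>)) - (LINT \<omega>|P. gn \<omega> * h (X \<omega>))"
      by (simp add: int_im gp_def gn_def)
    also have "\<dots> = (LINT \<omega>|P. gp \<omega> * h (X \<omega>) - gn \<omega> * h (X \<omega>))"
    proof (rule Bochner_Integration.integral_diff[symmetric])
      have "integrable P (\<lambda>\<omega>. t \<omega> * h (X \<omega>))" if t: "integrable P t" for t
      proof (rule Bochner_Integration.integrable_bound[of _ "\<lambda>\<omega>. D * t \<omega>"])
        show "(\<lambda>\<omega>. t \<omega> * h (X \<omega>)) \<in> borel_measurable P" using t by simp
        show "AE \<omega> in P. norm (t \<omega> * h (X \<omega>)) \<le> norm (D * t \<omega>)"
        proof (intro AE_I2)
          fix \<omega> assume "\<omega> \<in> space P"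
          then have "\<bar>h (X \<omega>)\<bar> \<le> \<bar>D\<bar>" using hb measurable_space[OF X] by force
          then have "\<bar>h (X \<omega>)\<bar> * \<bar>t \<omega>\<bar> \<le> \<bar>D\<bar> * \<bar>t \<omega>\<bar>" by (rule mult_right_mono) auto
          then show "norm (t \<omega> * h (X \<omega>)) \<le> norm (D * t \<omega>)" by (simp add: abs_mult mult.commute)
        qed
      qed (use t in simp)
      then show "integrable P (\<lambda>\<omega>. gp \<omega> * h (X \<omega>))" "integrable P (\<lambda>\<omega>. gn \<omega> * h (X \<omega>))"
        using gpn by auto
    qed
    also have "\<dots> = (LINT \<omega>|P. g \<omega> * h (X \<omega>))"
      by (rule Bochner_Integration.integral_cong) (auto simp: gp_def gn_def max_def)
    finally show "(LINT x|L. s x * h x) = (LINT \<omega>|P. g \<omega> * h (X \<omega>))" .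
  qed
  have "signed_integral M \<zeta> f = (LINT x|L. s x * f x)"
  proof (rule signed_integral_density[OF sets _ _ f b])
    show "integrable L s" using sint(1)[of "\<lambda>_. 1" 1] by simp
    fix B assume B: "B \<in> sets M"
    then have "(LINT x|L. s x * indicator B x) = \<zeta> B"
      using sint(2)[of "indicator B" 1] by (simp add: \<zeta>)
    then show "\<zeta> B = (LINT x:B|L. s x)" by (simp add: set_lebesgue_integral_def mult.commute)
  qed
  with sint(2)[OF f b] show ?thesis by simp
qed

section \<open>Empirical means\<close>

declare One_nat_def [simp del]

definition emp_mean :: "nat \<Rightarrow> ('a \<Rightarrow> real) \<Rightarrow> (nat \<Rightarrow> 'a) \<Rightarrow> real" where
  "emp_mean N a X = (\<Sum>i=1..N. a (X i)) / real N"

lemma emp_mean_measurable[measurable]: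
  "a \<in> borel_measurable P \<Longrightarrow> emp_mean N a \<in> borel_measurable (\<Pi>\<^sub>M i\<in>{1..N}. P)"
  unfolding emp_mean_def[abs_def]
  by (intro borel_measurable_divide borel_measurable_sum borel_measurable_const
      measurable_compose[OF measurable_component_singleton]) auto

lemma emp_mean_bounds:
  assumes "N \<ge> 1" "\<And>i. i \<in> {1..N} \<Longrightarrow> l \<le> a (X i)" "\<And>i. i \<in> {1..N} \<Longrightarrow> a (X i) \<le> u"
  shows "l \<le> emp_mean N a X" "emp_mean N a X \<le> u"
proof -
  have "(\<Sum>i=1..N. l) \<le> (\<Sum>i=1..N. a (X i))" "(\<Sum>i=1..N. a (X i)) \<le> (\<Sum>i=1..N. u)"
    using assms(2,3) by (intro sum_mono; blast)+
  with assms(1) show "l \<le> emp_mean N a X" "emp_mean N a X \<le> u"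
    by (auto simp: emp_mean_def field_simps)
qed

lemma emp_mean_abs_bound:
  assumes "N \<ge> 1" "\<And>i. i \<in> {1..N} \<Longrightarrow> \<bar>a (X i)\<bar> \<le> A"
  shows "\<bar>emp_mean N a X\<bar> \<le> A"
  using emp_mean_bounds[of N "- A" a X A] assms by (force simp: abs_le_iff)

context prob_space
begin

lemma prob_space_PiM_power: "prob_space (\<Pi>\<^sub>M i\<in>I. M)"
  by (rule prob_space_PiM) unfold_locales

lemma integrable_PiM_bounded:
  assumes "a \<in> borel_measurable (\<Pi>\<^sub>M i\<in>I. M)" "\<And>X. X \<in> space (\<Pi>\<^sub>M i\<in>I. M) \<Longrightarrow> \<bar>a X\<bar> \<le> (C::real)"
  shows "integrable (\<Pi>\<^sub>M i\<in>I. M) a"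
proof -
  interpret P: prob_space "\<Pi>\<^sub>M i\<in>I. M" by (rule prob_space_PiM_power)
  show ?thesis using assms by (intro P.integrable_const_bound[of _ C]) auto
qed

lemma integral_PiM_component:
  assumes "i \<in> I" "a \<in> borel_measurable M"
  shows "(LINT X|(\<Pi>\<^sub>M i\<in>I. M). a (X i) :: real) = (LINT x|M. a x)"
proof -
  have "(LINT x|M. a x) = (LINT x|distr (\<Pi>\<^sub>M i\<in>I. M) M (\<lambda>X. X i). a x)"
    by (subst distr_PiM_component) (auto simp: assms prob_space_axioms)
  also have "\<dots> = (LINT X|(\<Pi>\<^sub>M i\<in>I. M). a (X i))"
    using assms by (subst integral_distr) auto
  finally show ?thesis by simp
qed

lemma integral_emp_mean:
  assumes a[measurable]: "a \<in> borel_measurable M" and A: "\<And>x. x \<in> space M \<Longrightarrow> \<bar>a x\<bar> \<le> A" and N: "N \<ge> 1"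
  shows "(LINT X|(\<Pi>\<^sub>M i\<in>{1..N}. M). emp_mean N a X) = (LINT x|M. a x)"
proof -
  have "integrable (\<Pi>\<^sub>M i\<in>{1..N}. M) (\<lambda>X. a (X i))" if "i \<in> {1..N}" for i
    using that by (intro integrable_PiM_bounded[of _ _ A]) (auto simp: space_PiM intro!: A)
  then show ?thesis
    using N unfolding emp_mean_def
    by (simp add: integral_PiM_component)
qed

text \<open>By independence the products of two different coordinates integrate to zero, which
  leaves N of the N^2 terms of the squared sum.\<close>

lemma integral_emp_mean_square:
  assumes a[measurable]: "a \<in> borel_measurable M" and A: "\<And>x. x \<in> space M \<Longrightarrow> \<bar>a x\<bar> \<le> A"
    and mean: "(LINT x|M. a x) = 0" and N: "N \<ge> 1"
  shows "(LINT X|(\<Pi>\<^sub>M i\<in>{1..N}. M). (emp_mean N a X)\<^sup>2) \<le> A\<^sup>2 / N"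
proof -
  let ?P = "\<Pi>\<^sub>M i\<in>{1..N}. M"
  interpret P: prob_space ?P by (rule prob_space_PiM_power)
  interpret pp: product_prob_space "\<lambda>_::nat. M" by unfold_locales
  have bnd: "\<bar>a (X i) * a (X j)\<bar> \<le> A\<^sup>2" if "X \<in> space ?P" "i \<in> {1..N}" "j \<in> {1..N}" for X i j
    using that unfolding power2_eq_square abs_mult
    by (intro mult_mono) (auto simp: space_PiM intro!: A order_trans[OF abs_ge_zero A])
  have int: "integrable ?P (\<lambda>X. a (X i) * a (X j))" if "i \<in> {1..N}" "j \<in> {1..N}" for i j
    using that bnd by (intro integrable_PiM_bounded[of _ _ "A\<^sup>2"]) auto
  have off: "(LINT X|?P. a (X i) * a (X j)) = 0" if ij: "i \<in> {1..N}" "j \<in> {1..N}" "i \<noteq> j" for i j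
  proof -
    \<comment> \<open>Constant factors 1 at the other coordinates turn a product of two coordinates
      into a product over all of them, whose integral factorises.\<close>
    define F where "F k = (if k = i \<or> k = j then a else (\<lambda>_. 1))" for k
    have [measurable]: "F k \<in> borel_measurable M" for k by (simp add: F_def)
    have "(\<Prod>k\<in>{1..N}. F k (X k)) = a (X i) * a (X j)" for X
    proof -
      have "(\<Prod>k\<in>{1..N}. F k (X k)) = (\<Prod>k\<in>{i, j}. F k (X k))"
        using ij by (intro prod.mono_neutral_right) (auto simp: F_def)
      then show ?thesis using ij by (simp add: F_def)
    qed
    then have "(LINT X|?P. a (X i) * a (X j)) = (LINT X|?P. (\<Prod>k\<in>{1..N}. F k (X k)))" by simp
    also have "\<dots> = (\<Prod>k\<in>{1..N}. (LINT x|M. F k x))"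
    proof (rule pp.product_integral_prod)
      fix k show "integrable M (F k)"
        by (rule integrable_const_bound[of _ "max A 1"]) (auto simp: F_def le_max_iff_disj A)
    qed simp
    also have "\<dots> = 0" using ij mean by (auto simp: F_def intro!: bexI[of _ i])
    finally show ?thesis .
  qed
  have diag: "(LINT X|?P. a (X i) * a (X i)) \<le> A\<^sup>2" if "i \<in> {1..N}" for i
  proof -
    have "(LINT X|?P. a (X i) * a (X i)) \<le> (LINT X|?P. A\<^sup>2)"
      using that bnd[OF _ that that] by (intro integral_mono int P.integrable_const) (auto simp: abs_le_iff)
    then show ?thesis by (simp add: P.prob_space)
  qed
  have "(LINT X|?P. (emp_mean N a X)\<^sup>2) = (LINT X|?P. (\<Sum>i=1..N. \<Sum>j=1..N. a (X i) * a (X j)) / N\<^sup>2)"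
    by (simp add: emp_mean_def power2_eq_square sum_product)
  also have "\<dots> = (LINT X|?P. (\<Sum>i=1..N. \<Sum>j=1..N. a (X i) * a (X j))) / N\<^sup>2"
    by simp
  also have "(LINT X|?P. (\<Sum>i=1..N. \<Sum>j=1..N. a (X i) * a (X j))) / N\<^sup>2 =
      (\<Sum>i=1..N. LINT X|?P. (\<Sum>j=1..N. a (X i) * a (X j))) / N\<^sup>2"
    by (intro arg_cong[where f="\<lambda>t. t / real (N\<^sup>2)"] Bochner_Integration.integral_sum Bochner_Integration.integrable_sum int)
  also have "\<dots> = (\<Sum>i=1..N. \<Sum>j=1..N. LINT X|?P. a (X i) * a (X j)) / N\<^sup>2"
    by (intro arg_cong[where f="\<lambda>t. t / real (N\<^sup>2)"] sum.cong refl Bochner_Integration.integral_sum int)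
  also have "\<dots> \<le> (\<Sum>i=1..N. A\<^sup>2) / N\<^sup>2"
  proof (intro divide_right_mono sum_mono)
    fix i assume i: "i \<in> {1..N}"
    have "(\<Sum>j=1..N. LINT X|?P. a (X i) * a (X j)) = (\<Sum>j\<in>{i}. LINT X|?P. a (X i) * a (X j))"
      using i off by (intro sum.mono_neutral_right) auto
    then show "(\<Sum>j=1..N. LINT X|?P. a (X i) * a (X j)) \<le> A\<^sup>2" using diag[OF i] by simp
  qed simp
  also have "\<dots> = A\<^sup>2 / N" using N by (simp add: power2_eq_square)
  finally show ?thesis .
qed

text \<open>A substitute for Cauchy-Schwarz: 2 |a b| \<le> (B/A) a^2 + (A/B) b^2 is balanced so that
  both variances contribute equally. The absolute value stands inside the integral because the
  product is later multiplied by a bounded random denominator.\<close>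

lemma integral_emp_mean_product:
  assumes a[measurable]: "a \<in> borel_measurable M" and A: "\<And>x. x \<in> space M \<Longrightarrow> \<bar>a x\<bar> \<le> A"
    and b[measurable]: "b \<in> borel_measurable M" and B: "\<And>x. x \<in> space M \<Longrightarrow> \<bar>b x\<bar> \<le> B"
    and mean: "(LINT x|M. a x) = 0" "(LINT x|M. b x) = 0" and N: "N \<ge> 1"
  shows "(LINT X|(\<Pi>\<^sub>M i\<in>{1..N}. M). \<bar>emp_mean N a X * emp_mean N b X\<bar>) \<le> A * B / N"
proof -
  let ?P = "\<Pi>\<^sub>M i\<in>{1..N}. M"
  have bounds: "\<bar>emp_mean N c X\<bar> \<le> C"
    if "X \<in> space ?P" "\<And>x. x \<in> space M \<Longrightarrow> \<bar>c x\<bar> \<le> C" for c C X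
      proof (rule emp_mean_abs_bound[OF N])
    fix i assume "i \<in> {1..N}"
    then have "X i \<in> space M" using that(1) by (auto simp: space_PiM)
    then show "\<bar>c (X i)\<bar> \<le> C" by (rule that(2))
  qed
  obtain x0 where x0: "x0 \<in> space M" using not_empty by auto
  then have nonneg: "0 \<le> A" "0 \<le> B" using order_trans[OF abs_ge_zero A] order_trans[OF abs_ge_zero B] by auto
  show ?thesis
  \<comment> \<open>The balancing weights need nonzero bounds. If one bound is 0, the integrand
    vanishes.\<close>
  proof (cases "A = 0 \<or> B = 0")
    case True
    then have "(LINT X|?P. \<bar>emp_mean N a X * emp_mean N b X\<bar>) = (LINT X|?P. 0)"
      using bounds[OF _ A] bounds[OF _ B] by (intro Bochner_Integration.integral_cong) force+
    with True show ?thesis by auto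
  next
    case False
    with nonneg have AB: "0 < A" "0 < B" by auto
    have i: "integrable ?P (\<lambda>X. (emp_mean N c X)\<^sup>2)"
      if [measurable]: "c \<in> borel_measurable M" and C: "\<And>x. x \<in> space M \<Longrightarrow> \<bar>c x\<bar> \<le> C" for c C
    proof (rule integrable_PiM_bounded)
      show "\<bar>(emp_mean N c X)\<^sup>2\<bar> \<le> C\<^sup>2" if "X \<in> space ?P" for X
        using power_mono[OF bounds[OF that C] abs_ge_zero, where n=2] by simp
    qed measurable
    have "\<bar>emp_mean N a X * emp_mean N b X\<bar> \<le> (B / A * (emp_mean N a X)\<^sup>2 + A / B * (emp_mean N b X)\<^sup>2) / 2" for X
    proof -
      have "0 \<le> (B * \<bar>emp_mean N a X\<bar> - A * \<bar>emp_mean N b X\<bar>)\<^sup>2" by simp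
      then have "2 * (A * B) * \<bar>emp_mean N a X * emp_mean N b X\<bar> \<le> B\<^sup>2 * (emp_mean N a X)\<^sup>2 + A\<^sup>2 * (emp_mean N b X)\<^sup>2"
        by (simp add: power2_diff power_mult_distrib abs_mult algebra_simps)
      then show ?thesis using AB by (simp add: field_simps power2_eq_square)
    qed
    then have "(LINT X|?P. \<bar>emp_mean N a X * emp_mean N b X\<bar>) \<le>
        (LINT X|?P. (B / A * (emp_mean N a X)\<^sup>2 + A / B * (emp_mean N b X)\<^sup>2) / 2)"
      using i[OF a A] i[OF b B] by (intro integral_mono')
        (auto intro!: add_nonneg_nonneg divide_nonneg_nonneg mult_nonneg_nonneg simp: nonneg)
    also have "\<dots> = (B / A * (LINT X|?P. (emp_mean N a X)\<^sup>2) + A / B * (LINT X|?P. (emp_mean N b X)\<^sup>2)) / 2"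
      using i[OF a A] i[OF b B] by simp
    also have "\<dots> \<le> (B / A * (A\<^sup>2 / N) + A / B * (B\<^sup>2 / N)) / 2"
      using AB by (intro divide_right_mono add_mono mult_left_mono
          integral_emp_mean_square[OF a A mean(1) N] integral_emp_mean_square[OF b B mean(2) N]) auto
    also have "\<dots> = A * B / N" using AB N by (simp add: power2_eq_square)
    finally show ?thesis .
  qed
qed

end

lemma emp_mean_cmult: "emp_mean N (\<lambda>x. t * a x) X = t * emp_mean N a X"
  by (simp add: emp_mean_def sum_distrib_left)

lemma emp_mean_diff: "emp_mean N (\<lambda>x. a x - b x) X = emp_mean N a X - emp_mean N b X"
  by (simp add: emp_mean_def sum_subtractf diff_divide_distrib)

text \<open>Boxes form an intersection-stable generator, and on a box the product measure is a
  finite product of functions measurable in the parameter. This makes the simultaneous draw of all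
  particles a kernel in the history.\<close>

lemma measurable_PiM_prob_algebra:
  assumes I: "finite I" and K: "K \<in> L \<rightarrow>\<^sub>M prob_algebra S"
  shows "(\<lambda>h. \<Pi>\<^sub>M i\<in>I. K h) \<in> L \<rightarrow>\<^sub>M prob_algebra (\<Pi>\<^sub>M i\<in>I. S)"
proof (rule measurable_prob_algebra_generated)
  have K': "prob_space (K h)" "sets (K h) = sets S" if "h \<in> space L" for h
    using measurable_space[OF K that] by (auto simp: space_prob_algebra)
  show "sets (\<Pi>\<^sub>M i\<in>I. S) = sigma_sets (\<Pi>\<^sub>E i\<in>I. space S) {Pi\<^sub>E I E | E. \<forall>i\<in>I. E i \<in> sets S}"
    unfolding sets_PiM prod_algebra_eq_finite[OF I] by (simp add: Pi_iff)
  show "Int_stable {Pi\<^sub>E I E | E. \<forall>i\<in>I. E i \<in> sets S}"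
    by (rule Int_stable_PiE)
  show "{Pi\<^sub>E I E | E. \<forall>i\<in>I. E i \<in> sets S} \<subseteq> Pow (\<Pi>\<^sub>E i\<in>I. space S)"
    by (auto simp: PiE_iff) (metis sets.sets_into_space subsetD)
  show "prob_space (\<Pi>\<^sub>M i\<in>I. K h)" if "h \<in> space L" for h
    by (rule prob_space_PiM) (rule K'[OF that])
  show "sets (\<Pi>\<^sub>M i\<in>I. K h) = sets (\<Pi>\<^sub>M i\<in>I. S)" if "h \<in> space L" for h
    by (rule sets_PiM_cong) (auto simp: K'[OF that])
  fix A assume "A \<in> {Pi\<^sub>E I E | E. \<forall>i\<in>I. E i \<in> sets S}"
  then obtain E where E: "A = Pi\<^sub>E I E" "\<And>i. i \<in> I \<Longrightarrow> E i \<in> sets S" by auto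
  have "emeasure (\<Pi>\<^sub>M i\<in>I. K h) A = (\<Prod>i\<in>I. emeasure (K h) (E i))" if h: "h \<in> space L" for h
  proof -
    interpret prob_space "K h" by (rule K'[OF h])
    interpret product_sigma_finite "\<lambda>_. K h" by unfold_locales
    show ?thesis unfolding E(1) using E(2) K'(2)[OF h] by (intro emeasure_PiM I) simp
  qed
  moreover have "(\<lambda>h. \<Prod>i\<in>I. emeasure (K h) (E i)) \<in> borel_measurable L"
  proof (rule borel_measurable_prod_ennreal)
    fix i assume "i \<in> I"
    with E have "(\<lambda>M. emeasure M (E i)) \<in> borel_measurable (subprob_algebra S)" by simp
    from measurable_compose[OF measurable_prob_algebraD[OF K] this]
    show "(\<lambda>h. emeasure (K h) (E i)) \<in> borel_measurable L" .
  qed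
  ultimately show "(\<lambda>h. emeasure (\<Pi>\<^sub>M i\<in>I. K h) A) \<in> borel_measurable L"
    by (simp cong: measurable_cong)
qed

section \<open>Ratios of empirical means\<close>

lemma abs_diff_near:
  fixes a b c D E :: real
  shows "\<bar>a - c\<bar> \<le> D \<Longrightarrow> \<bar>b - c\<bar> \<le> E \<Longrightarrow> \<bar>a - b\<bar> \<le> D + E"
  by linarith

lemma abs_integral_le:
  fixes a b :: "'a \<Rightarrow> real"
  assumes "integrable P a" "integrable P b" "\<And>x. x \<in> space P \<Longrightarrow> \<bar>a x\<bar> \<le> b x"
  shows "\<bar>LINT x|P. a x\<bar> \<le> (LINT x|P. b x)"
proof -
  have "\<bar>LINT x|P. a x\<bar> \<le> (LINT x|P. \<bar>a x\<bar>)" by (rule integral_abs_bound)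
  also have "\<dots> \<le> (LINT x|P. b x)" using assms by (intro integral_mono) auto
  finally show ?thesis .
qed

lemma (in prob_space) integrable_bounded:
  fixes a :: "'a \<Rightarrow> real"
  assumes "a \<in> borel_measurable M" "\<And>x. x \<in> space M \<Longrightarrow> \<bar>a x\<bar> \<le> C"
  shows "integrable M a"
  using assms by (intro integrable_const_bound[of _ C]) auto

text \<open>
  With \<open>a\<close>, \<open>b\<close>, \<open>c\<close>, \<open>e\<close> the integrals of an unnormalised filter and of its derivative against
  a test function (\<open>a\<close>, \<open>c\<close>) and against \<open>1\<close> (\<open>b\<close>, \<open>e\<close>), this is the derivative of the
  quotient \<open>a / b\<close>.
\<close>

definition quot_deriv :: "real \<Rightarrow> real \<Rightarrow> real \<Rightarrow> real \<Rightarrow> real" where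
  "quot_deriv a b c e = c / b - a * e / b\<^sup>2"

text \<open>Homogeneity of degree 0 lets the factor 1/N of empirical means and the normalising
  constant of a sampling density drop out.\<close>

lemma quot_deriv_scale: "t \<noteq> 0 \<Longrightarrow> quot_deriv (t * a) (t * b) (t * c) (t * e) = quot_deriv a b c e"
  by (simp add: quot_deriv_def power2_eq_square)

text \<open>
  The invariance under \<open>\<phi> \<mapsto> \<phi> - \<kappa>\<close> and under a shift of the weights by \<open>\<omega>\<close>, which allows both
  factors of the product to be centred.
\<close>

lemma quot_deriv_shift:
  assumes "b \<noteq> 0"
  shows "quot_deriv a b c e = (c - \<kappa> * e - \<omega> * (a - \<kappa> * b)) / b - (a - \<kappa> * b) / b * ((e - \<omega> * b) / b)"
  using assms by (simp add: quot_deriv_def field_simps power2_eq_square)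

text \<open>\<open>H\<close> will be the likelihood of future observations as a function of the
  current state. Its size is not controlled uniformly in the number of steps; only the ratio of two
  of its values is, by \<beta>.\<close>

locale bounded_ratio = prob_space +
  fixes H :: "'a \<Rightarrow> real" and \<beta> :: real
  assumes H_measurable[measurable]: "H \<in> borel_measurable M"
    and H_pos: "\<And>x. x \<in> space M \<Longrightarrow> 0 < H x"
    and H_ratio: "\<And>x z. x \<in> space M \<Longrightarrow> z \<in> space M \<Longrightarrow> H x \<le> \<beta> * H z"
begin

lemma H_bounded: obtains B where "\<And>x. x \<in> space M \<Longrightarrow> \<bar>H x\<bar> \<le> B"
proof -
  obtain x0 where "x0 \<in> space M" using not_empty by auto
  then show ?thesis using that[of "\<beta> * H x0"] H_ratio H_pos by (metis abs_of_pos)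
qed

lemma integrable_H_mult:
  assumes [measurable]: "z \<in> borel_measurable M" and Z: "\<And>x. x \<in> space M \<Longrightarrow> \<bar>z x\<bar> \<le> Z"
  shows "integrable M (\<lambda>x. H x * z x)"
proof -
  obtain B where B: "\<And>x. x \<in> space M \<Longrightarrow> \<bar>H x\<bar> \<le> B" by (rule H_bounded) auto
  show ?thesis
    using B Z by (intro integrable_bounded[of _ "B * Z"])
      (auto simp: abs_mult intro!: mult_mono order_trans[OF abs_ge_zero B])
qed

lemma integrable_H: "integrable M H"
  using integrable_H_mult[of "\<lambda>_. 1" 1] by simp

lemma beta_ge_1: "1 \<le> \<beta>"
proof -
  obtain x0 where "x0 \<in> space M" using not_empty by auto
  from H_ratio[OF this this] H_pos[OF this] show ?thesis by simp
qed

lemma integral_H_bounds: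
  assumes "x \<in> space M"
  shows "(LINT x|M. H x) \<le> \<beta> * H x" "H x \<le> \<beta> * (LINT x|M. H x)"
proof -
  have "(LINT x|M. H x) \<le> (LINT z|M. \<beta> * H x)"
    using assms by (intro integral_mono integrable_H integrable_const H_ratio)
  then show "(LINT x|M. H x) \<le> \<beta> * H x" by (simp add: prob_space)
  have "(LINT z|M. H x) \<le> (LINT z|M. \<beta> * H z)"
    using assms by (intro integral_mono integrable_mult_right integrable_H integrable_const H_ratio)
  then show "H x \<le> \<beta> * (LINT x|M. H x)" by (simp add: prob_space)
qed

lemma integral_H_pos: "0 < (LINT x|M. H x)"
proof -
  obtain x0 where x0: "x0 \<in> space M" using not_empty by auto
  from integral_H_bounds(2)[OF this] H_pos[OF this] have "0 < \<beta> * (LINT x|M. H x)" by linarith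
  then show ?thesis using beta_ge_1 by (simp add: zero_less_mult_iff)
qed

definition hmean :: "('a \<Rightarrow> real) \<Rightarrow> real" where
  "hmean z = (LINT x|M. H x * z x) / (LINT x|M. H x)"

text \<open>A mean with positive weights stays in the range of its values. It serves to replace an
  unspecified centre \<open>c\<close> by the actual mean \<open>hmean z\<close>, at the cost of a
  factor 2 in the oscillation.\<close>

lemma hmean_near:
  assumes [measurable]: "z \<in> borel_measurable M" and Z: "\<And>x. x \<in> space M \<Longrightarrow> \<bar>z x - c\<bar> \<le> Z"
  shows "\<bar>hmean z - c\<bar> \<le> Z"
proof -
  have i: "integrable M (\<lambda>x. H x * (z x - c))" by (rule integrable_H_mult) (use Z in auto)
  have "\<bar>z x\<bar> \<le> Z + \<bar>c\<bar>" if "x \<in> space M" for x using Z[OF that] by linarith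
  then have iz: "integrable M (\<lambda>x. H x * z x)" by (intro integrable_H_mult[of _ "Z + \<bar>c\<bar>"]) auto
  have "\<bar>LINT x|M. H x * (z x - c)\<bar> \<le> (LINT x|M. H x * Z)"
  proof (rule abs_integral_le[OF i])
    show "\<bar>H x * (z x - c)\<bar> \<le> H x * Z" if "x \<in> space M" for x
      using Z[OF that] H_pos[OF that] by (simp add: abs_mult)
  qed (use integrable_H in simp)
  also have "(LINT x|M. H x * (z x - c)) = (LINT x|M. H x * z x) - c * (LINT x|M. H x)"
    using iz integrable_H by (simp add: right_diff_distrib mult.commute)
  finally show ?thesis using integral_H_pos by (simp add: hmean_def field_simps abs_if split: if_splits)
qed

text \<open>Division by the mean turns the bound on ratios into the absolute bounds 1/\<beta> and
  \<beta>; the constant cancels in every quotient of empirical means.\<close>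

definition h :: "'a \<Rightarrow> real" where "h x = H x / (LINT x|M. H x)"

lemma h_measurable[measurable]: "h \<in> borel_measurable M"
  unfolding h_def[abs_def] by measurable

lemma h_bounds:
  assumes "x \<in> space M"
  shows "1 / \<beta> \<le> h x" "h x \<le> \<beta>" "0 < h x" "\<bar>h x - 1\<bar> \<le> \<beta>"
proof -
  show 1: "1 / \<beta> \<le> h x" and 2: "h x \<le> \<beta>"
    using integral_H_bounds[OF assms] integral_H_pos beta_ge_1 by (auto simp: h_def field_simps)
  show "0 < h x" using H_pos[OF assms] integral_H_pos by (simp add: h_def)
  with 2 beta_ge_1 show "\<bar>h x - 1\<bar> \<le> \<beta>" by linarith
qed

lemma integral_h: "(LINT x|M. h x) = 1"
  using integral_H_pos by (simp add: h_def)

lemma integral_h_mult: "(LINT x|M. h x * z x) = hmean z"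
  by (simp add: h_def hmean_def)

lemma emp_mean_h_bounds:
  assumes "N \<ge> 1" "X \<in> space (\<Pi>\<^sub>M i\<in>{1..N}. M)"
  shows "1 / \<beta> \<le> emp_mean N h X" "0 < emp_mean N h X"
proof -
  have "X i \<in> space M" if "i \<in> {1..N}" for i using assms(2) that by (auto simp: space_PiM)
  then show 1: "1 / \<beta> \<le> emp_mean N h X"
    using assms(1) by (intro emp_mean_bounds[of N _ _ _ \<beta>] h_bounds) auto
  have "0 < 1 / \<beta>" using beta_ge_1 by simp
  with 1 show "0 < emp_mean N h X" by linarith
qed

lemma emp_ratio_h: "emp_mean N (\<lambda>x. H x * z x) X / emp_mean N H X = emp_mean N (\<lambda>x. h x * z x) X / emp_mean N h X"
proof -
  let ?t = "LINT x|M. H x"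
  have "emp_mean N (\<lambda>x. H x * z x) X = ?t * emp_mean N (\<lambda>x. h x * z x) X"
    "emp_mean N H X = ?t * emp_mean N h X"
    unfolding emp_mean_cmult[symmetric] using integral_H_pos by (simp_all add: h_def)
  then show ?thesis using integral_H_pos by simp
qed

lemma emp_ratio_abs_le:
  assumes "N \<ge> 1" "X \<in> space (\<Pi>\<^sub>M i\<in>{1..N}. M)" and Z: "\<And>x. x \<in> space M \<Longrightarrow> \<bar>z x\<bar> \<le> Z"
  shows "\<bar>emp_mean N (\<lambda>x. H x * z x) X / emp_mean N H X\<bar> \<le> \<beta>\<^sup>2 * Z"
proof -
  have X: "X i \<in> space M" if "i \<in> {1..N}" for i using assms(2) that by (auto simp: space_PiM)
  have "\<bar>emp_mean N (\<lambda>x. h x * z x) X\<bar> \<le> \<beta> * Z"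
    using Z h_bounds(2,3)[OF X] X beta_ge_1
    by (intro emp_mean_abs_bound assms) (auto simp: abs_mult less_imp_le intro!: mult_mono)
  moreover have "1 / emp_mean N h X \<le> \<beta>"
    using emp_mean_h_bounds[OF assms(1,2)] beta_ge_1 by (simp add: field_simps)
  ultimately have "\<bar>emp_mean N (\<lambda>x. h x * z x) X\<bar> * (1 / emp_mean N h X) \<le> \<beta> * Z * \<beta>"
    using emp_mean_h_bounds[OF assms(1,2)] by (intro mult_mono) auto
  then show ?thesis using emp_mean_h_bounds[OF assms(1,2)]
    by (simp add: emp_ratio_h power2_eq_square abs_mult mult_ac)
qed

lemma integrable_emp_ratio:
  assumes [measurable]: "z \<in> borel_measurable M" and Z: "\<And>x. x \<in> space M \<Longrightarrow> \<bar>z x\<bar> \<le> Z" and N: "N \<ge> 1"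
  shows "integrable (\<Pi>\<^sub>M i\<in>{1..N}. M) (\<lambda>X. emp_mean N (\<lambda>x. H x * z x) X / emp_mean N H X)"
  by (rule integrable_PiM_bounded[OF _ emp_ratio_abs_le[OF N _ Z]]) auto

text \<open>With \<open>?a\<close> and \<open>?b\<close> the empirical means of
  \<open>h * z0\<close> and \<open>h - 1\<close>, both of mean zero, the error is a/(1+b) = a - a
  b/(1+b). The first term integrates to zero and the second is a product of two centred means. Of
  \<beta>^3, one factor bounds the reciprocal of the denominator, the others bound
  \<open>h * z0\<close> and \<open>h - 1\<close>.\<close>

lemma emp_ratio_bias:
  assumes [measurable]: "z \<in> borel_measurable M"
    and Z: "\<And>x. x \<in> space M \<Longrightarrow> \<bar>z x - hmean z\<bar> \<le> Z" and N: "N \<ge> 1"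
  shows "\<bar>(LINT X|(\<Pi>\<^sub>M i\<in>{1..N}. M). emp_mean N (\<lambda>x. H x * z x) X / emp_mean N H X) - hmean z\<bar> \<le> \<beta> ^ 3 * Z / N"
proof -
  let ?P = "\<Pi>\<^sub>M i\<in>{1..N}. M"
  interpret P: prob_space ?P by (rule prob_space_PiM_power)
  define z0 where "z0 x = z x - hmean z" for x
  let ?a = "emp_mean N (\<lambda>x. h x * z0 x)" and ?b = "emp_mean N (\<lambda>x. h x - 1)"
  have [measurable]: "z0 \<in> borel_measurable M" unfolding z0_def[abs_def] by simp
  have z0: "\<bar>h x * z0 x\<bar> \<le> \<beta> * Z" if "x \<in> space M" for x
    unfolding abs_mult z0_def using h_bounds[OF that] Z[OF that] beta_ge_1 by (intro mult_mono) auto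
  have zb: "\<bar>z x\<bar> \<le> Z + \<bar>hmean z\<bar>" if "x \<in> space M" for x using Z[OF that] by linarith
  have ih: "integrable M (\<lambda>x. h x * z x)" "integrable M h"
    using integrable_H_mult[OF _ zb] integrable_H unfolding h_def[abs_def] by auto
  have mean0: "(LINT x|M. h x * z0 x) = 0" "(LINT x|M. h x - 1) = 0"
    using ih by (simp_all add: z0_def right_diff_distrib integral_h_mult integral_h prob_space)
  have eq: "emp_mean N (\<lambda>x. H x * z x) X / emp_mean N H X - hmean z =
      ?a X - ?a X * ?b X / emp_mean N h X"
    if X: "X \<in> space ?P" for X
  proof -
    have 1: "?a X = emp_mean N (\<lambda>x. h x * z x) X - hmean z * emp_mean N h X"
      unfolding emp_mean_cmult[symmetric] emp_mean_diff[symmetric] z0_def by (simp add: algebra_simps)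
    have 2: "?b X = emp_mean N h X - 1"
      using N by (simp add: emp_mean_diff) (simp add: emp_mean_def)
    show ?thesis
      unfolding emp_ratio_h 1 2 using emp_mean_h_bounds(2)[OF N X] by (simp add: divide_simps) (simp add: algebra_simps)
  qed
  have b: "\<bar>?a X * ?b X / emp_mean N h X\<bar>
      \<le> \<beta> * \<bar>?a X * ?b X\<bar>" if X: "X \<in> space ?P" for X
  proof -
    have "1 / emp_mean N h X \<le> \<beta>"
      using emp_mean_h_bounds[OF N X] beta_ge_1 by (simp add: field_simps)
    from mult_right_mono[OF this, of "\<bar>?a X * ?b X\<bar>"]
    show ?thesis using emp_mean_h_bounds(2)[OF N X] by (simp add: abs_mult)
  qed
  have ia: "integrable ?P (?a)" "integrable ?P (?b)"
    and ip: "integrable ?P (\<lambda>X. ?a X * ?b X)"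
  proof -
    have bd: "\<bar>?a X\<bar> \<le> \<beta> * Z" "\<bar>?b X\<bar> \<le> \<beta>"
      if "X \<in> space ?P" for X
    proof -
      have X: "X i \<in> space M" if "i \<in> {1..N}" for i using \<open>X \<in> space ?P\<close> that by (auto simp: space_PiM)
      show "\<bar>?a X\<bar> \<le> \<beta> * Z" by (intro emp_mean_abs_bound N z0 X)
      show "\<bar>?b X\<bar> \<le> \<beta>" by (intro emp_mean_abs_bound N h_bounds X)
    qed
    show "integrable ?P (?a)" "integrable ?P (?b)"
      by (rule integrable_PiM_bounded[OF _ bd(1)], simp_all) (rule integrable_PiM_bounded[OF _ bd(2)], simp_all)
    show "integrable ?P (\<lambda>X. ?a X * ?b X)"
    proof (rule integrable_PiM_bounded)
      show "\<bar>?a X * ?b X\<bar> \<le> \<beta> * Z * \<beta>" if "X \<in> space ?P" for X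
        unfolding abs_mult using bd[OF that] by (intro mult_mono) (auto intro: order_trans[OF abs_ge_zero])
    qed simp
  qed
  have iq: "integrable ?P (\<lambda>X. ?a X * ?b X / emp_mean N h X)"
    using ip b beta_ge_1 by (intro Bochner_Integration.integrable_bound[OF integrable_mult_right[OF ip, of \<beta>]] AE_I2)
      (auto simp: abs_mult)
  have "(LINT X|?P. emp_mean N (\<lambda>x. H x * z x) X / emp_mean N H X) - hmean z =
      (LINT X|?P. emp_mean N (\<lambda>x. H x * z x) X / emp_mean N H X - hmean z)"
    using integrable_emp_ratio[OF _ zb N] by (simp add: P.prob_space)
  also have "\<dots> = (LINT X|?P. ?a X -
      ?a X * ?b X / emp_mean N h X)"
    by (intro Bochner_Integration.integral_cong refl eq)
  also have "\<dots> = - (LINT X|?P. ?a X * ?b X / emp_mean N h X)"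
    using ia iq mean0 by (simp add: integral_emp_mean[OF _ z0 N])
  finally have "\<bar>(LINT X|?P. emp_mean N (\<lambda>x. H x * z x) X / emp_mean N H X) - hmean z\<bar> =
     \<bar>LINT X|?P. ?a X * ?b X / emp_mean N h X\<bar>" by simp
  also have "\<dots> \<le> (LINT X|?P. \<beta> * \<bar>?a X * ?b X\<bar>)"
    using ip by (intro abs_integral_le iq b) auto
  also have "\<dots> \<le> \<beta> * ((\<beta> * Z) * \<beta> / N)"
    using beta_ge_1 mult_left_mono[OF integral_emp_mean_product[OF _ z0 _ h_bounds(4) mean0 N], of \<beta>] by simp
  finally show ?thesis by (simp add: power3_eq_cube mult_ac)
qed

text \<open>Both numerators are centred, so their product is already of order 1/N and the
  denominators need only be bounded. Each denominator costs one \<beta>, and so does each of the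
  bounds on \<open>h * y\<close> and \<open>h * z\<close>.\<close>

lemma emp_ratio_product:
  assumes [measurable]: "y \<in> borel_measurable M" "z \<in> borel_measurable M"
    and Y: "\<And>x. x \<in> space M \<Longrightarrow> \<bar>y x\<bar> \<le> Y" and Z: "\<And>x. x \<in> space M \<Longrightarrow> \<bar>z x\<bar> \<le> Z"
    and mean: "hmean y = 0" "hmean z = 0" and N: "N \<ge> 1"
  shows "\<bar>LINT X|(\<Pi>\<^sub>M i\<in>{1..N}. M). emp_mean N (\<lambda>x. H x * y x) X / emp_mean N H X *
      (emp_mean N (\<lambda>x. H x * z x) X / emp_mean N H X)\<bar> \<le> \<beta> ^ 4 * (Y * Z) / N"
proof -
  let ?P = "\<Pi>\<^sub>M i\<in>{1..N}. M"
  let ?a = "emp_mean N (\<lambda>x. h x * y x)" and ?b = "emp_mean N (\<lambda>x. h x * z x)"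
  have hb: "\<bar>h x * y x\<bar> \<le> \<beta> * Y" "\<bar>h x * z x\<bar> \<le> \<beta> * Z" if "x \<in> space M" for x
    unfolding abs_mult using h_bounds[OF that] Y[OF that] Z[OF that] beta_ge_1 by (auto intro!: mult_mono)
  have bd: "\<bar>?a X\<bar> \<le> \<beta> * Y" "\<bar>?b X\<bar> \<le> \<beta> * Z"
    if "X \<in> space ?P" for X
    using that by (auto simp: space_PiM intro!: emp_mean_abs_bound N hb)
  have ip: "integrable ?P (\<lambda>X. \<bar>?a X * ?b X\<bar>)"
  proof (rule integrable_PiM_bounded)
    show "\<bar>\<bar>?a X * ?b X\<bar>\<bar> \<le> (\<beta> * Y) * (\<beta> * Z)" if "X \<in> space ?P" for X
      unfolding abs_mult abs_abs using bd[OF that] by (intro mult_mono) (auto intro: order_trans[OF abs_ge_zero])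
  qed simp
  have b: "\<bar>emp_mean N (\<lambda>x. H x * y x) X / emp_mean N H X * (emp_mean N (\<lambda>x. H x * z x) X / emp_mean N H X)\<bar>
      \<le> \<beta>\<^sup>2 * \<bar>?a X * ?b X\<bar>" if X: "X \<in> space ?P" for X
  proof -
    have "1 / emp_mean N h X \<le> \<beta>"
      using emp_mean_h_bounds[OF N X] beta_ge_1 by (simp add: field_simps)
    then have "(1 / emp_mean N h X)\<^sup>2 \<le> \<beta>\<^sup>2"
      using emp_mean_h_bounds[OF N X] by (intro power_mono) auto
    from mult_right_mono[OF this, of "\<bar>?a X * ?b X\<bar>"]
    show ?thesis using emp_mean_h_bounds(2)[OF N X]
      by (simp add: emp_ratio_h abs_mult power2_eq_square)
  qed
  have i: "integrable ?P (\<lambda>X. emp_mean N (\<lambda>x. H x * y x) X / emp_mean N H X *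
      (emp_mean N (\<lambda>x. H x * z x) X / emp_mean N H X))"
    using b by (intro Bochner_Integration.integrable_bound[OF integrable_mult_right[OF ip, of "\<beta>\<^sup>2"]] AE_I2)
      (auto simp: abs_mult)
  have "\<bar>LINT X|?P. emp_mean N (\<lambda>x. H x * y x) X / emp_mean N H X * (emp_mean N (\<lambda>x. H x * z x) X / emp_mean N H X)\<bar>
      \<le> (LINT X|?P. \<beta>\<^sup>2 * \<bar>?a X * ?b X\<bar>)"
    using ip by (intro abs_integral_le[OF i _ b]) auto
  also have "\<dots> = \<beta>\<^sup>2 * (LINT X|?P. \<bar>?a X * ?b X\<bar>)"
    by simp
  also have "\<dots> \<le> \<beta>\<^sup>2 * ((\<beta> * Y) * (\<beta> * Z) / N)"
    by (intro mult_left_mono integral_emp_mean_product hb N) (simp_all add: integral_h_mult mean)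
  also have "\<dots> = \<beta> ^ 4 * (Y * Z) / N" by (simp add: power2_eq_square power4_eq_xxxx)
  finally show ?thesis .
qed

text \<open>In the application \<open>u\<close> is the normalised filter applied to the test
  function, \<open>v\<close> and \<open>v1\<close> are its normalised derivatives for the test
  function and for 1, and \<open>W\<close> is the weight function. After the shift by \<kappa> and
  \<omega> the derivative of the quotient is one self-normalised mean of \<open>z\<close> minus a
  product of two centred ones, and the two preceding bounds apply. Separate bounds \<open>S\<close>
  and \<open>T\<close>, which need not be small, appear because each of them is multiplied by
  \<open>U\<close>.\<close>

lemma emp_quot_deriv_bias:
  assumes [measurable]: "u \<in> borel_measurable M" "v \<in> borel_measurable M" "v1 \<in> borel_measurable M"
      "W \<in> borel_measurable M"
    and U: "\<And>x. x \<in> space M \<Longrightarrow> \<bar>u x - hmean u\<bar> \<le> U"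
    and V: "\<And>x. x \<in> space M \<Longrightarrow> \<bar>v x - hmean u * v1 x - c0\<bar> \<le> V"
    and S: "\<And>x. x \<in> space M \<Longrightarrow> \<bar>v1 x + W x - hmean (\<lambda>x. v1 x + W x)\<bar> \<le> S"
    and T: "\<And>x. x \<in> space M \<Longrightarrow> \<bar>W x - hmean (\<lambda>x. v1 x + W x)\<bar> \<le> T"
    and N: "N \<ge> 1"
  shows "\<bar>(LINT X|(\<Pi>\<^sub>M i\<in>{1..N}. M). quot_deriv (emp_mean N (\<lambda>x. H x * u x) X) (emp_mean N H X)
        (emp_mean N (\<lambda>x. H x * (v x + W x * u x)) X) (emp_mean N (\<lambda>x. H x * (v1 x + W x)) X))
     - quot_deriv (LINT x|M. H x * u x) (LINT x|M. H x)
        (LINT x|M. H x * (v x + W x * u x)) (LINT x|M. H x * (v1 x + W x))\<bar>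
     \<le> (2 * \<beta> ^ 3 * (V + T * U) + \<beta> ^ 4 * (U * S)) / N" (is "\<bar>(LINT X|?P. ?Q X) - ?q\<bar> \<le> _")
proof -
  interpret P: prob_space ?P by (rule prob_space_PiM_power)
  define \<kappa> where "\<kappa> = hmean u"
  define \<omega> where "\<omega> = hmean (\<lambda>x. v1 x + W x)"
  define u0 where "u0 x = u x - \<kappa>" for x
  define s0 where "s0 x = v1 x + W x - \<omega>" for x
  \<comment> \<open>All terms that remain in the shifted numerator, gathered into one function.
    \<open>v\<close> and \<open>\<kappa> * v1\<close> enter only through their difference, whose
    oscillation is measured by \<open>V\<close>.\<close>
  define z where "z x = v x - \<kappa> * v1 x + (W x - \<omega>) * u0 x" for x
  have [measurable]: "u0 \<in> borel_measurable M" "s0 \<in> borel_measurable M" "z \<in> borel_measurable M"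
    unfolding u0_def[abs_def] s0_def[abs_def] z_def[abs_def] by simp_all
  have zc: "\<bar>z x - c0\<bar> \<le> V + T * U" if "x \<in> space M" for x
  proof -
    have "\<bar>(W x - \<omega>) * u0 x\<bar> \<le> T * U"
      unfolding abs_mult u0_def \<kappa>_def \<omega>_def using T[OF that] U[OF that] by (intro mult_mono) auto
    then show ?thesis using V[OF that] unfolding z_def \<kappa>_def by linarith
  qed
  have zm: "\<bar>z x - hmean z\<bar> \<le> 2 * (V + T * U)" if "x \<in> space M" for x
  proof -
    have "\<bar>hmean z - c0\<bar> \<le> V + T * U" by (rule hmean_near[OF _ zc]) auto
    moreover have "\<bar>z x - hmean z\<bar> \<le> \<bar>z x - c0\<bar> + \<bar>hmean z - c0\<bar>" by linarith
    ultimately show ?thesis using zc[OF that] by (simp only: mult_2)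
  qed
  have zb: "\<bar>z x\<bar> \<le> (V + T * U) + \<bar>c0\<bar>" if "x \<in> space M" for x using zc[OF that] by linarith
  have u0b: "\<bar>u0 x\<bar> \<le> U" and s0b: "\<bar>s0 x\<bar> \<le> S" if "x \<in> space M" for x
    using U[OF that] S[OF that] by (simp_all add: u0_def s0_def \<kappa>_def \<omega>_def)
  have vsb: "\<bar>v x - \<kappa> * v1 x\<bar> \<le> V + \<bar>c0\<bar>" if "x \<in> space M" for x
    using V[OF that] by (simp add: \<kappa>_def)
  have ub: "\<bar>u x\<bar> \<le> U + \<bar>\<kappa>\<bar>" if "x \<in> space M" for x
    using U[OF that] by (simp add: \<kappa>_def)
  have sb: "\<bar>v1 x + W x\<bar> \<le> S + \<bar>\<omega>\<bar>" if "x \<in> space M" for x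
    using S[OF that] by (simp add: \<omega>_def)
  have Wb: "\<bar>W x\<bar> \<le> T + \<bar>\<omega>\<bar>" if "x \<in> space M" for x
    using T[OF that] by (simp add: \<omega>_def)
  have zeq: "H x * z x = (H x * (v x + W x * u x) - \<kappa> * (H x * (v1 x + W x))) - \<omega> * (H x * u x - \<kappa> * H x)" for x
    by (simp add: z_def u0_def algebra_simps)
  have iz: "integrable M (\<lambda>x. H x * z x)" by (rule integrable_H_mult[OF _ zb]) auto
  have iu: "integrable M (\<lambda>x. H x * u x)" by (rule integrable_H_mult[OF _ ub]) auto
  have iss: "integrable M (\<lambda>x. H x * (v1 x + W x))" by (rule integrable_H_mult[OF _ sb]) auto
  have ic: "integrable M (\<lambda>x. H x * (v x + W x * u x))"
  proof -
    have "H x * (v x + W x * u x) = H x * z x + \<kappa> * (H x * (v1 x + W x)) + \<omega> * (H x * u x - \<kappa> * H x)" for x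
      by (simp add: zeq)
    then show ?thesis using iz iu iss integrable_H by simp
  qed
  have hu0: "hmean u0 = 0"
    using iu integrable_H integral_H_pos
    by (simp add: hmean_def[of u0] u0_def right_diff_distrib) (simp add: \<kappa>_def hmean_def)
  have hs0: "hmean s0 = 0"
    using iss integrable_H integral_H_pos
    by (simp add: hmean_def[of s0] s0_def right_diff_distrib) (simp add: \<omega>_def hmean_def)
  \<comment> \<open>For exact integrals the product term vanishes, because \<kappa> is the mean that
    centres its first factor.\<close>
  have q: "?q = hmean z"
  proof -
    have "?q = ((LINT x|M. H x * (v x + W x * u x)) - \<kappa> * (LINT x|M. H x * (v1 x + W x))
        - \<omega> * ((LINT x|M. H x * u x) - \<kappa> * (LINT x|M. H x))) / (LINT x|M. H x)"
      using integral_H_pos by (subst quot_deriv_shift[where \<kappa>=\<kappa> and \<omega>=\<omega>]) (auto simp: \<kappa>_def hmean_def)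
    also have "\<dots> = hmean z"
      unfolding hmean_def[of z] zeq using iu iss ic integrable_H by simp
    finally show ?thesis .
  qed
  let ?r = "\<lambda>z X. emp_mean N (\<lambda>x. H x * z x) X / emp_mean N H X"
  have Q: "?Q X = ?r z X - ?r u0 X * ?r s0 X" if X: "X \<in> space ?P" for X
  proof -
    have "emp_mean N H X = (LINT x|M. H x) * emp_mean N h X"
      unfolding emp_mean_cmult[symmetric] using integral_H_pos by (simp add: h_def)
    then have "emp_mean N H X \<noteq> 0"
      using emp_mean_h_bounds(2)[OF N X] integral_H_pos by simp
    then have "?Q X = (emp_mean N (\<lambda>x. H x * (v x + W x * u x)) X - \<kappa> * emp_mean N (\<lambda>x. H x * (v1 x + W x)) X
        - \<omega> * (emp_mean N (\<lambda>x. H x * u x) X - \<kappa> * emp_mean N H X)) / emp_mean N H X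
        - (emp_mean N (\<lambda>x. H x * u x) X - \<kappa> * emp_mean N H X) / emp_mean N H X *
        ((emp_mean N (\<lambda>x. H x * (v1 x + W x)) X - \<omega> * emp_mean N H X) / emp_mean N H X)"
      by (rule quot_deriv_shift)
    also have "\<dots> = ?r z X - ?r u0 X * ?r s0 X"
      unfolding zeq emp_mean_diff emp_mean_cmult
      by (simp add: u0_def s0_def right_diff_distrib emp_mean_diff emp_mean_cmult mult.commute[of "H _" \<kappa>] mult.commute[of "H _" \<omega>])
    finally show ?thesis .
  qed
  have irz: "integrable ?P (?r z)" by (rule integrable_emp_ratio[OF _ zb N]) auto
  have irp: "integrable ?P (\<lambda>X. ?r u0 X * ?r s0 X)"
  proof (rule integrable_PiM_bounded)
    show "\<bar>?r u0 X * ?r s0 X\<bar> \<le> (\<beta>\<^sup>2 * U) * (\<beta>\<^sup>2 * S)" if "X \<in> space ?P" for X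
    proof -
      have 1: "\<bar>?r u0 X\<bar> \<le> \<beta>\<^sup>2 * U" and 2: "\<bar>?r s0 X\<bar> \<le> \<beta>\<^sup>2 * S"
        by (intro emp_ratio_abs_le N that u0b s0b; assumption)+
      show ?thesis
        unfolding abs_mult[of "?r u0 X"] by (rule mult_mono[OF 1 2 order_trans[OF abs_ge_zero 1] abs_ge_zero])
    qed
  qed simp
  have "(LINT X|?P. ?Q X) - ?q = (LINT X|?P. ?r z X - ?r u0 X * ?r s0 X) - hmean z"
    unfolding q by (simp add: Q cong: Bochner_Integration.integral_cong)
  also have "\<dots> = ((LINT X|?P. ?r z X) - hmean z) - (LINT X|?P. ?r u0 X * ?r s0 X)"
    using irz irp by (simp del: times_divide_eq_right times_divide_eq_left)
  finally have "\<bar>(LINT X|?P. ?Q X) - ?q\<bar> \<le> \<bar>(LINT X|?P. ?r z X) - hmean z\<bar> + \<bar>LINT X|?P. ?r u0 X * ?r s0 X\<bar>"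
    by (simp only: abs_triangle_ineq4)
  also have "\<dots> \<le> \<beta> ^ 3 * (2 * (V + T * U)) / N + \<beta> ^ 4 * (U * S) / N"
    by (intro add_mono emp_ratio_bias[OF _ zm N] emp_ratio_product u0b s0b hu0 hs0 N) auto
  also have "\<dots> = (2 * \<beta> ^ 3 * (V + T * U) + \<beta> ^ 4 * (U * S)) / N"
    by (simp add: add_divide_distrib algebra_simps)
  finally show ?thesis .
qed

end

section \<open>Mixing kernels\<close>

text \<open>
  Doeblin's argument: weights in \<open>[\<delta>, 1/\<delta>]\<close> share the fraction \<open>\<delta>\<^sup>2\<close> of their mass with
  the base measure, so the means they define oscillate less than the averaged function.
\<close>

lemma weighted_mean_contraction:
  fixes P :: "'b measure" and F :: "'a \<Rightarrow> 'b \<Rightarrow> real" and h u :: "'b \<Rightarrow> real"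
  assumes \<delta>: "0 < \<delta>"
    and h: "integrable P h" "\<And>y. y \<in> space P \<Longrightarrow> 0 \<le> h y" "0 < (LINT y|P. h y)"
    and hu: "integrable P (\<lambda>y. h y * u y)"
    and Fh: "\<And>x. x \<in> S \<Longrightarrow> integrable P (\<lambda>y. F x y * h y)"
    and Fhu: "\<And>x. x \<in> S \<Longrightarrow> integrable P (\<lambda>y. F x y * h y * u y)"
    and F: "\<And>x y. x \<in> S \<Longrightarrow> y \<in> space P \<Longrightarrow> \<delta> \<le> F x y"
      "\<And>x y. x \<in> S \<Longrightarrow> y \<in> space P \<Longrightarrow> F x y \<le> 1 / \<delta>"
    and D: "\<And>y. y \<in> space P \<Longrightarrow> \<bar>u y - c\<bar> \<le> D"
  shows "\<exists>c'. \<forall>x\<in>S. \<bar>(LINT y|P. F x y * h y * u y) / (LINT y|P. F x y * h y) - c'\<bar> \<le> (1 - \<delta>\<^sup>2) * D"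
proof -
  define J where "J = (LINT y|P. h y)"
  have J: "0 < J" using h(3) by (simp add: J_def)
  \<comment> \<open>The lower bound is this upper bound for -u and -c, which is why \<open>u\<close>
    and \<open>c\<close> are generalised again here.\<close>
  have upper: "(LINT y|P. F x y * h y * u y) / (LINT y|P. F x y * h y) - c
      \<le> (1 - \<delta>\<^sup>2) * D + \<delta>\<^sup>2 * ((LINT y|P. h y * u y) / J - c)"
    if x: "x \<in> S" and D: "\<And>y. y \<in> space P \<Longrightarrow> u y - c \<le> D"
      and hu: "integrable P (\<lambda>y. h y * u y)" and Fhu: "integrable P (\<lambda>y. F x y * h y * u y)" for x u c
  proof -
    define s where "s = (LINT y|P. F x y * h y)"
    have "(LINT y|P. \<delta> * h y) \<le> s"
      unfolding s_def using F[OF x] h by (intro integral_mono Fh x) (auto intro: mult_right_mono)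
    with J \<delta> have s: "0 < s" by (simp add: J_def[symmetric]) (metis less_le_trans mult_pos_pos)
    have "s \<le> (LINT y|P. 1 / \<delta> * h y)"
      unfolding s_def using h by (intro integral_mono Fh x integrable_mult_right mult_right_mono F(2)) auto
    then have sJ: "\<delta> * s \<le> J" using \<delta> by (simp add: J_def field_simps)
    \<comment> \<open>The total slack D - (u - c) \<ge> 0 under the weights \<open>h\<close>. The
      weights \<open>F\<close> retain at least the fraction \<delta> of it, and \<delta> s \<le> J
      turns \<delta> q / s into at least \<delta>^2 q / J, a quantity independent of x.\<close>
    define q where "q = (LINT y|P. h y * (D - (u y - c)))"
    have q: "0 \<le> q" unfolding q_def using h D by (intro Bochner_Integration.integral_nonneg) (auto intro!: mult_nonneg_nonneg)
    have iF: "integrable P (\<lambda>y. F x y * h y * (D - (u y - c)))"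
      using Fh[OF x] Fhu by (simp add: right_diff_distrib)
    have "(LINT y|P. \<delta> * (h y * (D - (u y - c)))) \<le> (LINT y|P. F x y * h y * (D - (u y - c)))"
    proof (intro integral_mono iF)
      show "integrable P (\<lambda>y. \<delta> * (h y * (D - (u y - c))))"
        using h hu by (simp add: right_diff_distrib)
      fix y assume y: "y \<in> space P"
      show "\<delta> * (h y * (D - (u y - c))) \<le> F x y * h y * (D - (u y - c))"
        unfolding mult.assoc using F(1)[OF x y] h(2)[OF y] D[OF y] by (intro mult_right_mono) auto
    qed
    also have "(LINT y|P. F x y * h y * (D - (u y - c))) = (D + c) * s - (LINT y|P. F x y * h y * u y)"
      using Fh[OF x] Fhu by (simp add: right_diff_distrib s_def algebra_simps)
    finally have *: "(LINT y|P. F x y * h y * u y) \<le> (D + c) * s - \<delta> * q" by (simp add: q_def)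
    have "\<delta>\<^sup>2 * q * s \<le> \<delta> * q * J"
      using mult_left_mono[OF sJ, of "\<delta> * q"] q \<delta> by (simp add: power2_eq_square mult_ac)
    then have "\<delta>\<^sup>2 * (q / J) \<le> \<delta> * q / s" using s J by (simp add: field_simps)
    moreover have "(LINT y|P. F x y * h y * u y) / s \<le> (D + c) - \<delta> * q / s"
      using * s by (simp add: field_simps)
    moreover have "q / J = D + c - (LINT y|P. h y * u y) / J"
      using h hu J by (simp add: q_def right_diff_distrib J_def field_simps)
    ultimately have "(LINT y|P. F x y * h y * u y) / s \<le> (D + c) - \<delta>\<^sup>2 * (D + c - (LINT y|P. h y * u y) / J)"
      by simp
    then show ?thesis unfolding s_def[symmetric] by (simp add: algebra_simps)
  qed
  show ?thesis
  \<comment> \<open>The centre moves by the fraction \<delta>^2 from \<open>c\<close> towards the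
    mean under the weights \<open>h\<close> alone.\<close>
  proof (intro exI[of _ "c + \<delta>\<^sup>2 * ((LINT y|P. h y * u y) / J - c)"] ballI)
    fix x assume x: "x \<in> S"
    have "(LINT y|P. F x y * h y * u y) / (LINT y|P. F x y * h y) - c
      \<le> (1 - \<delta>\<^sup>2) * D + \<delta>\<^sup>2 * ((LINT y|P. h y * u y) / J - c)"
      using D by (intro upper x hu Fhu) (auto simp: abs_le_iff)
    moreover have "(LINT y|P. F x y * h y * (- u y)) / (LINT y|P. F x y * h y) - (- c)
      \<le> (1 - \<delta>\<^sup>2) * D + \<delta>\<^sup>2 * ((LINT y|P. h y * (- u y)) / J - (- c))"
      using D hu Fhu[OF x] by (intro upper x) (auto simp: abs_le_iff)
    ultimately show "\<bar>(LINT y|P. F x y * h y * u y) / (LINT y|P. F x y * h y)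
        - (c + \<delta>\<^sup>2 * ((LINT y|P. h y * u y) / J - c))\<bar> \<le> (1 - \<delta>\<^sup>2) * D"
      by (simp add: abs_le_iff algebra_simps)
  qed
qed

section \<open>Bounded measurable functions, the domain of the filter operators\<close>

definition bounded_measurable :: "'a measure \<Rightarrow> ('a \<Rightarrow> real) \<Rightarrow> bool" where
  "bounded_measurable M \<phi> \<longleftrightarrow> \<phi> \<in> borel_measurable M \<and> (\<exists>C. \<forall>x\<in>space M. \<bar>\<phi> x\<bar> \<le> C)"

lemma bounded_measurableI:
  "\<phi> \<in> borel_measurable M \<Longrightarrow> (\<And>x. x \<in> space M \<Longrightarrow> \<bar>\<phi> x\<bar> \<le> C) \<Longrightarrow> bounded_measurable M \<phi>"
  by (auto simp: bounded_measurable_def)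

lemma bounded_measurable_borel: "bounded_measurable M \<phi> \<Longrightarrow> \<phi> \<in> borel_measurable M"
  by (simp add: bounded_measurable_def)

lemma bounded_measurable_const: "bounded_measurable M (\<lambda>_. c)"
  by (rule bounded_measurableI[of _ _ "\<bar>c\<bar>"]) auto

lemma bounded_measurable_mult:
  assumes "bounded_measurable M \<phi>" "bounded_measurable M \<psi>"
  shows "bounded_measurable M (\<lambda>x. \<phi> x * \<psi> x)"
proof -
  obtain C D where CD: "\<forall>x\<in>space M. \<bar>\<phi> x\<bar> \<le> C" "\<forall>x\<in>space M. \<bar>\<psi> x\<bar> \<le> D"
    using assms by (auto simp: bounded_measurable_def)
  show ?thesis
  proof (rule bounded_measurableI)
    show "\<bar>\<phi> x * \<psi> x\<bar> \<le> C * D" if "x \<in> space M" for x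
      unfolding abs_mult using CD that by (intro mult_mono) force+
  qed (intro borel_measurable_times bounded_measurable_borel assms)
qed

lemma bounded_measurable_add:
  assumes "bounded_measurable M \<phi>" "bounded_measurable M \<psi>"
  shows "bounded_measurable M (\<lambda>x. \<phi> x + \<psi> x)"
proof -
  obtain C D where "\<forall>x\<in>space M. \<bar>\<phi> x\<bar> \<le> C" "\<forall>x\<in>space M. \<bar>\<psi> x\<bar> \<le> D"
    using assms by (auto simp: bounded_measurable_def)
  then have "\<And>x. x \<in> space M \<Longrightarrow> \<bar>\<phi> x + \<psi> x\<bar> \<le> C + D" by fastforce
  with assms[THEN bounded_measurable_borel] show ?thesis
    by (intro bounded_measurableI borel_measurable_add)
qed

lemma bounded_measurable_diff:
  assumes "bounded_measurable M \<phi>" "bounded_measurable M \<psi>"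
  shows "bounded_measurable M (\<lambda>x. \<phi> x - \<psi> x)"
  using bounded_measurable_add[OF assms(1) bounded_measurable_mult[OF bounded_measurable_const[of _ "-1"] assms(2)]]
  by simp

lemma bounded_measurable_sum:
  "(\<And>i. i \<in> I \<Longrightarrow> bounded_measurable M (\<phi> i)) \<Longrightarrow> bounded_measurable M (\<lambda>x. \<Sum>i\<in>I. \<phi> i x)"
  by (induction I rule: infinite_finite_induct)
    (auto simp: bounded_measurable_const intro!: bounded_measurable_add)

lemma bounded_measurable_cong_sets:
  "sets M = sets N \<Longrightarrow> bounded_measurable M \<phi> = bounded_measurable N \<phi>"
  using sets_eq_imp_space_eq[of M N] by (simp add: bounded_measurable_def cong: measurable_cong_sets)

lemma bounded_measurable_compose:
  "bounded_measurable M \<phi> \<Longrightarrow> T \<in> N \<rightarrow>\<^sub>M M \<Longrightarrow> bounded_measurable N (\<lambda>x. \<phi> (T x))"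
  by (auto simp: bounded_measurable_def dest: measurable_space)

lemma (in finite_measure) integrable_bounded_measurable:
  "bounded_measurable M \<phi> \<Longrightarrow> integrable M \<phi>"
  unfolding bounded_measurable_def by (auto intro!: integrable_const_bound AE_I2)

lemmas bounded_measurable_intros =
  bounded_measurable_const bounded_measurable_add bounded_measurable_diff bounded_measurable_mult
  bounded_measurable_sum

text \<open>\<open>f k\<close> stands for the transition density times the observation density at
  time k, and \<open>g k\<close> for one partial derivative of it. The bound of \<open>g\<close>
  relative to \<open>f\<close> is a bound on the logarithmic derivative, and this form survives
  every normalisation.\<close>

locale mixing_kernels = finite_measure M for M :: "'a measure" +
  fixes f g :: "nat \<Rightarrow> 'a \<Rightarrow> 'a \<Rightarrow> real" and \<delta> \<Gamma> :: real
  assumes f_measurable: "(\<lambda>z. f k (fst z) (snd z)) \<in> borel_measurable (M \<Otimes>\<^sub>M M)"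
    and g_measurable: "(\<lambda>z. g k (fst z) (snd z)) \<in> borel_measurable (M \<Otimes>\<^sub>M M)"
    and delta: "0 < \<delta>" "\<delta> < 1"
    and Gamma: "0 \<le> \<Gamma>"
    and f_bounds: "\<And>k x x'. x \<in> space M \<Longrightarrow> x' \<in> space M \<Longrightarrow> \<delta> \<le> f k x' x"
      "\<And>k x x'. x \<in> space M \<Longrightarrow> x' \<in> space M \<Longrightarrow> f k x' x \<le> 1 / \<delta>"
    and g_bound: "\<And>k x x'. x \<in> space M \<Longrightarrow> x' \<in> space M \<Longrightarrow> \<bar>g k x' x\<bar> \<le> \<Gamma> * f k x' x"
    and mass: "0 < measure M (space M)"
begin

lemma f_comp_measurable[measurable (raw)]:
  "a \<in> N \<rightarrow>\<^sub>M M \<Longrightarrow> b \<in> N \<rightarrow>\<^sub>M M \<Longrightarrow> (\<lambda>\<omega>. f k (a \<omega>) (b \<omega>)) \<in> borel_measurable N"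
  using measurable_compose[OF measurable_Pair f_measurable, of a N b k] by simp

lemma g_comp_measurable[measurable (raw)]:
  "a \<in> N \<rightarrow>\<^sub>M M \<Longrightarrow> b \<in> N \<rightarrow>\<^sub>M M \<Longrightarrow> (\<lambda>\<omega>. g k (a \<omega>) (b \<omega>)) \<in> borel_measurable N"
  using measurable_compose[OF measurable_Pair g_measurable, of a N b k] by simp

lemma f_pos: "x \<in> space M \<Longrightarrow> x' \<in> space M \<Longrightarrow> 0 < f k x' x"
  using f_bounds(1) delta by (meson less_le_trans)

lemma f_abs: "x \<in> space M \<Longrightarrow> x' \<in> space M \<Longrightarrow> \<bar>f k x' x\<bar> \<le> 1 / \<delta>"
  using f_bounds(2)[of x x' k] f_pos[of x x' k] by simp

lemma g_abs: "x \<in> space M \<Longrightarrow> x' \<in> space M \<Longrightarrow> \<bar>g k x' x\<bar> \<le> \<Gamma> * (1 / \<delta>)"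
  using g_bound f_bounds(2) Gamma by (meson mult_left_mono order_trans)

lemma f_bounded_measurable: "x \<in> space M \<Longrightarrow> bounded_measurable M (\<lambda>x'. f k x' x)"
  by (intro bounded_measurableI[of _ _ "1 / \<delta>"] f_abs) measurable

lemma g_bounded_measurable: "x \<in> space M \<Longrightarrow> bounded_measurable M (\<lambda>x'. g k x' x)"
  by (intro bounded_measurableI[of _ _ "\<Gamma> * (1 / \<delta>)"] g_abs) auto

section \<open>The unnormalised operators and their likelihoods\<close>

definition Fop :: "nat \<Rightarrow> ('a \<Rightarrow> real) \<Rightarrow> 'a \<Rightarrow> real" where
  "Fop k \<phi> x = (LINT x'|M. f k x' x * \<phi> x')"

definition Gop :: "nat \<Rightarrow> ('a \<Rightarrow> real) \<Rightarrow> 'a \<Rightarrow> real" where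
  "Gop k \<phi> x = (LINT x'|M. g k x' x * \<phi> x')"

lemma bounded_integral_operator:
  assumes \<phi>: "bounded_measurable M \<phi>" and m: "(\<lambda>z. l (fst z) (snd z)) \<in> borel_measurable (M \<Otimes>\<^sub>M M)"
    and b: "\<And>x x'. x \<in> space M \<Longrightarrow> x' \<in> space M \<Longrightarrow> \<bar>l x' x\<bar> \<le> B"
  shows "bounded_measurable M (\<lambda>x. LINT x'|M. l x' x * \<phi> x')"
proof -
  note [measurable] = bounded_measurable_borel[OF \<phi>]
  have [measurable]: "(\<lambda>\<omega>. l (p \<omega>) (q \<omega>)) \<in> borel_measurable N" if "p \<in> N \<rightarrow>\<^sub>M M" "q \<in> N \<rightarrow>\<^sub>M M" for p q and N :: "'c measure"
    using measurable_compose[OF measurable_Pair m, of p N q] that by simp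
  obtain C where C: "\<And>x. x \<in> space M \<Longrightarrow> \<bar>\<phi> x\<bar> \<le> C" using \<phi> by (auto simp: bounded_measurable_def)
  have lb: "\<bar>l x' x * \<phi> x'\<bar> \<le> B * C" if "x \<in> space M" "x' \<in> space M" for x x'
    unfolding abs_mult using b[OF that] C[OF that(2)] by (intro mult_mono) auto
  show ?thesis
  proof (rule bounded_measurableI)
    have "(\<lambda>(x, x'). l x' x * \<phi> x') \<in> borel_measurable (M \<Otimes>\<^sub>M M)"
      using measurable_compose[OF measurable_Pair[OF measurable_snd measurable_fst] m] by (simp add: split_beta)
    then show "(\<lambda>x. LINT x'|M. l x' x * \<phi> x') \<in> borel_measurable M"
      by (rule borel_measurable_lebesgue_integral)
    fix x assume x: "x \<in> space M"
    have "(\<lambda>x'. l x' x) \<in> borel_measurable M"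
      using measurable_compose[OF measurable_Pair[OF measurable_ident measurable_const[OF x]] m] by simp
    then have "integrable M (\<lambda>x'. l x' x * \<phi> x')"
      using lb[OF x] by (intro integrable_const_bound[of _ "B * C"]) auto
    then have "\<bar>LINT x'|M. l x' x * \<phi> x'\<bar> \<le> (LINT x'|M. B * C)"
      by (rule abs_integral_le) (auto simp: lb[OF x])
    then show "\<bar>LINT x'|M. l x' x * \<phi> x'\<bar> \<le> measure M (space M) * (B * C)" by simp
  qed
qed

lemma Fop_bounded_measurable: "bounded_measurable M \<phi> \<Longrightarrow> bounded_measurable M (Fop k \<phi>)"
  unfolding Fop_def[abs_def]
  by (rule bounded_integral_operator[of _ _ "1 / \<delta>"])
    (simp_all add: f_measurable f_abs[simplified])

lemma Gop_bounded_measurable: "bounded_measurable M \<phi> \<Longrightarrow> bounded_measurable M (Gop k \<phi>)"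
  unfolding Gop_def[abs_def]
  by (rule bounded_integral_operator[of _ _ "\<Gamma> * (1 / \<delta>)"]) (simp_all add: g_measurable g_abs[simplified])

lemma Fop_integrable: "bounded_measurable M \<phi> \<Longrightarrow> x \<in> space M \<Longrightarrow> integrable M (\<lambda>x'. f k x' x * \<phi> x')"
  by (intro integrable_bounded_measurable bounded_measurable_mult f_bounded_measurable)

lemma Gop_integrable: "bounded_measurable M \<phi> \<Longrightarrow> x \<in> space M \<Longrightarrow> integrable M (\<lambda>x'. g k x' x * \<phi> x')"
  by (intro integrable_bounded_measurable bounded_measurable_mult g_bounded_measurable)

text \<open>A vanishing integral would force a strictly positive integrand to be zero almost
  everywhere, which a base measure of positive mass excludes.\<close>

lemma Fop_pos:
  assumes "bounded_measurable M \<phi>" "\<And>x. x \<in> space M \<Longrightarrow> 0 < \<phi> x" "x \<in> space M"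
  shows "0 < Fop k \<phi> x"
proof -
  have "0 \<le> Fop k \<phi> x"
    unfolding Fop_def using assms f_pos by (intro Bochner_Integration.integral_nonneg) (auto simp: less_imp_le)
  moreover have "Fop k \<phi> x \<noteq> 0"
  proof
    assume "Fop k \<phi> x = 0"
    then have "AE x' in M. f k x' x * \<phi> x' = 0"
      unfolding Fop_def using assms f_pos
      by (subst (asm) integral_nonneg_eq_0_iff_AE[OF Fop_integrable]) (auto simp: less_imp_le)
    moreover have "AE x' in M. f k x' x * \<phi> x' \<noteq> 0"
      using assms f_pos by (intro AE_I2) (auto simp: less_imp_neq[symmetric])
    ultimately have "AE x' in M. False" by eventually_elim auto
    then show False using mass by (simp add: AE_iff_measurable[OF _ refl] measure_def)
  qed
  ultimately show ?thesis by simp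
qed


text \<open>
  \<open>fprop j k \<phi>\<close> is the unnormalised filter, started in a point mass at time \<open>k\<close> and run for
  \<open>j\<close> steps, integrated against \<open>\<phi>\<close>; \<open>dprop j k \<phi>\<close> is its derivative in the parameter.
\<close>

primrec fprop :: "nat \<Rightarrow> nat \<Rightarrow> ('a \<Rightarrow> real) \<Rightarrow> 'a \<Rightarrow> real" where
  "fprop 0 k \<phi> = \<phi>"
| "fprop (Suc j) k \<phi> = Fop k (fprop j (Suc k) \<phi>)"

primrec dprop :: "nat \<Rightarrow> nat \<Rightarrow> ('a \<Rightarrow> real) \<Rightarrow> 'a \<Rightarrow> real" where
  "dprop 0 k \<phi> = (\<lambda>_. 0)"
| "dprop (Suc j) k \<phi> = (\<lambda>x. Gop k (fprop j (Suc k) \<phi>) x + Fop k (dprop j (Suc k) \<phi>) x)"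

text \<open>The likelihood of the next j observations given the state at time k. It is the
  importance weight with which a particle at time k enters the filter at time k + j.\<close>

definition H :: "nat \<Rightarrow> nat \<Rightarrow> 'a \<Rightarrow> real" where "H j k = fprop j k (\<lambda>_. 1)"

definition nprop :: "nat \<Rightarrow> nat \<Rightarrow> ('a \<Rightarrow> real) \<Rightarrow> 'a \<Rightarrow> real" where
  "nprop j k \<phi> x = fprop j k \<phi> x / H j k x"

text \<open>This is not the derivative of \<open>nprop\<close>: only the numerator is
  differentiated, and the quotient rule is left to \<open>quot_deriv\<close>.\<close>

definition ndprop :: "nat \<Rightarrow> nat \<Rightarrow> ('a \<Rightarrow> real) \<Rightarrow> 'a \<Rightarrow> real" where
  "ndprop j k \<phi> x = dprop j k \<phi> x / H j k x"

lemma fprop_bounded_measurable: "bounded_measurable M \<phi> \<Longrightarrow> bounded_measurable M (fprop j k \<phi>)"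
  by (induction j arbitrary: k) (auto intro: Fop_bounded_measurable)

lemma dprop_bounded_measurable: "bounded_measurable M \<phi> \<Longrightarrow> bounded_measurable M (dprop j k \<phi>)"
  by (induction j arbitrary: k)
    (auto intro!: bounded_measurable_intros Fop_bounded_measurable Gop_bounded_measurable fprop_bounded_measurable)

lemma H_bounded_measurable: "bounded_measurable M (H j k)"
  unfolding H_def by (intro fprop_bounded_measurable bounded_measurable_const)

lemma H_0: "H 0 k x = 1" by (simp add: H_def)

lemma H_Suc: "H (Suc j) k = Fop k (H j (Suc k))" by (simp add: H_def)

lemma H_positive: "x \<in> space M \<Longrightarrow> 0 < H j k x"
  by (induction j arbitrary: k x) (auto simp: H_0 H_Suc intro!: Fop_pos H_bounded_measurable)

text \<open>Only the first step sees the starting point, and f k x' x \<le> 1/\<delta> \<le> f k x'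
  z / \<delta>^2. The factor therefore does not grow with j.\<close>

lemma H_ratio_bound:
  assumes x: "x \<in> space M" and z: "z \<in> space M"
  shows "H j k x \<le> 1 / \<delta>\<^sup>2 * H j k z"
proof (cases j)
  case 0
  have "\<delta>\<^sup>2 \<le> 1" using delta by (simp add: power_le_one)
  with 0 delta show ?thesis by (simp add: H_0)
next
  case (Suc i)
  let ?H = "H i (Suc k)"
  have "Fop k ?H x \<le> (LINT x'|M. 1 / \<delta>\<^sup>2 * (f k x' z * ?H x'))"
    unfolding Fop_def
  proof (intro integral_mono Fop_integrable H_bounded_measurable x integrable_mult_right z)
    fix x' assume x': "x' \<in> space M"
    have "f k x' x \<le> 1 / \<delta>\<^sup>2 * \<delta>" using f_bounds(2)[OF x x', of k] delta by (simp add: power2_eq_square)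
    also have "\<dots> \<le> 1 / \<delta>\<^sup>2 * f k x' z" using f_bounds(1)[OF z x'] by (intro mult_left_mono) auto
    finally have "f k x' x * ?H x' \<le> 1 / \<delta>\<^sup>2 * f k x' z * ?H x'"
      using H_positive[OF x'] by (intro mult_right_mono) (auto simp: less_imp_le)
    then show "f k x' x * ?H x' \<le> 1 / \<delta>\<^sup>2 * (f k x' z * ?H x')" by (simp add: mult.assoc)
  qed
  then show ?thesis by (simp add: Suc H_Suc Fop_def)
qed

lemma nprop_bound:
  assumes "bounded_measurable M \<phi>"
  shows "bounded_measurable M (nprop j k \<phi>)" "bounded_measurable M (ndprop j k \<phi>)"
proof -
  obtain x0 where x0: "x0 \<in> space M" using mass by (cases "space M = {}") auto
  \<comment> \<open>\<open>H j k\<close> is controlled only up to a common factor, so its reciprocal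
    is bounded by comparison with one fixed point.\<close>
  have Hinv: "bounded_measurable M (\<lambda>x. 1 / H j k x)"
  proof (rule bounded_measurableI)
    show "(\<lambda>x. 1 / H j k x) \<in> borel_measurable M"
      using bounded_measurable_borel[OF H_bounded_measurable[of j k]] by measurable
    fix x assume x: "x \<in> space M"
    have "1 / H j k x \<le> (1 / \<delta>\<^sup>2) / H j k x0"
      using H_ratio_bound[OF x0 x, of j k] H_positive[OF x, of j k] H_positive[OF x0, of j k] delta by (simp add: field_simps)
    then show "\<bar>1 / H j k x\<bar> \<le> (1 / \<delta>\<^sup>2) / H j k x0" using H_positive[OF x, of j k] by simp
  qed
  show "bounded_measurable M (nprop j k \<phi>)" "bounded_measurable M (ndprop j k \<phi>)"
    using bounded_measurable_mult[OF fprop_bounded_measurable[OF assms] Hinv, of j k]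
      bounded_measurable_mult[OF dprop_bounded_measurable[OF assms] Hinv, of j k]
    by (simp_all add: nprop_def[abs_def] ndprop_def[abs_def])
qed


text \<open>For \<open>h = H j (Suc k)\<close> this is the expectation over the next state given the
  current one and the future observations: the transition kernel tilted by the likelihood of what
  follows.\<close>

definition fmean :: "nat \<Rightarrow> ('a \<Rightarrow> real) \<Rightarrow> ('a \<Rightarrow> real) \<Rightarrow> 'a \<Rightarrow> real" where
  "fmean k h u x = Fop k (\<lambda>x'. h x' * u x') x / Fop k h x"

text \<open>The tilt \<open>h\<close> is absorbed into the base weights of Doeblin's argument, so
  the rate depends on \<delta> alone and is the same at every time.\<close>

lemma fmean_contraction:
  assumes h: "bounded_measurable M h" "\<And>x. x \<in> space M \<Longrightarrow> 0 < h x" and u: "bounded_measurable M u"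
    and D: "\<And>x. x \<in> space M \<Longrightarrow> \<bar>u x - c\<bar> \<le> D"
  shows "\<exists>c'. \<forall>x\<in>space M. \<bar>fmean k h u x - c'\<bar> \<le> (1 - \<delta>\<^sup>2) * D"
  unfolding fmean_def Fop_def mult.assoc[symmetric]
proof (rule weighted_mean_contraction[where F="\<lambda>x x'. f k x' x" and S="space M" and P=M and h=h and u=u and \<delta>=\<delta> and D=D and c=c])
  show "0 < (LINT x|M. h x)"
  proof -
    have "0 \<le> (LINT x|M. h x)" using h(2) by (intro Bochner_Integration.integral_nonneg) (auto simp: less_imp_le)
    moreover have "(LINT x|M. h x) \<noteq> 0"
    proof
      assume "(LINT x|M. h x) = 0"
      then have "AE x' in M. h x' = 0"
        using h by (subst (asm) integral_nonneg_eq_0_iff_AE) (auto simp: less_imp_le integrable_bounded_measurable)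
      moreover have "AE x' in M. h x' \<noteq> 0" using h(2) by (intro AE_I2) (auto simp: less_imp_neq[symmetric])
      ultimately have "AE x' in M. False" by eventually_elim auto
      then show False using mass by (simp add: AE_iff_measurable[OF _ refl] measure_def)
    qed
    ultimately show ?thesis by simp
  qed
  show "integrable M (\<lambda>x'. f k x' x * h x' * u x')" if "x \<in> space M" for x
    using that by (intro integrable_bounded_measurable bounded_measurable_mult f_bounded_measurable h u)
qed (auto simp: delta f_bounds D less_imp_le h(2) intro!: Fop_integrable h(1) integrable_bounded_measurable bounded_measurable_mult f_bounded_measurable u)

lemma fmean_diff:
  assumes "bounded_measurable M h" "bounded_measurable M u" "bounded_measurable M v" "x \<in> space M"
  shows "fmean k h (\<lambda>x. u x - t * v x) x = fmean k h u x - t * fmean k h v x"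
proof -
  have "Fop k (\<lambda>x'. h x' * (u x' - t * v x')) x = (LINT x'|M. f k x' x * (h x' * u x') - t * (f k x' x * (h x' * v x')))"
    unfolding Fop_def by (simp add: algebra_simps)
  also have "\<dots> = Fop k (\<lambda>x'. h x' * u x') x - t * Fop k (\<lambda>x'. h x' * v x') x"
    unfolding Fop_def using assms by (simp add: Fop_integrable bounded_measurable_mult)
  finally show ?thesis by (simp add: fmean_def diff_divide_distrib)
qed

lemma fmean_abs_le:
  assumes h: "bounded_measurable M h" "\<And>x. x \<in> space M \<Longrightarrow> 0 < h x" and u: "bounded_measurable M u"
    and D: "\<And>x. x \<in> space M \<Longrightarrow> \<bar>u x\<bar> \<le> D" and x: "x \<in> space M"
  shows "\<bar>fmean k h u x\<bar> \<le> D"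
proof -
  have "\<bar>Fop k (\<lambda>x'. h x' * u x') x\<bar> \<le> (LINT x'|M. D * (f k x' x * h x'))"
    unfolding Fop_def
  proof (rule abs_integral_le)
    show "\<bar>f k x' x * (h x' * u x')\<bar> \<le> D * (f k x' x * h x')" if x': "x' \<in> space M" for x'
    proof -
      have "\<bar>u x'\<bar> * (f k x' x * h x') \<le> D * (f k x' x * h x')"
        using D[OF x'] f_pos[OF x x'] h(2)[OF x'] by (intro mult_right_mono) (auto simp: less_imp_le)
      then show ?thesis using f_pos[OF x x', of k] h(2)[OF x'] by (simp add: abs_mult mult_ac)
    qed
  qed (use assms in \<open>auto intro!: Fop_integrable bounded_measurable_mult\<close>)
  also have "\<dots> = D * Fop k h x" by (simp add: Fop_def)
  finally show ?thesis using Fop_pos[OF h x, of k] by (simp add: fmean_def pos_divide_le_eq)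
qed

text \<open>Divided by the same normaliser as \<open>fmean\<close>, this is the mean of
  \<open>u\<close> times the one-step score g/f under the tilted kernel. Since |g/f| \<le> \<Gamma>,
  it is bounded by \<Gamma> times the bound of \<open>u\<close>.\<close>

definition gmean :: "nat \<Rightarrow> ('a \<Rightarrow> real) \<Rightarrow> ('a \<Rightarrow> real) \<Rightarrow> 'a \<Rightarrow> real" where
  "gmean k h u x = Gop k (\<lambda>x'. h x' * u x') x / Fop k h x"

lemma gmean_diff:
  assumes "bounded_measurable M h" "bounded_measurable M u" "bounded_measurable M v" "x \<in> space M"
  shows "gmean k h (\<lambda>x. u x - t * v x) x = gmean k h u x - t * gmean k h v x"
proof -
  have "Gop k (\<lambda>x'. h x' * (u x' - t * v x')) x = (LINT x'|M. g k x' x * (h x' * u x') - t * (g k x' x * (h x' * v x')))"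
    unfolding Gop_def by (simp add: algebra_simps)
  also have "\<dots> = Gop k (\<lambda>x'. h x' * u x') x - t * Gop k (\<lambda>x'. h x' * v x') x"
    unfolding Gop_def using assms by (simp add: Gop_integrable bounded_measurable_mult)
  finally show ?thesis by (simp add: gmean_def diff_divide_distrib)
qed

lemma gmean_abs_le:
  assumes h: "bounded_measurable M h" "\<And>x. x \<in> space M \<Longrightarrow> 0 < h x" and u: "bounded_measurable M u"
    and D: "\<And>x. x \<in> space M \<Longrightarrow> \<bar>u x\<bar> \<le> D" and x: "x \<in> space M"
  shows "\<bar>gmean k h u x\<bar> \<le> \<Gamma> * D"
proof -
  have "\<bar>Gop k (\<lambda>x'. h x' * u x') x\<bar> \<le> (LINT x'|M. \<Gamma> * D * (f k x' x * h x'))"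
    unfolding Gop_def
  proof (rule abs_integral_le)
    show "\<bar>g k x' x * (h x' * u x')\<bar> \<le> \<Gamma> * D * (f k x' x * h x')" if x': "x' \<in> space M" for x'
    proof -
      have "\<bar>g k x' x\<bar> * (h x' * \<bar>u x'\<bar>) \<le> (\<Gamma> * f k x' x) * (h x' * D)"
        using D[OF x'] f_pos[OF x x'] h(2)[OF x'] g_bound[OF x x'] Gamma
        by (intro mult_mono) (auto simp: less_imp_le)
      then show ?thesis using h(2)[OF x'] by (simp add: abs_mult mult_ac)
    qed
  qed (use assms in \<open>auto intro!: Fop_integrable Gop_integrable bounded_measurable_mult\<close>)
  also have "\<dots> = \<Gamma> * D * Fop k h x" by (simp add: Fop_def)
  finally show ?thesis using Fop_pos[OF h x, of k] by (simp add: gmean_def pos_divide_le_eq)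
qed

lemma Fop_cong: "(\<And>x'. x' \<in> space M \<Longrightarrow> \<phi> x' = \<psi> x') \<Longrightarrow> Fop k \<phi> x = Fop k \<psi> x"
  unfolding Fop_def by (intro Bochner_Integration.integral_cong) auto

lemma Gop_cong: "(\<And>x'. x' \<in> space M \<Longrightarrow> \<phi> x' = \<psi> x') \<Longrightarrow> Gop k \<phi> x = Gop k \<psi> x"
  unfolding Gop_def by (intro Bochner_Integration.integral_cong) auto

lemma H_nprop: "x \<in> space M \<Longrightarrow> H j k x * nprop j k \<phi> x = fprop j k \<phi> x"
  using H_positive[of x j k] by (simp add: nprop_def)

lemma H_ndprop: "x \<in> space M \<Longrightarrow> H j k x * ndprop j k \<phi> x = dprop j k \<phi> x"
  using H_positive[of x j k] by (simp add: ndprop_def)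

text \<open>After division by the likelihoods the propagation becomes a composition of averaging
  operators, to which the contraction applies step by step.\<close>

lemma nprop_Suc: "nprop (Suc j) k \<phi> x = fmean k (H j (Suc k)) (nprop j (Suc k) \<phi>) x"
proof -
  have "Fop k (fprop j (Suc k) \<phi>) x = Fop k (\<lambda>x'. H j (Suc k) x' * nprop j (Suc k) \<phi> x') x"
    by (rule Fop_cong) (simp add: H_nprop)
  then show ?thesis by (simp add: fmean_def H_Suc nprop_def[of "Suc j"])
qed

text \<open>The product rule in normalised form: the gradient falls either on the first step or,
  averaged over the next state, on the later ones.\<close>

lemma ndprop_Suc:
  "ndprop (Suc j) k \<phi> x = gmean k (H j (Suc k)) (nprop j (Suc k) \<phi>) x + fmean k (H j (Suc k)) (ndprop j (Suc k) \<phi>) x"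
proof -
  have "Gop k (fprop j (Suc k) \<phi>) x = Gop k (\<lambda>x'. H j (Suc k) x' * nprop j (Suc k) \<phi> x') x"
    by (rule Gop_cong) (simp add: H_nprop)
  moreover have "Fop k (dprop j (Suc k) \<phi>) x = Fop k (\<lambda>x'. H j (Suc k) x' * ndprop j (Suc k) \<phi> x') x"
    by (rule Fop_cong) (simp add: H_ndprop)
  ultimately show ?thesis by (simp add: fmean_def gmean_def H_Suc ndprop_def[of "Suc j"] add_divide_distrib)
qed

lemma nprop_one: "x \<in> space M \<Longrightarrow> nprop j k (\<lambda>_. 1) x = 1"
  using H_positive[of x j k] by (simp add: nprop_def H_def)

section \<open>Forgetting of the starting point\<close>

definition \<rho> :: real where "\<rho> = 1 - \<delta>\<^sup>2"

lemma rho: "0 < \<rho>" "\<rho> < 1"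
  using delta by (simp_all add: \<rho>_def power_less_one_iff abs_square_less_1)

text \<open>Iterated contraction, beginning with centre 0 and radius 1. The centre is existential
  because it changes at every step; a radius around some centre serves as the measure of oscillation
  throughout.\<close>

lemma nprop_near_const:
  assumes \<phi>: "bounded_measurable M \<phi>" "\<And>x. x \<in> space M \<Longrightarrow> \<bar>\<phi> x\<bar> \<le> 1"
  shows "\<exists>c. \<forall>x\<in>space M. \<bar>nprop j k \<phi> x - c\<bar> \<le> \<rho> ^ j"
proof (induction j arbitrary: k)
  case 0
  show ?case using \<phi>(2) by (intro exI[of _ 0]) (simp add: nprop_def H_0)
next
  case (Suc j)
  from Suc[of "Suc k"] obtain c where "\<And>x. x \<in> space M \<Longrightarrow> \<bar>nprop j (Suc k) \<phi> x - c\<bar> \<le> \<rho> ^ j" by blast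
  from fmean_contraction[OF H_bounded_measurable H_positive nprop_bound(1)[OF \<phi>(1)] this, of k]
  show ?case by (simp add: nprop_Suc \<rho>_def)
qed

text \<open>\<open>ndprop j k (\<lambda>_. 1)\<close> plays the part of the derivative of the
  log-likelihood. Its oscillation D obeys D' \<le> \<Gamma> + (1 - \<delta>^2) D, and
  \<Gamma>/\<delta>^2 is the fixed point of this recursion.\<close>

lemma ndprop_one_near_const:
  "\<exists>c. \<forall>x\<in>space M. \<bar>ndprop j k (\<lambda>_. 1) x - c\<bar> \<le> \<Gamma> / \<delta>\<^sup>2"
proof (induction j arbitrary: k)
  case 0
  show ?case using Gamma by (intro exI[of _ 0]) (simp add: ndprop_def)
next
  case (Suc j)
  from Suc[of "Suc k"] obtain c where "\<And>x. x \<in> space M \<Longrightarrow> \<bar>ndprop j (Suc k) (\<lambda>_. 1) x - c\<bar> \<le> \<Gamma> / \<delta>\<^sup>2" by blast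
  from fmean_contraction[OF H_bounded_measurable H_positive nprop_bound(2)[OF bounded_measurable_const] this, of k]
  obtain c' where c': "\<And>x. x \<in> space M \<Longrightarrow> \<bar>fmean k (H j (Suc k)) (ndprop j (Suc k) (\<lambda>_. 1)) x - c'\<bar> \<le> (1 - \<delta>\<^sup>2) * (\<Gamma> / \<delta>\<^sup>2)"
    by blast
  show ?case
  proof (intro exI[of _ c'] ballI)
    fix x assume x: "x \<in> space M"
    have "\<bar>gmean k (H j (Suc k)) (nprop j (Suc k) (\<lambda>_. 1)) x\<bar> \<le> \<Gamma> * 1"
      by (intro gmean_abs_le H_bounded_measurable H_positive nprop_bound bounded_measurable_const x) (simp_all add: nprop_one)
    with c'[OF x] have "\<bar>ndprop (Suc j) k (\<lambda>_. 1) x - c'\<bar> \<le> \<Gamma> + (1 - \<delta>\<^sup>2) * (\<Gamma> / \<delta>\<^sup>2)"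
      unfolding ndprop_Suc by linarith
    also have "\<dots> = \<Gamma> / \<delta>\<^sup>2" using delta by (simp add: field_simps)
    finally show "\<bar>ndprop (Suc j) k (\<lambda>_. 1) x - c'\<bar> \<le> \<Gamma> / \<delta>\<^sup>2" .
  qed
qed

text \<open>Each step contributes at most \<Gamma>. This bound on the size, not on the oscillation,
  is needed where the weights are centred with a mean that includes the future score.\<close>

lemma ndprop_one_abs_le: "x \<in> space M \<Longrightarrow> \<bar>ndprop j k (\<lambda>_. 1) x\<bar> \<le> \<Gamma> * real j"
proof (induction j arbitrary: k x)
  case (Suc j)
  have "\<bar>gmean k (H j (Suc k)) (nprop j (Suc k) (\<lambda>_. 1)) x\<bar> \<le> \<Gamma> * 1"
    by (intro gmean_abs_le H_bounded_measurable H_positive nprop_bound bounded_measurable_const Suc) (simp_all add: nprop_one)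
  moreover have "\<bar>fmean k (H j (Suc k)) (ndprop j (Suc k) (\<lambda>_. 1)) x\<bar> \<le> \<Gamma> * real j"
    by (intro fmean_abs_le H_bounded_measurable H_positive nprop_bound bounded_measurable_const Suc)
  ultimately show ?case unfolding ndprop_Suc by (simp add: algebra_simps)
qed (simp add: ndprop_def)

text \<open>
  The score accumulated between the times \<open>k\<close> and \<open>k + j\<close> is of order \<open>j\<close>, but its covariance
  with \<open>\<phi>\<close> at the final time is of order \<open>j \<rho>\<^sup>j\<close>: a gradient at an intermediate time is seen
  neither far behind nor far ahead.  The centring \<open>\<kappa>\<close> may differ from step to step at the cost of the
  bounded oscillation of \<open>ndprop j k 1\<close>.
\<close>

lemma ndprop_centred_near_const:
  assumes \<phi>: "bounded_measurable M \<phi>" "\<And>x. x \<in> space M \<Longrightarrow> \<bar>\<phi> x\<bar> \<le> 1"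
    and \<kappa>: "\<And>x. x \<in> space M \<Longrightarrow> \<bar>nprop j k \<phi> x - \<kappa>\<bar> \<le> 2 * \<rho> ^ j"
  shows "\<exists>c. \<forall>x\<in>space M. \<bar>ndprop j k \<phi> x - \<kappa> * ndprop j k (\<lambda>_. 1) x - c\<bar> \<le> 4 * \<Gamma> / \<delta>\<^sup>2 * (real j * \<rho> ^ (j - 1))"
  using \<kappa>
proof (induction j arbitrary: k \<kappa>)
  case 0
  show ?case by (intro exI[of _ 0]) (simp add: ndprop_def)
next
  case (Suc j)
  let ?R = "\<Gamma> / \<delta>\<^sup>2" and ?h = "H j (Suc k)" and ?u = "nprop j (Suc k) \<phi>" and ?v = "ndprop j (Suc k) \<phi>"
    and ?v1 = "ndprop j (Suc k) (\<lambda>_. 1)" and ?u1 = "nprop j (Suc k) (\<lambda>_. 1)"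
  have R: "0 \<le> ?R" using Gamma by simp
  obtain x0 where x0: "x0 \<in> space M" using mass by (cases "space M = {}") auto
  \<comment> \<open>The given \<kappa> is a centre for time k, while the induction hypothesis asks
    for one at time k + 1.\<close>
  obtain \<kappa>' where \<kappa>': "\<And>x. x \<in> space M \<Longrightarrow> \<bar>?u x - \<kappa>'\<bar> \<le> \<rho> ^ j"
    using nprop_near_const[OF \<phi>, where j=j and k="Suc k"] by blast
  then have "\<And>x. x \<in> space M \<Longrightarrow> \<bar>?u x - \<kappa>'\<bar> \<le> 2 * \<rho> ^ j"
    using rho by (smt (verit) zero_le_power)
  from Suc.IH[OF this] obtain c where
    c: "\<And>x. x \<in> space M \<Longrightarrow> \<bar>(?v x - \<kappa>' * ?v1 x) - c\<bar> \<le> 4 * \<Gamma> / \<delta>\<^sup>2 * (real j * \<rho> ^ (j - 1))" by blast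
  note bm = H_bounded_measurable[of j "Suc k"] nprop_bound[OF \<phi>(1)] nprop_bound[OF bounded_measurable_const]
  note bmd = bounded_measurable_diff[OF nprop_bound(2)[OF \<phi>(1)] bounded_measurable_mult[OF bounded_measurable_const nprop_bound(2)[OF bounded_measurable_const]]]
  from fmean_contraction[OF bm(1) H_positive bmd c, of k]
  obtain c' where c': "\<And>x. x \<in> space M \<Longrightarrow> \<bar>fmean k ?h (\<lambda>x. ?v x - \<kappa>' * ?v1 x) x - c'\<bar>
      \<le> (1 - \<delta>\<^sup>2) * (4 * \<Gamma> / \<delta>\<^sup>2 * (real j * \<rho> ^ (j - 1)))" by blast
  obtain c1 where c1: "\<And>x. x \<in> space M \<Longrightarrow> \<bar>ndprop (Suc j) k (\<lambda>_. 1) x - c1\<bar> \<le> ?R"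
    using ndprop_one_near_const[of "Suc j" k] by blast
  \<comment> \<open>At a point x0 the value of \<open>nprop (Suc j) k \<phi>\<close> is an average
    of values within \<rho>^j of \<kappa>', and it is also within 2 \<rho>^(j+1) of
    \<kappa>.\<close>
  have "\<bar>\<kappa> - \<kappa>'\<bar> \<le> 3 * \<rho> ^ j"
  proof -
    have "\<bar>fmean k ?h (\<lambda>x. ?u x - \<kappa>' * ?u1 x) x0\<bar> \<le> \<rho> ^ j"
      using \<kappa>' by (intro fmean_abs_le bm H_positive x0 bounded_measurable_intros) (simp_all add: nprop_one)
    then have "\<bar>nprop (Suc j) k \<phi> x0 - \<kappa>'\<bar> \<le> \<rho> ^ j"
      using x0 by (simp add: fmean_diff bm nprop_Suc[symmetric] nprop_one)
    moreover have "\<bar>nprop (Suc j) k \<phi> x0 - \<kappa>\<bar> \<le> 2 * \<rho> ^ Suc j" by (rule Suc.prems[OF x0])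
    moreover have "\<rho> ^ Suc j \<le> \<rho> ^ j" using rho by (simp add: mult_left_le_one_le)
    ultimately show ?thesis by linarith
  qed
  then have \<kappa>c: "\<bar>\<kappa> - \<kappa>'\<bar> * ?R \<le> 3 * \<rho> ^ j * ?R" using R by (rule mult_right_mono)
  show ?case
  proof (intro exI[of _ "c' - (\<kappa> - \<kappa>') * c1"] ballI)
    fix x assume x: "x \<in> space M"
    have "\<bar>gmean k ?h (\<lambda>x. ?u x - \<kappa>' * ?u1 x) x\<bar> \<le> \<Gamma> * \<rho> ^ j"
      using \<kappa>' by (intro gmean_abs_le bm H_positive x bounded_measurable_intros) (simp_all add: nprop_one)
    also have "\<dots> \<le> ?R * \<rho> ^ j"
    proof (rule mult_right_mono)
      have "\<delta>\<^sup>2 \<le> 1" using delta by (simp add: power_le_one)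
      then show "\<Gamma> \<le> ?R" using Gamma delta by (simp add: field_simps mult_left_le)
    qed (use rho in simp)
    finally have 1: "\<bar>gmean k ?h (\<lambda>x. ?u x - \<kappa>' * ?u1 x) x\<bar> \<le> ?R * \<rho> ^ j" .
    \<comment> \<open>Three contributions: the gradient of the current step, the average of the
      later ones, and the change of centre. The last multiplies the score for the function 1, whose
      oscillation around \<open>c1\<close> is bounded.\<close>
    have eq: "ndprop (Suc j) k \<phi> x - \<kappa> * ndprop (Suc j) k (\<lambda>_. 1) x - (c' - (\<kappa> - \<kappa>') * c1) =
        gmean k ?h (\<lambda>x. ?u x - \<kappa>' * ?u1 x) x + (fmean k ?h (\<lambda>x. ?v x - \<kappa>' * ?v1 x) x - c')
        - (\<kappa> - \<kappa>') * (ndprop (Suc j) k (\<lambda>_. 1) x - c1)"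
      using x by (simp add: gmean_diff fmean_diff bm ndprop_Suc algebra_simps)
    have 2: "\<bar>(\<kappa> - \<kappa>') * (ndprop (Suc j) k (\<lambda>_. 1) x - c1)\<bar> \<le> 3 * \<rho> ^ j * ?R"
      using mult_left_mono[OF c1[OF x], of "\<bar>\<kappa> - \<kappa>'\<bar>"] \<kappa>c by (simp add: abs_mult)
    have "\<bar>ndprop (Suc j) k \<phi> x - \<kappa> * ndprop (Suc j) k (\<lambda>_. 1) x - (c' - (\<kappa> - \<kappa>') * c1)\<bar>
        \<le> ?R * \<rho> ^ j + (1 - \<delta>\<^sup>2) * (4 * \<Gamma> / \<delta>\<^sup>2 * (real j * \<rho> ^ (j - 1))) + 3 * \<rho> ^ j * ?R"
      unfolding eq using 1 2 c'[OF x] by linarith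
    \<comment> \<open>One share of \<rho>^j from the current gradient and three from the change of
      centre make up the 4, and contraction turns j \<rho>^(j-1) into j \<rho>^j.\<close>
    also have "\<dots> = 4 * \<Gamma> / \<delta>\<^sup>2 * (real (Suc j) * \<rho> ^ (Suc j - 1))"
    proof -
      have "\<rho> * (real j * \<rho> ^ (j - 1)) = real j * \<rho> ^ j" by (cases j) simp_all
      then have *: "(1 - \<delta>\<^sup>2) * (4 * \<Gamma> / \<delta>\<^sup>2 * (real j * \<rho> ^ (j - 1))) = 4 * ?R * (real j * \<rho> ^ j)"
        unfolding \<rho>_def[symmetric] by (auto simp: mult.left_commute)
      show ?thesis unfolding * by (simp add: algebra_simps add_divide_distrib)
    qed
    finally show "\<bar>ndprop (Suc j) k \<phi> x - \<kappa> * ndprop (Suc j) k (\<lambda>_. 1) x - (c' - (\<kappa> - \<kappa>') * c1)\<bar>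
        \<le> 4 * \<Gamma> / \<delta>\<^sup>2 * (real (Suc j) * \<rho> ^ (Suc j - 1))" .
  qed
qed


section \<open>Bias of a single sampling step\<close>

lemma bounded_ratio_H:
  assumes "prob_space \<eta>" "sets \<eta> = sets M"
  shows "bounded_ratio \<eta> (H j k) (1 / \<delta>\<^sup>2)"
proof -
  interpret prob_space \<eta> by fact
  have "space \<eta> = space M" using assms(2) by (rule sets_eq_imp_space_eq)
  then show ?thesis
    using bounded_measurable_borel[OF H_bounded_measurable] H_positive H_ratio_bound assms(2)
    by unfold_locales (auto cong: measurable_cong_sets)
qed

text \<open>The exact filter started at time k from the equally weighted particles \<open>X\<close>
  and run for j steps. For j = 0 it is the particle estimate itself; the telescope lowers k and
  raises j.\<close>

definition particle_filter :: "nat \<Rightarrow> nat \<Rightarrow> nat \<Rightarrow> ('a \<Rightarrow> real) \<Rightarrow> (nat \<Rightarrow> 'a) \<Rightarrow> real" where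
  "particle_filter N j k \<phi> X = (\<Sum>i=1..N. fprop j k \<phi> (X i)) / (\<Sum>i=1..N. H j k (X i))"

text \<open>The parameter derivative of that filter when particle i carries \<open>w i\<close> as
  the score of its past. For j = 0 it is the empirical covariance of the weights and the test
  function.\<close>

definition particle_deriv ::
  "nat \<Rightarrow> nat \<Rightarrow> nat \<Rightarrow> ('a \<Rightarrow> real) \<Rightarrow> (nat \<Rightarrow> 'a) \<Rightarrow> (nat \<Rightarrow> real) \<Rightarrow> real" where
  "particle_deriv N j k \<phi> X w = quot_deriv (\<Sum>i=1..N. fprop j k \<phi> (X i)) (\<Sum>i=1..N. H j k (X i))
     (\<Sum>i=1..N. dprop j k \<phi> (X i) + w i * fprop j k \<phi> (X i))
     (\<Sum>i=1..N. dprop j k (\<lambda>_. 1) (X i) + w i * H j k (X i))"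

definition law_deriv :: "nat \<Rightarrow> nat \<Rightarrow> ('a \<Rightarrow> real) \<Rightarrow> 'a measure \<Rightarrow> ('a \<Rightarrow> real) \<Rightarrow> real" where
  "law_deriv j k \<phi> \<eta> W = quot_deriv (LINT x|\<eta>. fprop j k \<phi> x) (LINT x|\<eta>. H j k x)
     (LINT x|\<eta>. dprop j k \<phi> x + W x * fprop j k \<phi> x)
     (LINT x|\<eta>. dprop j k (\<lambda>_. 1) x + W x * H j k x)"

text \<open>A self-normalised mean of \<open>nprop j k \<phi>\<close> with importance weights
  \<open>H j k\<close>. The function lies within \<rho>^j of some centre, hence within 2 \<rho>^j of
  its mean, and the likelihood ratio is \<beta> = 1/\<delta>^2.\<close>

lemma particle_filter_bias:
  assumes \<eta>: "prob_space \<eta>" "sets \<eta> = sets M" and N: "N \<ge> 1"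
    and \<phi>: "bounded_measurable M \<phi>" "\<And>x. x \<in> space M \<Longrightarrow> \<bar>\<phi> x\<bar> \<le> 1"
  shows "\<bar>(LINT X|(\<Pi>\<^sub>M i\<in>{1..N}. \<eta>). particle_filter N j k \<phi> X)
      - (LINT x|\<eta>. fprop j k \<phi> x) / (LINT x|\<eta>. H j k x)\<bar> \<le> 2 * (1 / \<delta>\<^sup>2) ^ 3 * \<rho> ^ j / N"
proof -
  interpret bounded_ratio \<eta> "H j k" "1 / \<delta>\<^sup>2" by (rule bounded_ratio_H[OF \<eta>])
  have sp: "space \<eta> = space M" using \<eta>(2) by (rule sets_eq_imp_space_eq)
  have [measurable]: "nprop j k \<phi> \<in> borel_measurable \<eta>"
    using bounded_measurable_borel[OF nprop_bound(1)[OF \<phi>(1)]] \<eta>(2) by (simp cong: measurable_cong_sets)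
  obtain c where c: "\<And>x. x \<in> space \<eta> \<Longrightarrow> \<bar>nprop j k \<phi> x - c\<bar> \<le> \<rho> ^ j"
    using nprop_near_const[OF \<phi>, where j=j and k=k] sp by auto
  have near: "\<bar>nprop j k \<phi> x - hmean (nprop j k \<phi>)\<bar> \<le> 2 * \<rho> ^ j" if "x \<in> space \<eta>" for x
  proof -
    have "\<bar>hmean (nprop j k \<phi>) - c\<bar> \<le> \<rho> ^ j" by (rule hmean_near[OF _ c]) auto
    with c[OF that] show ?thesis by linarith
  qed
  have 1: "emp_mean N (\<lambda>x. H j k x * nprop j k \<phi> x) X / emp_mean N (H j k) X = particle_filter N j k \<phi> X"
    if "X \<in> space (\<Pi>\<^sub>M i\<in>{1..N}. \<eta>)" for X
  proof -
    have "(\<Sum>i=1..N. H j k (X i) * nprop j k \<phi> (X i)) = (\<Sum>i=1..N. fprop j k \<phi> (X i))"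
      using that sp by (intro sum.cong) (auto simp: space_PiM intro!: H_nprop)
    then show ?thesis using N by (simp add: emp_mean_def particle_filter_def)
  qed
  have 2: "hmean (nprop j k \<phi>) = (LINT x|\<eta>. fprop j k \<phi> x) / (LINT x|\<eta>. H j k x)"
  proof -
    have "(LINT x|\<eta>. H j k x * nprop j k \<phi> x) = (LINT x|\<eta>. fprop j k \<phi> x)"
      by (rule Bochner_Integration.integral_cong) (auto simp: sp H_nprop)
    then show ?thesis by (simp add: hmean_def)
  qed
  have "(LINT X|(\<Pi>\<^sub>M i\<in>{1..N}. \<eta>). emp_mean N (\<lambda>x. H j k x * nprop j k \<phi> x) X / emp_mean N (H j k) X) =
      (LINT X|(\<Pi>\<^sub>M i\<in>{1..N}. \<eta>). particle_filter N j k \<phi> X)"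
    by (rule Bochner_Integration.integral_cong) (auto simp: 1)
  with emp_ratio_bias[OF _ near N] show ?thesis by (simp add: 2 mult_ac)
qed

text \<open>With \<beta> = 1/\<delta>^2, the first summand comes from V + T U and the second from U
  S in \<open>emp_quot_deriv_bias\<close>, after the factor (j+1) \<rho>^j (1+D) has been taken out.
  The division by \<rho> makes up for the exponent j - 1.\<close>

definition step_const :: real where
  "step_const = 2 * (1 / \<delta>\<^sup>2) ^ 3 * (4 * (\<Gamma> / \<delta>\<^sup>2) / \<rho> + (4 + 2 * \<Gamma>)) + (1 / \<delta>\<^sup>2) ^ 4 * (4 * (\<Gamma> / \<delta>\<^sup>2 + 1))"

lemma step_const_nonneg: "0 \<le> step_const"
  using Gamma rho unfolding step_const_def by (intro add_nonneg_nonneg mult_nonneg_nonneg divide_nonneg_nonneg) auto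

text \<open>Here U is of order \<rho>^j and V of order j \<rho>^(j-1), whereas S is only bounded in
  j and T grows linearly. Since S and T are multiplied by U, the whole is of order (j+1) \<rho>^j.
  The weights enter through their oscillation \<open>D\<close> alone.\<close>

lemma particle_deriv_bias:
  assumes \<eta>: "prob_space \<eta>" "sets \<eta> = sets M" and N: "N \<ge> 1"
    and \<phi>: "bounded_measurable M \<phi>" "\<And>x. x \<in> space M \<Longrightarrow> \<bar>\<phi> x\<bar> \<le> 1"
    and W: "W \<in> borel_measurable M" "\<And>x. x \<in> space M \<Longrightarrow> \<bar>W x - c\<bar> \<le> D"
  shows "\<bar>(LINT X|(\<Pi>\<^sub>M i\<in>{1..N}. \<eta>). particle_deriv N j k \<phi> X (\<lambda>i. W (X i))) - law_deriv j k \<phi> \<eta> W\<bar>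
      \<le> step_const * (real (Suc j) * \<rho> ^ j * (1 + D)) / N"
proof -
  let ?P = "\<Pi>\<^sub>M i\<in>{1..N}. \<eta>" and ?u = "nprop j k \<phi>" and ?v = "ndprop j k \<phi>" and ?v1 = "ndprop j k (\<lambda>_. 1)"
    and ?R = "\<Gamma> / \<delta>\<^sup>2"
  interpret bounded_ratio \<eta> "H j k" "1 / \<delta>\<^sup>2" by (rule bounded_ratio_H[OF \<eta>])
  have sp: "space \<eta> = space M" using \<eta>(2) by (rule sets_eq_imp_space_eq)
  have meas: "a \<in> borel_measurable M \<Longrightarrow> a \<in> borel_measurable \<eta>" for a :: "'a \<Rightarrow> real"
    using \<eta>(2) by (simp cong: measurable_cong_sets)
  have [measurable]: "?u \<in> borel_measurable \<eta>" "?v \<in> borel_measurable \<eta>" "?v1 \<in> borel_measurable \<eta>" "W \<in> borel_measurable \<eta>"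
    by (intro meas bounded_measurable_borel nprop_bound \<phi> bounded_measurable_const W(1))+
  obtain x0 where x0: "x0 \<in> space \<eta>" using not_empty by auto
  then have D: "0 \<le> D" using order_trans[OF abs_ge_zero W(2)] sp by auto
  obtain cu where cu: "\<And>x. x \<in> space \<eta> \<Longrightarrow> \<bar>?u x - cu\<bar> \<le> \<rho> ^ j"
    using nprop_near_const[OF \<phi>, where j=j and k=k] sp by auto
  have U: "\<bar>?u x - hmean ?u\<bar> \<le> 2 * \<rho> ^ j" if "x \<in> space \<eta>" for x
  proof -
    have "\<bar>hmean ?u - cu\<bar> \<le> \<rho> ^ j" by (rule hmean_near[OF _ cu]) auto
    with cu[OF that] show ?thesis by linarith
  qed
  obtain cv where V: "\<And>x. x \<in> space \<eta> \<Longrightarrow> \<bar>?v x - hmean ?u * ?v1 x - cv\<bar> \<le> 4 * \<Gamma> / \<delta>\<^sup>2 * (real j * \<rho> ^ (j - 1))"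
    using ndprop_centred_near_const[OF \<phi>, where j=j and k=k and \<kappa>="hmean ?u"] U sp by auto
  obtain c1 where c1: "\<And>x. x \<in> space \<eta> \<Longrightarrow> \<bar>?v1 x - c1\<bar> \<le> ?R"
    using ndprop_one_near_const[of j k] sp by auto
  have sn: "\<bar>?v1 x + W x - (c1 + c)\<bar> \<le> ?R + D" if "x \<in> space \<eta>" for x
    using c1[OF that] W(2)[of x] that sp by simp
  have S: "\<bar>?v1 x + W x - hmean (\<lambda>x. ?v1 x + W x)\<bar> \<le> 2 * (?R + D)" if "x \<in> space \<eta>" for x
  proof -
    have "\<bar>hmean (\<lambda>x. ?v1 x + W x) - (c1 + c)\<bar> \<le> ?R + D" by (rule hmean_near[OF _ sn]) auto
    from abs_diff_near[OF sn[OF that] this] show ?thesis by (simp only: mult_2)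
  qed
  \<comment> \<open>The mean to be compared with \<open>W\<close> contains \<open>?v1\<close>, which
    may grow linearly in j; the centre here is that of the weights alone.\<close>
  have tn: "\<bar>?v1 x + W x - c\<bar> \<le> \<Gamma> * real j + D" if "x \<in> space \<eta>" for x
    using ndprop_one_abs_le[of x j k] W(2)[of x] that sp by simp
  have T: "\<bar>W x - hmean (\<lambda>x. ?v1 x + W x)\<bar> \<le> 2 * D + \<Gamma> * real j" if "x \<in> space \<eta>" for x
  proof -
    have "\<bar>hmean (\<lambda>x. ?v1 x + W x) - c\<bar> \<le> \<Gamma> * real j + D" by (rule hmean_near[OF _ tn]) auto
    moreover have "\<bar>W x - c\<bar> \<le> D" using that sp by (intro W(2)) simp
    ultimately have "\<bar>W x - hmean (\<lambda>x. ?v1 x + W x)\<bar> \<le> D + (\<Gamma> * real j + D)" by (rule abs_diff_near[rotated])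
    also have "\<dots> = 2 * D + \<Gamma> * real j" by simp
    finally show ?thesis .
  qed
  have lift: "H j k x * (ndprop j k \<psi> x + W x * nprop j k \<psi> x) = dprop j k \<psi> x + W x * fprop j k \<psi> x"
    if "x \<in> space M" for x \<psi>
    using H_nprop[OF that, of j k \<psi>] H_ndprop[OF that, of j k \<psi>] by (simp add: distrib_left mult.left_commute)
  have lift1: "H j k x * (?v1 x + W x) = dprop j k (\<lambda>_. 1) x + W x * H j k x" if "x \<in> space M" for x
    using lift[OF that, of "\<lambda>_. 1"] nprop_one[OF that] by (simp add: H_def)
  have 1: "quot_deriv (emp_mean N (\<lambda>x. H j k x * ?u x) X) (emp_mean N (H j k) X)
        (emp_mean N (\<lambda>x. H j k x * (?v x + W x * ?u x)) X) (emp_mean N (\<lambda>x. H j k x * (?v1 x + W x)) X)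
      = particle_deriv N j k \<phi> X (\<lambda>i. W (X i))" if X: "X \<in> space ?P" for X
  proof -
    have Xi: "X i \<in> space M" if "i \<in> {1..N}" for i using X that sp by (auto simp: space_PiM)
    have "particle_deriv N j k \<phi> X (\<lambda>i. W (X i)) = quot_deriv
       (1 / real N * (\<Sum>i=1..N. fprop j k \<phi> (X i))) (1 / real N * (\<Sum>i=1..N. H j k (X i)))
       (1 / real N * (\<Sum>i=1..N. dprop j k \<phi> (X i) + W (X i) * fprop j k \<phi> (X i)))
       (1 / real N * (\<Sum>i=1..N. dprop j k (\<lambda>_. 1) (X i) + W (X i) * H j k (X i)))"
      unfolding particle_deriv_def using N by (subst quot_deriv_scale) auto
    then show ?thesis
      using Xi by (simp add: emp_mean_def H_nprop lift lift1)
  qed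
  have 2: "quot_deriv (LINT x|\<eta>. H j k x * ?u x) (LINT x|\<eta>. H j k x)
        (LINT x|\<eta>. H j k x * (?v x + W x * ?u x)) (LINT x|\<eta>. H j k x * (?v1 x + W x)) = law_deriv j k \<phi> \<eta> W"
  proof -
    have "(LINT x|\<eta>. H j k x * ?u x) = (LINT x|\<eta>. fprop j k \<phi> x)"
      "(LINT x|\<eta>. H j k x * (?v x + W x * ?u x)) = (LINT x|\<eta>. dprop j k \<phi> x + W x * fprop j k \<phi> x)"
      "(LINT x|\<eta>. H j k x * (?v1 x + W x)) = (LINT x|\<eta>. dprop j k (\<lambda>_. 1) x + W x * H j k x)"
      by (rule Bochner_Integration.integral_cong; simp add: sp H_nprop lift lift1)+
    then show ?thesis by (simp add: law_deriv_def)
  qed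
  have le: "2 * (1 / \<delta>\<^sup>2) ^ 3 * (4 * \<Gamma> / \<delta>\<^sup>2 * (real j * \<rho> ^ (j - 1)) + (2 * D + \<Gamma> * real j) * (2 * \<rho> ^ j))
      + (1 / \<delta>\<^sup>2) ^ 4 * (2 * \<rho> ^ j * (2 * (?R + D))) \<le> step_const * (real (Suc j) * \<rho> ^ j * (1 + D))"
  proof -
    define E where "E = real (Suc j) * \<rho> ^ j * (1 + D)"
    have rj: "0 \<le> \<rho> ^ j" using rho by simp
    have R: "0 \<le> ?R" using Gamma by simp
    \<comment> \<open>At j = 0 the truncated exponent is harmless, since the factor
      \<open>real j\<close> vanishes.\<close>
    have "real j * \<rho> ^ (j - 1) * \<rho> \<le> E"
    proof -
      have "real j * \<rho> ^ (j - 1) * \<rho> = real j * \<rho> ^ j * 1" by (cases j) auto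
      also have "\<dots> \<le> E" unfolding E_def using rj D by (intro mult_mono) auto
      finally show ?thesis .
    qed
    then have "real j * \<rho> ^ (j - 1) \<le> E / \<rho>" using rho by (simp add: field_simps)
    from mult_left_mono[OF this, of "4 * ?R"] R
    have a: "4 * \<Gamma> / \<delta>\<^sup>2 * (real j * \<rho> ^ (j - 1)) \<le> 4 * ?R / \<rho> * E" by simp
    have "(2 * D + \<Gamma> * real j) * 2 \<le> (4 + 2 * \<Gamma>) * (real (Suc j) * (1 + D))"
      using D Gamma by (simp add: algebra_simps)
    from mult_right_mono[OF this rj]
    have b: "(2 * D + \<Gamma> * real j) * (2 * \<rho> ^ j) \<le> (4 + 2 * \<Gamma>) * E" by (simp only: E_def mult_ac)
    have "4 * (?R + D) \<le> 4 * ((?R + 1) * (real (Suc j) * (1 + D)))"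
    proof -
      have "?R + D \<le> (?R + 1) * (1 + D)" using mult_nonneg_nonneg[OF R D] by (simp add: distrib_left distrib_right)
      also have "\<dots> \<le> (?R + 1) * (real (Suc j) * (1 + D))"
        using R D by (intro mult_left_mono) (auto simp: algebra_simps)
      finally show ?thesis by (intro mult_left_mono) auto
    qed
    from mult_right_mono[OF this rj]
    have "4 * (?R + D) * \<rho> ^ j \<le> 4 * (?R + 1) * E" by (simp only: E_def mult_ac)
    then have c: "2 * \<rho> ^ j * (2 * (?R + D)) \<le> 4 * (?R + 1) * E" by (simp add: algebra_simps)
    have "2 * (1 / \<delta>\<^sup>2) ^ 3 * (4 * \<Gamma> / \<delta>\<^sup>2 * (real j * \<rho> ^ (j - 1)) + (2 * D + \<Gamma> * real j) * (2 * \<rho> ^ j))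
      + (1 / \<delta>\<^sup>2) ^ 4 * (2 * \<rho> ^ j * (2 * (?R + D)))
      \<le> 2 * (1 / \<delta>\<^sup>2) ^ 3 * (4 * ?R / \<rho> * E + (4 + 2 * \<Gamma>) * E) + (1 / \<delta>\<^sup>2) ^ 4 * (4 * (?R + 1) * E)"
      by (intro add_mono mult_left_mono a b c) auto
    also have "\<dots> = step_const * E" unfolding step_const_def by (simp add: distrib_left distrib_right)
    finally show ?thesis by (simp add: E_def)
  qed
  have "\<bar>(LINT X|?P. particle_deriv N j k \<phi> X (\<lambda>i. W (X i))) - law_deriv j k \<phi> \<eta> W\<bar> \<le>
     (2 * (1 / \<delta>\<^sup>2) ^ 3 * (4 * \<Gamma> / \<delta>\<^sup>2 * (real j * \<rho> ^ (j - 1)) + (2 * D + \<Gamma> * real j) * (2 * \<rho> ^ j))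
      + (1 / \<delta>\<^sup>2) ^ 4 * (2 * \<rho> ^ j * (2 * (?R + D)))) / N"
  proof -
    have "(LINT X|?P. quot_deriv (emp_mean N (\<lambda>x. H j k x * ?u x) X) (emp_mean N (H j k) X)
        (emp_mean N (\<lambda>x. H j k x * (?v x + W x * ?u x)) X) (emp_mean N (\<lambda>x. H j k x * (?v1 x + W x)) X)) =
      (LINT X|?P. particle_deriv N j k \<phi> X (\<lambda>i. W (X i)))"
      by (rule Bochner_Integration.integral_cong) (simp_all add: 1)
    moreover note emp_quot_deriv_bias[OF _ _ _ _ U V S T N]
    ultimately show ?thesis by (simp add: 2)
  qed
  also have "\<dots> \<le> step_const * (real (Suc j) * \<rho> ^ j * (1 + D)) / N"
    using le by (intro divide_right_mono) auto
  finally show ?thesis .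
qed

section \<open>One step of the particle recursion\<close>

definition next_law :: "nat \<Rightarrow> nat \<Rightarrow> (nat \<Rightarrow> 'a) \<Rightarrow> 'a measure" where
  "next_law N k X = density M (\<lambda>x. ennreal ((\<Sum>j=1..N. f k x (X j)) / (\<Sum>j=1..N. Fop k (\<lambda>_. 1) (X j))))"

text \<open>The weight as a function of the position of the new particle, with the old particles and
  weights held fixed. In this form the weighted new particles are an i.i.d. sample with a
  deterministic weight function.\<close>

definition next_weight :: "nat \<Rightarrow> nat \<Rightarrow> (nat \<Rightarrow> 'a) \<Rightarrow> (nat \<Rightarrow> real) \<Rightarrow> 'a \<Rightarrow> real" where
  "next_weight N k X w x = (\<Sum>j=1..N. g k x (X j) + f k x (X j) * w j) / (\<Sum>j=1..N. f k x (X j))"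

context
  fixes N k :: nat and X :: "nat \<Rightarrow> 'a"
  assumes N: "N \<ge> 1" and X: "\<And>i. i \<in> {1..N} \<Longrightarrow> X i \<in> space M"
begin

lemma sum_f_pos: "x \<in> space M \<Longrightarrow> 0 < (\<Sum>j=1..N. f k x (X j))"
  using N by (intro sum_pos f_pos X) auto

lemma sum_Fop_pos: "0 < (\<Sum>j=1..N. Fop k (\<lambda>_. 1) (X j))"
  using N by (intro sum_pos Fop_pos bounded_measurable_const X) auto

lemma sets_next_law: "sets (next_law N k X) = sets M"
  by (simp add: next_law_def)

lemma integral_f_sum:
  assumes "bounded_measurable M \<phi>"
  shows "(LINT x|M. (\<Sum>j=1..N. f k x (X j)) * \<phi> x) = (\<Sum>j=1..N. Fop k \<phi> (X j))"
    "integrable M (\<lambda>x. (\<Sum>j=1..N. f k x (X j)) * \<phi> x)"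
proof -
  have i: "integrable M (\<lambda>x. f k x (X j) * \<phi> x)" if "j \<in> {1..N}" for j
    by (rule Fop_integrable[OF assms X[OF that]])
  show "(LINT x|M. (\<Sum>j=1..N. f k x (X j)) * \<phi> x) = (\<Sum>j=1..N. Fop k \<phi> (X j))"
    unfolding sum_distrib_right Fop_def by (rule Bochner_Integration.integral_sum) (rule i)
  show "integrable M (\<lambda>x. (\<Sum>j=1..N. f k x (X j)) * \<phi> x)"
    unfolding sum_distrib_right by (rule Bochner_Integration.integrable_sum) (rule i)
qed

lemma f_sum_measurable[measurable]: "(\<lambda>x. \<Sum>j=1..N. f k x (X j)) \<in> borel_measurable M"
  using X by (intro borel_measurable_sum f_comp_measurable) auto

lemma prob_space_next_law: "prob_space (next_law N k X)"
proof
  have "emeasure (next_law N k X) (space (next_law N k X)) =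
      (\<integral>\<^sup>+x. ennreal ((\<Sum>j=1..N. f k x (X j)) / (\<Sum>j=1..N. Fop k (\<lambda>_. 1) (X j))) \<partial>M)"
    by (auto simp: next_law_def emeasure_density intro!: nn_integral_cong)
  also have "\<dots> = ennreal (LINT x|M. (\<Sum>j=1..N. f k x (X j)) / (\<Sum>j=1..N. Fop k (\<lambda>_. 1) (X j)))"
    using integral_f_sum(2)[OF bounded_measurable_const[of _ 1]] sum_Fop_pos
    by (intro nn_integral_eq_integral) (auto intro!: divide_nonneg_nonneg less_imp_le[OF sum_f_pos])
  also have "(LINT x|M. (\<Sum>j=1..N. f k x (X j)) / (\<Sum>j=1..N. Fop k (\<lambda>_. 1) (X j))) = 1"
    using integral_f_sum(1)[OF bounded_measurable_const[of _ 1]] sum_Fop_pos by simp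
  finally show "emeasure (next_law N k X) (space (next_law N k X)) = 1" by simp
qed

lemma integral_next_law:
  assumes "bounded_measurable M \<phi>"
  shows "(LINT x|next_law N k X. \<phi> x) = (\<Sum>j=1..N. Fop k \<phi> (X j)) / (\<Sum>j=1..N. Fop k (\<lambda>_. 1) (X j))"
proof -
  note [measurable] = bounded_measurable_borel[OF assms]
  have "(LINT x|next_law N k X. \<phi> x) =
      (LINT x|M. (\<Sum>j=1..N. f k x (X j)) / (\<Sum>j=1..N. Fop k (\<lambda>_. 1) (X j)) * \<phi> x)"
    unfolding next_law_def using sum_Fop_pos
    by (subst integral_real_density) (auto intro!: AE_I2 divide_nonneg_nonneg less_imp_le[OF sum_f_pos])
  also have "\<dots> = (LINT x|M. (\<Sum>j=1..N. f k x (X j)) * \<phi> x) / (\<Sum>j=1..N. Fop k (\<lambda>_. 1) (X j))"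
    by (simp add: field_simps)
  finally show ?thesis by (simp add: integral_f_sum[OF assms])
qed

lemma next_weight_measurable[measurable]: "next_weight N k X w \<in> borel_measurable M"
  unfolding next_weight_def[abs_def]
  using X by (intro borel_measurable_divide borel_measurable_sum borel_measurable_add borel_measurable_times
      borel_measurable_const f_comp_measurable g_comp_measurable) auto

lemma next_weight_split:
  "next_weight N k X w x = (\<Sum>j=1..N. g k x (X j)) / (\<Sum>j=1..N. f k x (X j))
     + (\<Sum>j=1..N. f k x (X j) * w j) / (\<Sum>j=1..N. f k x (X j))"
  by (simp add: next_weight_def sum.distrib add_divide_distrib)

lemma g_sum_bound:
  assumes x: "x \<in> space M"
  shows "\<bar>(\<Sum>j=1..N. g k x (X j)) / (\<Sum>j=1..N. f k x (X j))\<bar> \<le> \<Gamma>"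
proof -
  have "\<bar>\<Sum>j=1..N. g k x (X j)\<bar> \<le> (\<Sum>j=1..N. \<Gamma> * f k x (X j))"
    using x by (intro order_trans[OF sum_abs] sum_mono g_bound X) auto
  then show ?thesis using sum_f_pos[OF x] by (simp add: sum_distrib_left pos_divide_le_eq)
qed

text \<open>Doeblin's argument once more, now averaging over the old particles: the new position x
  only chooses the averaging weights \<open>f k x (X j)\<close>. The gradient term adds at most
  \<Gamma>.\<close>

lemma next_weight_near_const:
  assumes D: "\<And>i. i \<in> {1..N} \<Longrightarrow> \<bar>w i - c\<bar> \<le> D"
  shows "\<exists>c'. \<forall>x\<in>space M. \<bar>next_weight N k X w x - c'\<bar> \<le> \<Gamma> + \<rho> * D"
proof -
  \<comment> \<open>The contraction is used with counting measure on the particle indices and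
    constant base weight 1.\<close>
  have "\<exists>c'. \<forall>x\<in>space M. \<bar>(LINT j|count_space {1..N}. f k x (X j) * 1 * w j) / (LINT j|count_space {1..N}. f k x (X j) * 1) - c'\<bar>
      \<le> (1 - \<delta>\<^sup>2) * D"
    using N by (intro weighted_mean_contraction[where c=c])
      (auto simp: delta f_bounds X D integrable_count_space lebesgue_integral_count_space_finite)
  then obtain c' where c': "\<And>x. x \<in> space M \<Longrightarrow>
      \<bar>(\<Sum>j=1..N. f k x (X j) * w j) / (\<Sum>j=1..N. f k x (X j)) - c'\<bar> \<le> \<rho> * D"
    by (auto simp: lebesgue_integral_count_space_finite \<rho>_def)
  have "\<bar>next_weight N k X w x - c'\<bar> \<le> \<Gamma> + \<rho> * D" if "x \<in> space M" for x
    using c'[OF that] g_sum_bound[OF that] unfolding next_weight_split by linarith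
  then show ?thesis by blast
qed

lemma next_weight_abs_le:
  assumes D: "\<And>i. i \<in> {1..N} \<Longrightarrow> \<bar>w i\<bar> \<le> D" and x: "x \<in> space M"
  shows "\<bar>next_weight N k X w x\<bar> \<le> \<Gamma> + D"
proof -
  have "\<bar>f k x (X j) * w j\<bar> \<le> D * f k x (X j)" if "j \<in> {1..N}" for j
    using mult_right_mono[OF D[OF that], of "f k x (X j)"] f_pos[OF X[OF that] x, of k] by (simp add: abs_mult mult_ac)
  then have "\<bar>\<Sum>j=1..N. f k x (X j) * w j\<bar> \<le> (\<Sum>j=1..N. D * f k x (X j))"
    by (intro order_trans[OF sum_abs] sum_mono) auto
  then have "\<bar>(\<Sum>j=1..N. f k x (X j) * w j) / (\<Sum>j=1..N. f k x (X j))\<bar> \<le> D"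
    using sum_f_pos[OF x] by (simp add: sum_distrib_left pos_divide_le_eq)
  with g_sum_bound[OF x] show ?thesis unfolding next_weight_split by linarith
qed

text \<open>Sampling from \<open>next_law\<close> is an exact filter step applied to the particles;
  its normaliser cancels in the quotient. This is what makes consecutive terms of the telescope
  meet.\<close>

lemma particle_filter_flow:
  assumes \<phi>: "bounded_measurable M \<phi>"
  shows "(LINT x|next_law N k X. fprop j (Suc k) \<phi> x) / (LINT x|next_law N k X. H j (Suc k) x)
    = particle_filter N (Suc j) k \<phi> X"
  unfolding particle_filter_def using sum_Fop_pos
  by (simp add: integral_next_law fprop_bounded_measurable[OF \<phi>] H_bounded_measurable H_Suc)

text \<open>The denominator of \<open>next_weight\<close> equals the numerator of the density of
  \<open>next_law\<close>, so their product is a sum over the old particles and the integral becomes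
  linear in the old weights.\<close>

lemma integral_next_weight:
  assumes \<phi>: "bounded_measurable M \<phi>" and \<psi>: "bounded_measurable M \<psi>"
  shows "(LINT x|next_law N k X. \<psi> x + next_weight N k X w x * \<phi> x) =
    (\<Sum>j=1..N. (Gop k \<phi> (X j) + Fop k \<psi> (X j)) + w j * Fop k \<phi> (X j)) / (\<Sum>j=1..N. Fop k (\<lambda>_. 1) (X j))"
proof -
  note [measurable] = bounded_measurable_borel[OF \<phi>] bounded_measurable_borel[OF \<psi>]
  let ?Z = "\<Sum>j=1..N. Fop k (\<lambda>_. 1) (X j)"
  have "(LINT x|next_law N k X. \<psi> x + next_weight N k X w x * \<phi> x) =
      (LINT x|M. (\<Sum>j=1..N. f k x (X j)) / ?Z * (\<psi> x + next_weight N k X w x * \<phi> x))"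
    unfolding next_law_def using sum_Fop_pos
    by (subst integral_real_density) (auto intro!: AE_I2 divide_nonneg_nonneg less_imp_le[OF sum_f_pos])
  also have "\<dots> = (LINT x|M. (\<Sum>j=1..N. f k x (X j)) * (\<psi> x + next_weight N k X w x * \<phi> x)) / ?Z"
    by (simp add: field_simps)
  also have "(LINT x|M. (\<Sum>j=1..N. f k x (X j)) * (\<psi> x + next_weight N k X w x * \<phi> x)) =
      (LINT x|M. (\<Sum>j=1..N. f k x (X j) * \<psi> x + (g k x (X j) * \<phi> x + w j * (f k x (X j) * \<phi> x))))"
  proof (rule Bochner_Integration.integral_cong[OF refl])
    fix x assume "x \<in> space M"
    then have *: "(\<Sum>j=1..N. f k x (X j)) * next_weight N k X w x = (\<Sum>j=1..N. g k x (X j) + f k x (X j) * w j)"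
      using sum_f_pos[of x] by (simp add: next_weight_def)
    have "(\<Sum>j=1..N. f k x (X j)) * (\<psi> x + next_weight N k X w x * \<phi> x) =
        (\<Sum>j=1..N. f k x (X j)) * \<psi> x + ((\<Sum>j=1..N. f k x (X j)) * next_weight N k X w x) * \<phi> x"
      by (simp only: distrib_left mult.assoc)
    also have "\<dots> = (\<Sum>j=1..N. f k x (X j)) * \<psi> x + (\<Sum>j=1..N. g k x (X j) + f k x (X j) * w j) * \<phi> x"
      by (simp only: *)
    also have "\<dots> = (\<Sum>j=1..N. f k x (X j) * \<psi> x + (g k x (X j) * \<phi> x + w j * (f k x (X j) * \<phi> x)))"
      unfolding sum_distrib_right sum.distrib[symmetric] by (rule sum.cong) (auto simp: algebra_simps)
    finally show "(\<Sum>j=1..N. f k x (X j)) * (\<psi> x + next_weight N k X w x * \<phi> x) =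
        (\<Sum>j=1..N. f k x (X j) * \<psi> x + (g k x (X j) * \<phi> x + w j * (f k x (X j) * \<phi> x)))" .
  qed
  also have "\<dots> = (\<Sum>j=1..N. LINT x|M. f k x (X j) * \<psi> x + (g k x (X j) * \<phi> x + w j * (f k x (X j) * \<phi> x)))"
    by (intro Bochner_Integration.integral_sum Bochner_Integration.integrable_add integrable_mult_right
        Fop_integrable Gop_integrable \<phi> \<psi> X)
  also have "\<dots> = (\<Sum>j=1..N. (Gop k \<phi> (X j) + Fop k \<psi> (X j)) + w j * Fop k \<phi> (X j))"
    by (rule sum.cong) (auto simp: Fop_integrable Gop_integrable \<phi> \<psi> X Fop_def Gop_def)
  finally show ?thesis .
qed

text \<open>The weight recursion reproduces the product rule in \<open>dprop\<close>, and the common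
  normaliser drops out by homogeneity. Telescoping is therefore exact for the derivative as
  well.\<close>

lemma particle_deriv_flow:
  assumes \<phi>: "bounded_measurable M \<phi>"
  shows "law_deriv j (Suc k) \<phi> (next_law N k X) (next_weight N k X w) = particle_deriv N (Suc j) k \<phi> X w"
proof -
  let ?Z = "\<Sum>j=1..N. Fop k (\<lambda>_. 1) (X j)"
  note bm = fprop_bounded_measurable dprop_bounded_measurable bounded_measurable_const \<phi>
  have "law_deriv j (Suc k) \<phi> (next_law N k X) (next_weight N k X w) = quot_deriv
      (1 / ?Z * (\<Sum>i=1..N. fprop (Suc j) k \<phi> (X i))) (1 / ?Z * (\<Sum>i=1..N. H (Suc j) k (X i)))
      (1 / ?Z * (\<Sum>i=1..N. dprop (Suc j) k \<phi> (X i) + w i * fprop (Suc j) k \<phi> (X i)))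
      (1 / ?Z * (\<Sum>i=1..N. dprop (Suc j) k (\<lambda>_. 1) (X i) + w i * H (Suc j) k (X i)))"
    unfolding law_deriv_def H_def by (simp add: integral_next_law integral_next_weight bm)
  also have "\<dots> = particle_deriv N (Suc j) k \<phi> X w"
    unfolding particle_deriv_def using sum_Fop_pos by (intro quot_deriv_scale) simp
  finally show ?thesis .
qed

lemma sum_H_pos: "0 < (\<Sum>i=1..N. H j k (X i))"
  using N by (intro sum_pos H_positive X) auto

end

lemma particle_filter_abs_le:
  assumes N: "N \<ge> 1" and X: "\<And>i. i \<in> {1..N} \<Longrightarrow> X i \<in> space M"
    and B: "\<And>x. x \<in> space M \<Longrightarrow> \<bar>nprop j k \<phi> x\<bar> \<le> B"
  shows "\<bar>particle_filter N j k \<phi> X\<bar> \<le> B"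
proof -
  have "\<bar>fprop j k \<phi> (X i)\<bar> \<le> B * H j k (X i)" if "i \<in> {1..N}" for i
    using mult_right_mono[OF B[OF X[OF that]], of "H j k (X i)"] H_positive[OF X[OF that], of j k] H_nprop[OF X[OF that], of j k \<phi>]
    by (metis abs_mult abs_of_pos less_imp_le mult.commute)
  then have "\<bar>\<Sum>i=1..N. fprop j k \<phi> (X i)\<bar> \<le> (\<Sum>i=1..N. B * H j k (X i))"
    by (intro order_trans[OF sum_abs] sum_mono) auto
  moreover have "0 < (\<Sum>i=1..N. H j k (X i))" by (rule sum_H_pos[OF N X])
  ultimately show ?thesis by (simp add: particle_filter_def sum_distrib_left pos_divide_le_eq)
qed

text \<open>A qualitative bound, serving only integrability under the law of the particles; the size
  of \<open>C\<close> does not enter the final constants.\<close>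

lemma particle_deriv_bounded:
  assumes N: "N \<ge> 1" and \<phi>: "bounded_measurable M \<phi>"
  obtains C where "\<And>X w. (\<And>i. i \<in> {1..N} \<Longrightarrow> X i \<in> space M) \<Longrightarrow> (\<And>i. i \<in> {1..N} \<Longrightarrow> \<bar>w i\<bar> \<le> D)
    \<Longrightarrow> \<bar>particle_deriv N j k \<phi> X w\<bar> \<le> C"
proof -
  have ex: "\<exists>B V. (\<forall>x\<in>space M. \<bar>nprop j k \<psi> x\<bar> \<le> B) \<and> (\<forall>x\<in>space M. \<bar>ndprop j k \<psi> x\<bar> \<le> V)"
    if "bounded_measurable M \<psi>" for \<psi>
    using nprop_bound[OF that, of j k] by (auto simp: bounded_measurable_def)
  obtain B V where BV: "\<And>x. x \<in> space M \<Longrightarrow> \<bar>nprop j k \<phi> x\<bar> \<le> B" "\<And>x. x \<in> space M \<Longrightarrow> \<bar>ndprop j k \<phi> x\<bar> \<le> V"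
    using ex[OF \<phi>] by auto
  obtain B1 V1 where BV1: "\<And>x. x \<in> space M \<Longrightarrow> \<bar>nprop j k (\<lambda>_. 1) x\<bar> \<le> B1" "\<And>x. x \<in> space M \<Longrightarrow> \<bar>ndprop j k (\<lambda>_. 1) x\<bar> \<le> V1"
    using ex[OF bounded_measurable_const[of M 1]] by auto
  have quot: "\<bar>(\<Sum>i=1..N. dprop j k \<psi> (X i) + w i * fprop j k \<psi> (X i)) / (\<Sum>i=1..N. H j k (X i))\<bar> \<le> V' + D * B'"
    if X: "\<And>i. i \<in> {1..N} \<Longrightarrow> X i \<in> space M" and w: "\<And>i. i \<in> {1..N} \<Longrightarrow> \<bar>w i\<bar> \<le> D"
      and BV': "\<And>x. x \<in> space M \<Longrightarrow> \<bar>nprop j k \<psi> x\<bar> \<le> B'" "\<And>x. x \<in> space M \<Longrightarrow> \<bar>ndprop j k \<psi> x\<bar> \<le> V'" for X w \<psi> B' V'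
  proof -
    have "\<bar>dprop j k \<psi> (X i) + w i * fprop j k \<psi> (X i)\<bar> \<le> (V' + D * B') * H j k (X i)" if i: "i \<in> {1..N}" for i
    proof -
      have "\<bar>ndprop j k \<psi> (X i) + w i * nprop j k \<psi> (X i)\<bar> \<le> V' + D * B'"
        using BV'[OF X[OF i]] w[OF i]
        by (intro order_trans[OF abs_triangle_ineq] add_mono) (auto simp: abs_mult intro!: mult_mono)
      then have "\<bar>ndprop j k \<psi> (X i) + w i * nprop j k \<psi> (X i)\<bar> * H j k (X i) \<le> (V' + D * B') * H j k (X i)"
        using H_positive[OF X[OF i], of j k] by (intro mult_right_mono) auto
      moreover have "dprop j k \<psi> (X i) + w i * fprop j k \<psi> (X i) = (ndprop j k \<psi> (X i) + w i * nprop j k \<psi> (X i)) * H j k (X i)"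
        using H_nprop[OF X[OF i], of j k \<psi>] H_ndprop[OF X[OF i], of j k \<psi>] by (simp add: algebra_simps)
      ultimately show ?thesis using H_positive[OF X[OF i], of j k] by (simp add: abs_mult)
    qed
    then have "\<bar>\<Sum>i=1..N. dprop j k \<psi> (X i) + w i * fprop j k \<psi> (X i)\<bar> \<le> (\<Sum>i=1..N. (V' + D * B') * H j k (X i))"
      by (intro order_trans[OF sum_abs] sum_mono) auto
    moreover have "0 < (\<Sum>i=1..N. H j k (X i))" by (rule sum_H_pos[OF N X])
    ultimately show ?thesis by (simp add: sum_distrib_left[symmetric] pos_divide_le_eq)
  qed
  show ?thesis
  proof (rule that)
    fix X w assume X: "\<And>i. i \<in> {1..N} \<Longrightarrow> X i \<in> space M" and w: "\<And>i. i \<in> {1..N} \<Longrightarrow> \<bar>w i\<bar> \<le> D"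
    have "particle_deriv N j k \<phi> X w = (\<Sum>i=1..N. dprop j k \<phi> (X i) + w i * fprop j k \<phi> (X i)) / (\<Sum>i=1..N. H j k (X i))
       - particle_filter N j k \<phi> X * ((\<Sum>i=1..N. dprop j k (\<lambda>_. 1) (X i) + w i * fprop j k (\<lambda>_. 1) (X i)) / (\<Sum>i=1..N. H j k (X i)))"
      by (simp add: particle_deriv_def quot_deriv_def particle_filter_def H_def power2_eq_square)
    also have "\<bar>\<dots>\<bar> \<le> (V + D * B) + B * (V1 + D * B1)"
    proof (intro order_trans[OF abs_triangle_ineq4] add_mono quot X w BV)
      have 1: "\<bar>particle_filter N j k \<phi> X\<bar> \<le> B" by (rule particle_filter_abs_le[OF N X BV(1)])
      have 2: "\<bar>(\<Sum>i=1..N. dprop j k (\<lambda>_. 1) (X i) + w i * fprop j k (\<lambda>_. 1) (X i)) / (\<Sum>i=1..N. H j k (X i))\<bar> \<le> V1 + D * B1"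
        by (rule quot[OF X w BV1])
      show "\<bar>particle_filter N j k \<phi> X * ((\<Sum>i=1..N. dprop j k (\<lambda>_. 1) (X i) + w i * fprop j k (\<lambda>_. 1) (X i)) / (\<Sum>i=1..N. H j k (X i)))\<bar>
         \<le> B * (V1 + D * B1)"
        unfolding abs_mult by (rule mult_mono[OF 1 2 order_trans[OF abs_ge_zero 1] abs_ge_zero])
    qed
    finally show "\<bar>particle_deriv N j k \<phi> X w\<bar> \<le> (V + D * B) + B * (V1 + D * B1)" .
  qed
qed

end

section \<open>The particle system\<close>

lemma space_spX: "state_space_model m \<Longrightarrow> space (spX m) = setX m"
  using sets.sets_into_space by (fastforce simp: state_space_model_def spX_def space_restrict_space)

lemma space_spY: "state_space_model m \<Longrightarrow> space (spY m) = setY m"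
  using sets.sets_into_space by (fastforce simp: state_space_model_def spY_def space_restrict_space)

lemma space_spT: "state_space_model m \<Longrightarrow> space (spT m) = Theta m"
  by (auto simp: state_space_model_def spT_def space_restrict_space dest: openin_imp_subset)

lemma transd_section_measurable:
  assumes "state_space_model m" "\<theta> \<in> Theta m"
  shows "(\<lambda>z. transd m \<theta> (fst z) (snd z)) \<in> borel_measurable (spX m \<Otimes>\<^sub>M spX m)"
proof -
  have a: "(\<lambda>z. (\<theta>, fst z, snd z)) \<in> spX m \<Otimes>\<^sub>M spX m \<rightarrow>\<^sub>M spT m \<Otimes>\<^sub>M spX m \<Otimes>\<^sub>M spX m"
    using assms by (intro measurable_Pair measurable_const) (auto simp: space_spT)
  have b: "(\<lambda>(\<theta>, x', x). transd m \<theta> x' x) \<in> borel_measurable (spT m \<Otimes>\<^sub>M spX m \<Otimes>\<^sub>M spX m)"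
    using assms by (simp add: state_space_model_def)
  from measurable_compose[OF a b] show ?thesis by simp
qed

lemma obsd_section_measurable:
  assumes "state_space_model m" "\<theta> \<in> Theta m" "y \<in> setY m"
  shows "(\<lambda>x. obsd m \<theta> y x) \<in> borel_measurable (spX m)"
proof -
  have a: "(\<lambda>x. (\<theta>, y, x)) \<in> spX m \<rightarrow>\<^sub>M spT m \<Otimes>\<^sub>M spY m \<Otimes>\<^sub>M spX m"
    using assms by (intro measurable_Pair measurable_const measurable_ident) (auto simp: space_spT space_spY)
  have b: "(\<lambda>(\<theta>, y, x). obsd m \<theta> y x) \<in> borel_measurable (spT m \<Otimes>\<^sub>M spY m \<Otimes>\<^sub>M spX m)"
    using assms by (simp add: state_space_model_def)
  from measurable_compose[OF a b] show ?thesis by simp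
qed

lemma history_slice_measurable[measurable]:
  "k \<le> n \<Longrightarrow> (\<lambda>h. h k) \<in> history_space m N n \<rightarrow>\<^sub>M (\<Pi>\<^sub>M i\<in>{1..N}. spX m)"
  unfolding history_space_def by (rule measurable_component_singleton) auto

lemma history_component_measurable[measurable]:
  assumes "k \<le> n" "i \<in> {1..N}"
  shows "(\<lambda>h. h k i) \<in> history_space m N n \<rightarrow>\<^sub>M spX m"
proof -
  have "(\<lambda>X. X i) \<in> (\<Pi>\<^sub>M i\<in>{1..N}. spX m) \<rightarrow>\<^sub>M spX m"
    by (rule measurable_component_singleton) (rule assms)
  from measurable_compose[OF history_slice_measurable[OF assms(1)] this] show ?thesis .
qed

text \<open>\<open>r_step\<close> at index k + 1. Counting from the time of departure aligns the
  observation index with the recursion of the particle system.\<close>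

definition kern :: "ssm \<Rightarrow> vec \<Rightarrow> (nat \<Rightarrow> vec) \<Rightarrow> nat \<Rightarrow> vec \<Rightarrow> vec \<Rightarrow> real" where
  "kern m \<theta> y k x' x = transd m \<theta> x' x * obsd m \<theta> (y k) x"

locale ssm_run =
  fixes m :: ssm and \<epsilon> :: real and \<theta> :: vec and y :: "nat \<Rightarrow> vec"
  assumes model: "state_space_model m" and dens: "bounded_densities m \<epsilon>"
    and eps: "0 < \<epsilon>" "\<epsilon> < 1" and theta: "\<theta> \<in> Theta m" and obs: "\<And>k. y k \<in> setY m"
begin

lemma sets_refX[measurable_cong]: "sets (refX m) = sets (spX m)"
  using model by (simp add: state_space_model_def)

lemma space_refX: "space (refX m) = setX m"
  using sets_eq_imp_space_eq[OF sets_refX] space_spX[OF model] by simp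

lemma init_prob: "prob_space (init m \<theta>)" and sets_init[measurable_cong]: "sets (init m \<theta>) = sets (spX m)"
proof -
  have "init m \<in> spT m \<rightarrow>\<^sub>M prob_algebra (spX m)" using model by (simp add: state_space_model_def)
  from measurable_space[OF this, of \<theta>] theta show "prob_space (init m \<theta>)" "sets (init m \<theta>) = sets (spX m)"
    by (auto simp: space_spT[OF model] space_prob_algebra)
qed

lemma space_init: "space (init m \<theta>) = setX m"
  using sets_eq_imp_space_eq[OF sets_init] space_spX[OF model] by simp

lemma setX_nonempty: "setX m \<noteq> {}"
  using prob_space.not_empty[OF init_prob] by (simp add: space_init)

lemma transd_bounds: "x \<in> setX m \<Longrightarrow> x' \<in> setX m \<Longrightarrow> \<epsilon> \<le> transd m \<theta> x' x"
  "x \<in> setX m \<Longrightarrow> x' \<in> setX m \<Longrightarrow> transd m \<theta> x' x \<le> 1 / \<epsilon>"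
  using dens theta obs[of 0] by (auto simp: bounded_densities_def)

lemma obsd_bounds: "x \<in> setX m \<Longrightarrow> \<epsilon> \<le> obsd m \<theta> (y k) x"
  "x \<in> setX m \<Longrightarrow> obsd m \<theta> (y k) x \<le> 1 / \<epsilon>"
  using dens theta obs[of k] by (auto simp: bounded_densities_def)

lemma transd_integral: "x \<in> setX m \<Longrightarrow> (\<integral>\<^sup>+x'. ennreal (transd m \<theta> x' x) \<partial>refX m) = 1"
  using model theta by (auto simp: state_space_model_def)

text \<open>A density bounded below by \<epsilon> integrates to 1, so the reference measure has mass
  at most 1/\<epsilon>. The upper bound on the density shows in the same way that the mass is
  positive.\<close>

lemma finite_measure_refX: "finite_measure (refX m)"
proof
  obtain x where x: "x \<in> setX m" using setX_nonempty by auto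
  have "ennreal \<epsilon> * emeasure (refX m) (space (refX m)) = (\<integral>\<^sup>+x'. ennreal \<epsilon> \<partial>refX m)" by simp
  also have "\<dots> \<le> (\<integral>\<^sup>+x'. ennreal (transd m \<theta> x' x) \<partial>refX m)"
    using transd_bounds(1)[OF x] by (intro nn_integral_mono ennreal_leI) (auto simp: space_refX)
  also have "\<dots> = 1" by (rule transd_integral[OF x])
  finally show "emeasure (refX m) (space (refX m)) \<noteq> \<infinity>"
    using eps by (auto simp: ennreal_mult_top top_unique)
qed

lemma mass_refX: "0 < measure (refX m) (space (refX m))"
proof -
  interpret finite_measure "refX m" by (rule finite_measure_refX)
  obtain x where x: "x \<in> setX m" using setX_nonempty by auto
  have "1 = (\<integral>\<^sup>+x'. ennreal (transd m \<theta> x' x) \<partial>refX m)" using transd_integral[OF x] by simp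
  also have "\<dots> \<le> (\<integral>\<^sup>+x'. ennreal (1 / \<epsilon>) \<partial>refX m)"
    using transd_bounds(2)[OF x] by (intro nn_integral_mono ennreal_leI) (auto simp: space_refX)
  finally have "emeasure (refX m) (space (refX m)) \<noteq> 0" by auto
  then show ?thesis by (simp add: emeasure_eq_measure zero_less_measure_iff)
qed

lemma transd_measurable: "(\<lambda>z. transd m \<theta> (fst z) (snd z)) \<in> borel_measurable (refX m \<Otimes>\<^sub>M refX m)"
  using transd_section_measurable[OF model theta]
  by (simp cong: measurable_cong_sets add: sets_pair_measure_cong[OF sets_refX sets_refX])

lemma obsd_measurable[measurable]: "obsd m \<theta> (y k) \<in> borel_measurable (refX m)"
  using obsd_section_measurable[OF model theta obs, of k] by (simp cong: measurable_cong_sets add: sets_refX)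

lemma kern_measurable: "(\<lambda>z. kern m \<theta> y k (fst z) (snd z)) \<in> borel_measurable (refX m \<Otimes>\<^sub>M refX m)"
  unfolding kern_def using transd_measurable by measurable

lemma kern_bounds:
  assumes "x \<in> setX m" "x' \<in> setX m"
  shows "\<epsilon>\<^sup>2 \<le> kern m \<theta> y k x' x" "kern m \<theta> y k x' x \<le> 1 / \<epsilon>\<^sup>2"
proof -
  show "\<epsilon>\<^sup>2 \<le> kern m \<theta> y k x' x"
    unfolding kern_def power2_eq_square using eps transd_bounds[OF assms] obsd_bounds[OF assms(1), of k]
    by (intro mult_mono) auto
  have "kern m \<theta> y k x' x \<le> 1 / \<epsilon> * (1 / \<epsilon>)"
    unfolding kern_def using eps transd_bounds[OF assms] obsd_bounds[OF assms(1), of k]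
    by (intro mult_mono) auto
  then show "kern m \<theta> y k x' x \<le> 1 / \<epsilon>\<^sup>2" by (simp add: power2_eq_square)
qed

end

text \<open>\<open>g\<close> and \<open>w\<close> remain abstract so that one development serves
  both parts: they become a coordinate of the gradient and of the initial weight for the derivative,
  and zero for the filter.\<close>

locale ssm_filter = ssm_run +
  fixes N :: nat and g :: "nat \<Rightarrow> vec \<Rightarrow> vec \<Rightarrow> real" and \<Gamma> :: real and w :: "vec \<Rightarrow> real" and B :: real
  assumes N: "N \<ge> 1" and G: "0 \<le> \<Gamma>"
    and g_meas: "\<And>k. (\<lambda>z. g k (fst z) (snd z)) \<in> borel_measurable (refX m \<Otimes>\<^sub>M refX m)"
    and g_le: "\<And>k x x'. x \<in> setX m \<Longrightarrow> x' \<in> setX m \<Longrightarrow> \<bar>g k x' x\<bar> \<le> \<Gamma> * kern m \<theta> y k x' x"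
    and w_meas: "w \<in> borel_measurable (refX m)" and w_le: "\<And>x. x \<in> setX m \<Longrightarrow> \<bar>w x\<bar> \<le> B"
begin

text \<open>The kernel is a product of two factors in [\<epsilon>, 1/\<epsilon>], hence \<delta> =
  \<epsilon>^2 and the rate \<rho> is 1 - \<epsilon>^4.\<close>

sublocale mixing_kernels "refX m" "kern m \<theta> y" g "\<epsilon>\<^sup>2" \<Gamma>
proof -
  interpret finite_measure "refX m" by (rule finite_measure_refX)
  show "mixing_kernels (refX m) (kern m \<theta> y) g (\<epsilon>\<^sup>2) \<Gamma>"
    using kern_measurable g_meas eps G kern_bounds g_le mass_refX
    by unfold_locales (auto simp: space_refX power_less_one_iff abs_square_less_1)
qed

lemma B_nonneg: "0 \<le> B"
  using setX_nonempty w_le order_trans[OF abs_ge_zero] by (metis all_not_in_conv)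

section \<open>The law of the particle histories\<close>

abbreviation "L \<equiv> particle_law m N \<theta> y"
abbreviation "\<H> \<equiv> history_space m N"

text \<open>The transition density integrates to 1, which leaves the observation density. This
  identifies the normaliser of \<open>particle_kernel\<close> with that of
  \<open>next_law\<close>.\<close>

lemma Fop_one:
  assumes x: "x \<in> setX m"
  shows "Fop k (\<lambda>_. 1) x = obsd m \<theta> (y k) x"
proof -
  have "(\<lambda>x'. (x', x)) \<in> refX m \<rightarrow>\<^sub>M refX m \<Otimes>\<^sub>M refX m"
    using x by (intro measurable_Pair measurable_ident measurable_const) (auto simp: space_refX)
  from measurable_compose[OF this transd_measurable]
  have [measurable]: "(\<lambda>x'. transd m \<theta> x' x) \<in> borel_measurable (refX m)" by simp
  have "(LINT x'|refX m. transd m \<theta> x' x) = enn2real (\<integral>\<^sup>+x'. ennreal (transd m \<theta> x' x) \<partial>refX m)"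
  proof (intro integral_eq_nn_integral AE_I2)
    fix x' assume "x' \<in> space (refX m)"
    with transd_bounds(1)[OF x, of x'] eps show "0 \<le> transd m \<theta> x' x" by (simp add: space_refX)
  qed simp
  then show ?thesis by (simp add: Fop_def kern_def transd_integral[OF x])
qed

lemma history_in: "h \<in> space (\<H> n) \<Longrightarrow> k \<le> n \<Longrightarrow> i \<in> {1..N} \<Longrightarrow> h k i \<in> setX m"
  using measurable_space[OF history_component_measurable] space_spX[OF model] by blast

lemma particle_kernel_eq:
  assumes "\<And>i. i \<in> {1..N} \<Longrightarrow> X i \<in> setX m"
  shows "particle_kernel m N \<theta> (y k) X = next_law N k X"
proof -
  have "(\<Sum>j=1..N. Fop k (\<lambda>_. 1) (X j)) = (\<Sum>j=1..N. obsd m \<theta> (y k) (X j))"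
    using assms by (intro sum.cong) (auto simp: Fop_one)
  then show ?thesis by (simp add: particle_kernel_def next_law_def kern_def)
qed

lemma slice_in:
  "h \<in> space (\<H> n) \<Longrightarrow> i \<in> {1..N} \<Longrightarrow> h n i \<in> space (refX m)"
  using history_in by (simp add: space_refX)

lemma component_measurable[measurable]:
  "k \<le> n \<Longrightarrow> i \<in> {1..N} \<Longrightarrow> (\<lambda>h. h k i) \<in> \<H> n \<rightarrow>\<^sub>M refX m"
  using history_component_measurable[of k n i N m] by (simp cong: measurable_cong_sets add: sets_refX)

lemma sets_next_law_spX: "sets (next_law N k X) = sets (spX m)"
  by (simp add: next_law_def sets_refX)

text \<open>Joint measurability of the density in history and state survives integrating out the
  state. The law of histories can then be composed by \<open>bind\<close> and integrated
  iteratively.\<close>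

lemma next_law_kernel: "(\<lambda>h. next_law N n (h n)) \<in> \<H> n \<rightarrow>\<^sub>M prob_algebra (spX m)"
proof (rule measurable_prob_algebraI)
  show prob: "prob_space (next_law N n (h n))" if "h \<in> space (\<H> n)" for h
    using that by (intro prob_space_next_law N slice_in)
  have F[measurable]: "Fop n (\<lambda>_. 1) \<in> borel_measurable (refX m)"
    by (intro bounded_measurable_borel Fop_bounded_measurable bounded_measurable_const)
  let ?d = "\<lambda>h x. ennreal ((\<Sum>j=1..N. kern m \<theta> y n x (h n j)) / (\<Sum>j=1..N. Fop n (\<lambda>_. 1) (h n j)))"
  have d: "(\<lambda>p. ?d (fst p) (snd p)) \<in> borel_measurable (\<H> n \<Otimes>\<^sub>M refX m)"
  proof -
    have c: "(\<lambda>p. fst p n j) \<in> \<H> n \<Otimes>\<^sub>M refX m \<rightarrow>\<^sub>M refX m" if "j \<in> {1..N}" for j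
      by (rule measurable_compose[OF measurable_fst component_measurable]) (use that in auto)
    show ?thesis
      by (intro measurable_compose[OF _ measurable_ennreal] borel_measurable_divide borel_measurable_sum
          f_comp_measurable measurable_snd c measurable_compose[OF c F])
  qed
  show "(\<lambda>h. next_law N n (h n)) \<in> \<H> n \<rightarrow>\<^sub>M subprob_algebra (spX m)"
  proof (rule measurable_subprob_algebra)
    show "subprob_space (next_law N n (h n))" if "h \<in> space (\<H> n)" for h
      by (rule prob_space_imp_subprob_space[OF prob[OF that]])
    show "sets (next_law N n (h n)) = sets (spX m)" for h
      by (simp add: next_law_def sets_refX)
    fix A assume "A \<in> sets (spX m)"
    then have A: "A \<in> sets (refX m)" by (simp add: sets_refX)
    have "emeasure (next_law N n (h n)) A = (\<integral>\<^sup>+x. ?d h x * indicator A x \<partial>refX m)" if "h \<in> space (\<H> n)" for h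
    proof -
      have "(\<lambda>x. ?d h x) \<in> borel_measurable (refX m)"
        using measurable_compose[OF measurable_Pair[OF measurable_const[OF that] measurable_ident] d] by simp
      then show ?thesis unfolding next_law_def by (rule emeasure_density) (rule A)
    qed
    moreover have "(\<lambda>h. \<integral>\<^sup>+x. ?d h x * indicator A x \<partial>refX m) \<in> borel_measurable (\<H> n)"
    proof (rule borel_measurable_nn_integral)
      have "(\<lambda>p. indicator A (snd p) :: ennreal) \<in> borel_measurable (\<H> n \<Otimes>\<^sub>M refX m)"
        using A by (intro measurable_compose[OF measurable_snd borel_measurable_indicator])
      from borel_measurable_times_ennreal[OF d this]
      show "(\<lambda>(h, x). ?d h x * indicator A x) \<in> borel_measurable (\<H> n \<Otimes>\<^sub>M refX m)"
        by (simp add: split_beta)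
    qed
    ultimately show "(\<lambda>h. emeasure (next_law N n (h n)) A) \<in> borel_measurable (\<H> n)"
      by (simp cong: measurable_cong)
  qed
qed

definition step_kernel :: "nat \<Rightarrow> (nat \<Rightarrow> nat \<Rightarrow> vec) \<Rightarrow> (nat \<Rightarrow> nat \<Rightarrow> vec) measure" where
  "step_kernel n h = distr (\<Pi>\<^sub>M i\<in>{1..N}. next_law N n (h n)) (\<H> (Suc n)) (\<lambda>X. h(Suc n := X))"

lemma history_extend:
  "(\<lambda>(h, X). h(Suc n := X)) \<in> \<H> n \<Otimes>\<^sub>M (\<Pi>\<^sub>M i\<in>{1..N}. spX m) \<rightarrow>\<^sub>M \<H> (Suc n)"
  unfolding history_space_def split_beta
  by (rule measurable_fun_upd[where J="{..n}"]) (auto simp: atMost_Suc)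

lemma step_kernel_measurable: "step_kernel n \<in> \<H> n \<rightarrow>\<^sub>M prob_algebra (\<H> (Suc n))"
  unfolding step_kernel_def[abs_def]
  by (rule measurable_distr_prob_space2[OF measurable_PiM_prob_algebra[OF _ next_law_kernel] history_extend]) simp

lemma history_start: "(\<lambda>X. \<lambda>k\<in>{..0}. X) \<in> (\<Pi>\<^sub>M i\<in>{1..N}. spX m) \<rightarrow>\<^sub>M \<H> 0"
  unfolding history_space_def by (rule measurable_restrict) auto

lemma history_start_init: "(\<lambda>X. \<lambda>k\<in>{..0}. X) \<in> (\<Pi>\<^sub>M i\<in>{1..N}. init m \<theta>) \<rightarrow>\<^sub>M \<H> 0"
proof -
  have s: "sets (\<Pi>\<^sub>M i\<in>{1..N}. init m \<theta>) = sets (\<Pi>\<^sub>M i\<in>{1..N}. spX m)"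
    by (rule sets_PiM_cong) (auto simp: sets_init)
  show ?thesis unfolding measurable_cong_sets[OF s refl] by (rule history_start)
qed

text \<open>\<open>particle_kernel\<close> and \<open>next_law\<close> are identified only for
  particles in the state space, so the rewriting under \<open>bind\<close> takes place on the space
  of \<open>L n\<close>. The premise on the sets breaks the circle with \<open>law_prob\<close>,
  whose induction supplies it.\<close>

lemma law_Suc:
  assumes "sets (L n) = sets (\<H> n)"
  shows "L (Suc n) = L n \<bind> step_kernel n"
  unfolding particle_law.simps(2)
proof (rule bind_cong_All, rule ballI)
  fix h assume "h \<in> space (L n)"
  then have "particle_kernel m N \<theta> (y n) (h n) = next_law N n (h n)"
    using sets_eq_imp_space_eq[OF assms] by (intro particle_kernel_eq history_in) auto
  then show "distr (\<Pi>\<^sub>M i\<in>{1..N}. particle_kernel m N \<theta> (y n) (h n)) (\<H> (Suc n)) (\<lambda>X. h(Suc n := X)) = step_kernel n h"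
    by (simp add: step_kernel_def)
qed

lemma law_prob: "L n \<in> space (prob_algebra (\<H> n))"
proof (induction n)
  case 0
  have "prob_space (\<Pi>\<^sub>M i\<in>{1..N}. init m \<theta>)" by (rule prob_space_PiM) (rule init_prob)
  then have "prob_space (L 0)"
    unfolding particle_law.simps(1) by (rule prob_space.prob_space_distr) (rule history_start_init)
  then show ?case by (simp add: space_prob_algebra)
next
  case (Suc n)
  then have "L (Suc n) = L n \<bind> step_kernel n"
    by (intro law_Suc) (simp add: space_prob_algebra)
  then show ?case
    using prob_space_bind'[OF Suc step_kernel_measurable] sets_bind'[OF Suc step_kernel_measurable]
    by (simp add: space_prob_algebra)
qed

lemma prob_law: "prob_space (L n)" and sets_law: "sets (L n) = sets (\<H> n)"
  using law_prob[of n] by (auto simp: space_prob_algebra)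

lemma space_law: "space (L n) = space (\<H> n)"
  using sets_law by (rule sets_eq_imp_space_eq)

lemma integral_law_0:
  fixes \<Phi> :: "(nat \<Rightarrow> nat \<Rightarrow> vec) \<Rightarrow> real"
  assumes "\<Phi> \<in> borel_measurable (\<H> 0)"
  shows "(LINT h|L 0. \<Phi> h) = (LINT X|(\<Pi>\<^sub>M i\<in>{1..N}. init m \<theta>). \<Phi> (\<lambda>k\<in>{..0}. X))"
  unfolding particle_law.simps(1) by (rule integral_distr[OF history_start_init assms])

text \<open>The tower property: conditionally on the history up to time n, the new generation is a
  product of copies of \<open>next_law\<close>.\<close>

lemma integral_law_Suc:
  fixes \<Phi> :: "(nat \<Rightarrow> nat \<Rightarrow> vec) \<Rightarrow> real"
  assumes \<Phi>: "\<Phi> \<in> borel_measurable (\<H> (Suc n))" "\<And>h. h \<in> space (\<H> (Suc n)) \<Longrightarrow> \<bar>\<Phi> h\<bar> \<le> C"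
  shows "(LINT h|L (Suc n). \<Phi> h) = (LINT h|L n. LINT X|(\<Pi>\<^sub>M i\<in>{1..N}. next_law N n (h n)). \<Phi> (h(Suc n := X)))"
    and "integrable (L n) (\<lambda>h. LINT X|(\<Pi>\<^sub>M i\<in>{1..N}. next_law N n (h n)). \<Phi> (h(Suc n := X)))"
proof -
  interpret prob_space "L n" by (rule prob_law)
  have k: "step_kernel n \<in> L n \<rightarrow>\<^sub>M subprob_algebra (\<H> (Suc n))"
    using measurable_prob_algebraD[OF step_kernel_measurable] by (simp cong: measurable_cong_sets add: sets_law)
  have kp: "prob_space (step_kernel n h)" "sets (step_kernel n h) = sets (\<H> (Suc n))" if "h \<in> space (\<H> n)" for h
    using measurable_space[OF step_kernel_measurable that] by (auto simp: space_prob_algebra)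
  have eq: "(LINT h'|step_kernel n h. \<Phi> h') = (LINT X|(\<Pi>\<^sub>M i\<in>{1..N}. next_law N n (h n)). \<Phi> (h(Suc n := X)))"
    if h: "h \<in> space (L n)" for h
  proof -
    have "(\<lambda>X. h(Suc n := X)) \<in> (\<Pi>\<^sub>M i\<in>{1..N}. spX m) \<rightarrow>\<^sub>M \<H> (Suc n)"
      using measurable_compose[OF measurable_Pair[OF measurable_const measurable_ident] history_extend, of h n] h
      by (simp add: space_law)
    moreover have "sets (\<Pi>\<^sub>M i\<in>{1..N}. next_law N n (h n)) = sets (\<Pi>\<^sub>M i\<in>{1..N}. spX m)"
      by (rule sets_PiM_cong) (auto simp: sets_next_law_spX)
    ultimately have "(\<lambda>X. h(Suc n := X)) \<in> (\<Pi>\<^sub>M i\<in>{1..N}. next_law N n (h n)) \<rightarrow>\<^sub>M \<H> (Suc n)"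
      by (simp cong: measurable_cong_sets)
    then show ?thesis unfolding step_kernel_def by (intro integral_distr \<Phi>)
  qed
  show "(LINT h|L (Suc n). \<Phi> h) = (LINT h|L n. LINT X|(\<Pi>\<^sub>M i\<in>{1..N}. next_law N n (h n)). \<Phi> (h(Suc n := X)))"
  proof -
    have "(LINT h|L (Suc n). \<Phi> h) = (LINT h|L n. LINT h'|step_kernel n h. \<Phi> h')"
      unfolding law_Suc[OF sets_law]
      by (rule integral_bind[OF \<Phi> k finite_measure_axioms, of 1])
        (auto simp: space_law dest!: kp(1) intro!: AE_I2 prob_space.emeasure_le_1)
    also have "\<dots> = (LINT h|L n. LINT X|(\<Pi>\<^sub>M i\<in>{1..N}. next_law N n (h n)). \<Phi> (h(Suc n := X)))"
      by (intro Bochner_Integration.integral_cong refl eq)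
    finally show ?thesis .
  qed
  have "integrable (L n) (\<lambda>h. LINT h'|step_kernel n h. \<Phi> h')"
  proof (rule integrable_bounded)
    show "(\<lambda>h. LINT h'|step_kernel n h. \<Phi> h') \<in> borel_measurable (L n)"
      by (rule measurable_compose[OF k integral_measurable_subprob_algebra[OF \<Phi>(1)]])
    fix h assume h: "h \<in> space (L n)"
    interpret k: prob_space "step_kernel n h" using kp(1) h by (simp add: space_law)
    have sp: "space (step_kernel n h) = space (\<H> (Suc n))" using kp(2) h by (intro sets_eq_imp_space_eq) (simp add: space_law)
    have [measurable]: "\<Phi> \<in> borel_measurable (step_kernel n h)"
      using \<Phi>(1) kp(2) h by (simp cong: measurable_cong_sets add: space_law)
    have "\<bar>LINT h'|step_kernel n h. \<Phi> h'\<bar> \<le> (LINT h'|step_kernel n h. C)"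
      by (rule abs_integral_le) (auto intro!: k.integrable_bounded[of _ C] \<Phi>(2) simp: sp)
    then show "\<bar>LINT h'|step_kernel n h. \<Phi> h'\<bar> \<le> C" by (simp add: k.prob_space)
  qed
  then show "integrable (L n) (\<lambda>h. LINT X|(\<Pi>\<^sub>M i\<in>{1..N}. next_law N n (h n)). \<Phi> (h(Suc n := X)))"
    using eq by (simp cong: Bochner_Integration.integrable_cong)
qed


section \<open>Weights along a history\<close>

primrec wt :: "(nat \<Rightarrow> nat \<Rightarrow> vec) \<Rightarrow> nat \<Rightarrow> nat \<Rightarrow> real" where
  "wt h 0 = (\<lambda>i. w (h 0 i))"
| "wt h (Suc k) = (\<lambda>i. next_weight N k (h k) (wt h k) (h (Suc k) i))"

lemma wt_upd: "k \<le> n \<Longrightarrow> wt (h(Suc n := X)) k = wt h k"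
  by (induction k) auto

lemma wt_measurable: "k \<le> n \<Longrightarrow> i \<in> {1..N} \<Longrightarrow> (\<lambda>h. wt h k i) \<in> borel_measurable (\<H> n)"
proof (induction k arbitrary: i)
  case 0
  then show ?case using measurable_compose[OF component_measurable w_meas] by simp
next
  case (Suc k)
  then show ?case
    unfolding wt.simps next_weight_def
    by (intro borel_measurable_divide borel_measurable_sum borel_measurable_add borel_measurable_times
        f_comp_measurable g_comp_measurable component_measurable Suc.IH) auto
qed

text \<open>The linear growth in k does no harm, since the bound serves only integrability; the
  quantitative statement concerns the oscillation of the weights.\<close>

lemma wt_abs_le:
  "h \<in> space (\<H> n) \<Longrightarrow> k \<le> n \<Longrightarrow> i \<in> {1..N} \<Longrightarrow> \<bar>wt h k i\<bar> \<le> B + \<Gamma> * real k"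
proof (induction k arbitrary: i)
  case 0
  then show ?case using history_in[of h n 0 i] w_le by simp
next
  case (Suc k)
  have "\<bar>wt h (Suc k) i\<bar> \<le> \<Gamma> + (B + \<Gamma> * real k)"
    unfolding wt.simps using Suc.prems
    by (intro next_weight_abs_le N Suc.IH) (auto simp: space_refX intro: history_in)
  then show ?case by (simp add: algebra_simps)
qed

lemma w_near_zero:
  assumes "x \<in> setX m"
  shows "\<bar>w x - 0\<bar> \<le> \<Gamma> / (\<epsilon>\<^sup>2)\<^sup>2 + \<rho> ^ 0 * B"
proof -
  have "0 \<le> \<Gamma> / (\<epsilon>\<^sup>2)\<^sup>2" using G by simp
  with w_le[OF assms] have "\<bar>w x\<bar> \<le> \<Gamma> / (\<epsilon>\<^sup>2)\<^sup>2 + B" by linarith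
  then show ?thesis by simp
qed

text \<open>The radius solves D_(k+1) = \<Gamma> + \<rho> D_k with D_0 = \<Gamma>/\<delta>^2 + B:
  the accumulated gradients stay at the fixed point and the initial weights decay. The conclusion
  covers all positions x, because a bias estimate needs the weight function on the whole state
  space.\<close>

lemma next_weight_near_const_history:
  assumes h: "h \<in> space (\<H> n)" and k: "k \<le> n"
  shows "\<exists>c. \<forall>x\<in>setX m. \<bar>next_weight N k (h k) (wt h k) x - c\<bar> \<le> \<Gamma> / (\<epsilon>\<^sup>2)\<^sup>2 + \<rho> ^ Suc k * B"
proof -
  have R: "\<Gamma> + \<rho> * (\<Gamma> / (\<epsilon>\<^sup>2)\<^sup>2 + \<rho> ^ k * B) = \<Gamma> / (\<epsilon>\<^sup>2)\<^sup>2 + \<rho> ^ Suc k * B" for k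
    using eps by (simp add: \<rho>_def field_simps)
  have step: "\<exists>c. \<forall>x\<in>setX m. \<bar>next_weight N k (h k) (wt h k) x - c\<bar> \<le> \<Gamma> / (\<epsilon>\<^sup>2)\<^sup>2 + \<rho> ^ Suc k * B"
    if k: "k \<le> n" and c: "\<And>i. i \<in> {1..N} \<Longrightarrow> \<bar>wt h k i - c\<bar> \<le> \<Gamma> / (\<epsilon>\<^sup>2)\<^sup>2 + \<rho> ^ k * B" for k c
  proof -
    have "\<And>i. i \<in> {1..N} \<Longrightarrow> h k i \<in> space (refX m)" using h k by (auto simp: space_refX intro: history_in)
    then have "\<exists>c'. \<forall>x\<in>space (refX m). \<bar>next_weight N k (h k) (wt h k) x - c'\<bar>
        \<le> \<Gamma> + \<rho> * (\<Gamma> / (\<epsilon>\<^sup>2)\<^sup>2 + \<rho> ^ k * B)"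
      by (rule next_weight_near_const[OF N _ c])
    then show ?thesis by (simp only: R space_refX)
  qed
  have wt: "\<exists>c. \<forall>i\<in>{1..N}. \<bar>wt h k i - c\<bar> \<le> \<Gamma> / (\<epsilon>\<^sup>2)\<^sup>2 + \<rho> ^ k * B"
    using k
  proof (induction k)
    case 0
    have "\<bar>wt h 0 i - 0\<bar> \<le> \<Gamma> / (\<epsilon>\<^sup>2)\<^sup>2 + \<rho> ^ 0 * B" if "i \<in> {1..N}" for i
      using w_near_zero[OF history_in[OF h _ that, of 0]] by simp
    then show ?case by blast
  next
    case (Suc k)
    then have k: "k \<le> n" by simp
    from Suc.IH[OF this] obtain c where c: "\<And>i. i \<in> {1..N} \<Longrightarrow> \<bar>wt h k i - c\<bar> \<le> \<Gamma> / (\<epsilon>\<^sup>2)\<^sup>2 + \<rho> ^ k * B" by blast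
    from step[OF k this] history_in[OF h Suc.prems] show ?case unfolding wt.simps by blast
  qed
  with step[OF k] show ?thesis by blast
qed

section \<open>The telescoping sum\<close>

context
  fixes \<phi> :: "vec \<Rightarrow> real"
  assumes \<phi>: "bounded_measurable (refX m) \<phi>" and \<phi>_le: "\<And>x. x \<in> setX m \<Longrightarrow> \<bar>\<phi> x\<bar> \<le> 1"
begin

lemma phi_le: "x \<in> space (refX m) \<Longrightarrow> \<bar>\<phi> x\<bar> \<le> 1"
  by (simp add: space_refX \<phi>_le)

lemma operators_measurable:
  "fprop j k \<phi> \<in> borel_measurable (refX m)" "dprop j k \<phi> \<in> borel_measurable (refX m)"
  "dprop j k (\<lambda>_. 1) \<in> borel_measurable (refX m)" "H j k \<in> borel_measurable (refX m)"
  by (intro bounded_measurable_borel fprop_bounded_measurable dprop_bounded_measurable \<phi>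
      bounded_measurable_const H_bounded_measurable)+

lemma particle_filter_measurable:
  assumes "k \<le> n"
  shows "(\<lambda>h. particle_filter N j k \<phi> (h k)) \<in> borel_measurable (\<H> n)"
  unfolding particle_filter_def using assms
  by (intro borel_measurable_divide borel_measurable_sum
      measurable_compose[OF component_measurable operators_measurable(1)]
      measurable_compose[OF component_measurable operators_measurable(4)])

lemma particle_deriv_measurable:
  assumes "k \<le> n"
  shows "(\<lambda>h. particle_deriv N j k \<phi> (h k) (wt h k)) \<in> borel_measurable (\<H> n)"
  unfolding particle_deriv_def quot_deriv_def using assms
  by (intro borel_measurable_divide borel_measurable_sum borel_measurable_diff borel_measurable_times
      borel_measurable_add borel_measurable_power wt_measurable
      measurable_compose[OF component_measurable operators_measurable(1)]
      measurable_compose[OF component_measurable operators_measurable(2)]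
      measurable_compose[OF component_measurable operators_measurable(3)]
      measurable_compose[OF component_measurable operators_measurable(4)])

lemma particle_filter_bounded:
  obtains C where "\<And>h n. h \<in> space (\<H> n) \<Longrightarrow> k \<le> n \<Longrightarrow> \<bar>particle_filter N j k \<phi> (h k)\<bar> \<le> C"
proof -
  obtain C where C: "\<And>x. x \<in> space (refX m) \<Longrightarrow> \<bar>nprop j k \<phi> x\<bar> \<le> C"
    using nprop_bound(1)[OF \<phi>, of j k] by (auto simp: bounded_measurable_def)
  have "\<bar>particle_filter N j k \<phi> (h k)\<bar> \<le> C" if "h \<in> space (\<H> n)" "k \<le> n" for h n
    using that by (intro particle_filter_abs_le N C) (auto simp: space_refX intro: history_in)
  then show ?thesis by (rule that)
qed

lemma particle_deriv_history_bounded: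
  obtains C where "\<And>h n. h \<in> space (\<H> n) \<Longrightarrow> k \<le> n \<Longrightarrow> \<bar>particle_deriv N j k \<phi> (h k) (wt h k)\<bar> \<le> C"
proof -
  show ?thesis
  proof (rule particle_deriv_bounded[OF N \<phi>, where D="B + \<Gamma> * real k" and j=j and k=k])
    fix C assume C: "\<And>X v. (\<And>i. i \<in> {1..N} \<Longrightarrow> X i \<in> space (refX m)) \<Longrightarrow>
      (\<And>i. i \<in> {1..N} \<Longrightarrow> \<bar>v i\<bar> \<le> B + \<Gamma> * real k) \<Longrightarrow> \<bar>particle_deriv N j k \<phi> X v\<bar> \<le> C"
    have "\<bar>particle_deriv N j k \<phi> (h k) (wt h k)\<bar> \<le> C" if "h \<in> space (\<H> n)" "k \<le> n" for h n
      using that by (intro C wt_abs_le) (auto simp: space_refX intro: history_in)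
    then show ?thesis by (rule that)
  qed
qed

lemma integrable_law:
  assumes "a \<in> borel_measurable (\<H> n)" "\<And>h. h \<in> space (\<H> n) \<Longrightarrow> \<bar>a h\<bar> \<le> (C::real)"
  shows "integrable (L n) a"
proof -
  interpret prob_space "L n" by (rule prob_law)
  show ?thesis using assms by (intro integrable_bounded[of _ C]) (auto simp: space_law sets_law cong: measurable_cong_sets)
qed

text \<open>One term of the telescope. A bound uniform over the histories passes from the
  conditional bias to its expectation.\<close>

lemma integral_law_step_diff:
  fixes a b :: "(nat \<Rightarrow> nat \<Rightarrow> vec) \<Rightarrow> real"
  assumes a: "a \<in> borel_measurable (\<H> (Suc k))" "\<And>h. h \<in> space (\<H> (Suc k)) \<Longrightarrow> \<bar>a h\<bar> \<le> C"
    and b: "b \<in> borel_measurable (\<H> k)" "\<And>h. h \<in> space (\<H> k) \<Longrightarrow> \<bar>b h\<bar> \<le> C'"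
    and E: "\<And>h. h \<in> space (\<H> k) \<Longrightarrow>
      \<bar>(LINT X|(\<Pi>\<^sub>M i\<in>{1..N}. next_law N k (h k)). a (h(Suc k := X))) - b h\<bar> \<le> E"
  shows "\<bar>(LINT h|L (Suc k). a h) - (LINT h|L k. b h)\<bar> \<le> E"
proof -
  interpret prob_space "L k" by (rule prob_law)
  have i: "integrable (L k) (\<lambda>h. (LINT X|(\<Pi>\<^sub>M i\<in>{1..N}. next_law N k (h k)). a (h(Suc k := X))) - b h)"
    by (intro Bochner_Integration.integrable_diff integral_law_Suc(2)[OF a] integrable_law[OF b])
  have "(LINT h|L (Suc k). a h) - (LINT h|L k. b h) =
      (LINT h|L k. (LINT X|(\<Pi>\<^sub>M i\<in>{1..N}. next_law N k (h k)). a (h(Suc k := X))) - b h)"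
    by (subst integral_law_Suc(1)[OF a], assumption, rule Bochner_Integration.integral_diff[symmetric])
      (intro integral_law_Suc(2)[OF a] integrable_law[OF b]; assumption)+
  also have "\<bar>\<dots>\<bar> \<le> (LINT h|L k. E)"
    by (rule abs_integral_le[OF i]) (auto simp: space_law E)
  finally show ?thesis by (simp add: prob_space)
qed

text \<open>Exchanging sampling at time k for one exact step lowers k and raises j while j + k stays
  fixed, so the exact value on the left never changes. The term for i is the cost of the sampling at
  time i, and i = 0 is the initial draw.\<close>

lemma particle_filter_total_bias:
  "\<bar>(LINT h|L k. particle_filter N j k \<phi> (h k)) -
     (LINT x|init m \<theta>. fprop (j + k) 0 \<phi> x) / (LINT x|init m \<theta>. H (j + k) 0 x)\<bar>
   \<le> (\<Sum>i\<le>k. 2 * (1 / (\<epsilon>\<^sup>2)\<^sup>2) ^ 3 * \<rho> ^ (j + k - i) / N)"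
proof (induction k arbitrary: j)
  case 0
  have "(LINT h|L 0. particle_filter N j 0 \<phi> (h 0)) = (LINT X|(\<Pi>\<^sub>M i\<in>{1..N}. init m \<theta>). particle_filter N j 0 \<phi> X)"
    by (subst integral_law_0) (auto intro: particle_filter_measurable)
  then show ?case
    using particle_filter_bias[OF init_prob _ N \<phi> phi_le, of j 0] by (simp add: sets_init sets_refX)
next
  case (Suc k)
  obtain C where C: "\<And>h n. h \<in> space (\<H> n) \<Longrightarrow> Suc k \<le> n \<Longrightarrow> \<bar>particle_filter N j (Suc k) \<phi> (h (Suc k))\<bar> \<le> C"
    using particle_filter_bounded[of "Suc k" j] by blast
  obtain C' where C': "\<And>h n. h \<in> space (\<H> n) \<Longrightarrow> k \<le> n \<Longrightarrow> \<bar>particle_filter N (Suc j) k \<phi> (h k)\<bar> \<le> C'"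
    using particle_filter_bounded[of k "Suc j"] by blast
  have "\<bar>(LINT h|L (Suc k). particle_filter N j (Suc k) \<phi> (h (Suc k))) - (LINT h|L k. particle_filter N (Suc j) k \<phi> (h k))\<bar>
     \<le> 2 * (1 / (\<epsilon>\<^sup>2)\<^sup>2) ^ 3 * \<rho> ^ j / N"
  proof (rule integral_law_step_diff[where a="\<lambda>h. particle_filter N j (Suc k) \<phi> (h (Suc k))"
        and b="\<lambda>h. particle_filter N (Suc j) k \<phi> (h k)" and C=C and C'=C'])
    fix h assume h: "h \<in> space (\<H> k)"
    have X: "\<And>i. i \<in> {1..N} \<Longrightarrow> h k i \<in> space (refX m)" by (rule slice_in[OF h])
    have flow: "(LINT x|next_law N k (h k). fprop j (Suc k) \<phi> x) / (LINT x|next_law N k (h k). H j (Suc k) x) =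
        particle_filter N (Suc j) k \<phi> (h k)"
      by (rule particle_filter_flow[OF N X \<phi>])
    have "prob_space (next_law N k (h k))" "sets (next_law N k (h k)) = sets (refX m)"
      using prob_space_next_law[OF N X] sets_next_law[OF N X] by auto
    from particle_filter_bias[OF this N \<phi> phi_le, of j "Suc k"]
    show "\<bar>(LINT X|(\<Pi>\<^sub>M i\<in>{1..N}. next_law N k (h k)). particle_filter N j (Suc k) \<phi> ((h(Suc k := X)) (Suc k))) -
        particle_filter N (Suc j) k \<phi> (h k)\<bar> \<le> 2 * (1 / (\<epsilon>\<^sup>2)\<^sup>2) ^ 3 * \<rho> ^ j / N" by (simp add: flow)
  qed (auto intro: particle_filter_measurable C C')
  \<comment> \<open>The replaced step is appended to the exact run, hence the hypothesis at
    \<open>Suc j\<close>.\<close>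
  with Suc[of "Suc j"] show ?case by simp
qed

text \<open>The same telescope. The term for i also contains the oscillation of the weight function
  at time i, in which the initial weights have decayed to \<rho>^i B.\<close>

lemma particle_deriv_total_bias:
  "\<bar>(LINT h|L k. particle_deriv N j k \<phi> (h k) (wt h k)) - law_deriv (j + k) 0 \<phi> (init m \<theta>) w\<bar>
   \<le> (\<Sum>i\<le>k. step_const * (real (Suc (j + k - i)) * \<rho> ^ (j + k - i) * (1 + (\<Gamma> / (\<epsilon>\<^sup>2)\<^sup>2 + \<rho> ^ i * B))) / N)"
proof (induction k arbitrary: j)
  case 0
  have "(LINT h|L 0. particle_deriv N j 0 \<phi> (h 0) (wt h 0)) =
      (LINT X|(\<Pi>\<^sub>M i\<in>{1..N}. init m \<theta>). particle_deriv N j 0 \<phi> X (\<lambda>i. w (X i)))"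
    by (subst integral_law_0[OF particle_deriv_measurable[OF order_refl]]) simp
  moreover have "\<bar>w x - 0\<bar> \<le> \<Gamma> / (\<epsilon>\<^sup>2)\<^sup>2 + \<rho> ^ 0 * B" if "x \<in> space (refX m)" for x
    using w_near_zero[of x] that by (simp add: space_refX)
  note particle_deriv_bias[OF init_prob _ N \<phi> phi_le w_meas this, of j 0]
  ultimately show ?case by (simp add: sets_init sets_refX)
next
  case (Suc k)
  obtain C where C: "\<And>h n. h \<in> space (\<H> n) \<Longrightarrow> Suc k \<le> n \<Longrightarrow> \<bar>particle_deriv N j (Suc k) \<phi> (h (Suc k)) (wt h (Suc k))\<bar> \<le> C"
    using particle_deriv_history_bounded[of "Suc k" j] by blast
  obtain C' where C': "\<And>h n. h \<in> space (\<H> n) \<Longrightarrow> k \<le> n \<Longrightarrow> \<bar>particle_deriv N (Suc j) k \<phi> (h k) (wt h k)\<bar> \<le> C'"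
    using particle_deriv_history_bounded[of k "Suc j"] by blast
  let ?E = "step_const * (real (Suc j) * \<rho> ^ j * (1 + (\<Gamma> / (\<epsilon>\<^sup>2)\<^sup>2 + \<rho> ^ Suc k * B))) / N"
  have "\<bar>(LINT h|L (Suc k). particle_deriv N j (Suc k) \<phi> (h (Suc k)) (wt h (Suc k))) -
     (LINT h|L k. particle_deriv N (Suc j) k \<phi> (h k) (wt h k))\<bar> \<le> ?E"
  proof (rule integral_law_step_diff[where a="\<lambda>h. particle_deriv N j (Suc k) \<phi> (h (Suc k)) (wt h (Suc k))"
        and b="\<lambda>h. particle_deriv N (Suc j) k \<phi> (h k) (wt h k)" and C=C and C'=C'])
    fix h assume h: "h \<in> space (\<H> k)"
    have X: "\<And>i. i \<in> {1..N} \<Longrightarrow> h k i \<in> space (refX m)" by (rule slice_in[OF h])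
    obtain c where c: "\<And>x. x \<in> space (refX m) \<Longrightarrow> \<bar>next_weight N k (h k) (wt h k) x - c\<bar> \<le> \<Gamma> / (\<epsilon>\<^sup>2)\<^sup>2 + \<rho> ^ Suc k * B"
      using next_weight_near_const_history[OF h order_refl] by (auto simp: space_refX)
    have flow: "law_deriv j (Suc k) \<phi> (next_law N k (h k)) (next_weight N k (h k) (wt h k)) =
        particle_deriv N (Suc j) k \<phi> (h k) (wt h k)"
      by (rule particle_deriv_flow[OF N X \<phi>])
    have law: "prob_space (next_law N k (h k))" "sets (next_law N k (h k)) = sets (refX m)"
      using prob_space_next_law[OF N X] sets_next_law[OF N X] by auto
    have "next_weight N k (h k) (wt h k) \<in> borel_measurable (refX m)"
      by (rule next_weight_measurable[OF N X])
    from particle_deriv_bias[OF law N \<phi> phi_le this c, of j "Suc k"]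
    show "\<bar>(LINT X|(\<Pi>\<^sub>M i\<in>{1..N}. next_law N k (h k)). particle_deriv N j (Suc k) \<phi> ((h(Suc k := X)) (Suc k)) (wt (h(Suc k := X)) (Suc k))) -
        particle_deriv N (Suc j) k \<phi> (h k) (wt h k)\<bar> \<le> ?E" by (simp add: wt_upd flow)
  qed (auto intro: particle_deriv_measurable C C' simp del: wt.simps)
  with Suc[of "Suc j"] show ?case by simp
qed

end


section \<open>Integrals over paths\<close>

abbreviation "\<P> \<equiv> path_base m \<theta>"

definition path_score :: "nat \<Rightarrow> (nat \<Rightarrow> vec) \<Rightarrow> real" where
  "path_score n x = w (x 0) + (\<Sum>k=1..n. g (k - 1) (x k) (x (k - 1)) / kern m \<theta> y (k - 1) (x k) (x (k - 1)))"

lemma product_sigma_finite_path: "product_sigma_finite (\<lambda>k::nat. if k = 0 then init m \<theta> else refX m)"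
proof (rule product_sigma_finite.intro)
  interpret i: prob_space "init m \<theta>" by (rule init_prob)
  show "sigma_finite_measure (if k = 0 then init m \<theta> else refX m)" for k :: nat
    using i.sigma_finite_measure_axioms sigma_finite_measure_axioms by simp
qed

lemma path_in: "x \<in> space (\<P> n) \<Longrightarrow> k \<le> n \<Longrightarrow> x k \<in> setX m"
  by (auto simp: path_base_def space_PiM PiE_iff space_init space_refX split: if_splits)

lemma path_component_measurable:
  assumes "k \<le> n"
  shows "(\<lambda>x. x k) \<in> \<P> n \<rightarrow>\<^sub>M refX m"
proof -
  have "(\<lambda>x. x k) \<in> \<P> n \<rightarrow>\<^sub>M (if k = 0 then init m \<theta> else refX m)"
    unfolding path_base_def by (rule measurable_component_singleton) (use assms in simp)
  moreover have "sets (if k = 0 then init m \<theta> else refX m) = sets (refX m)"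
    by (simp add: sets_init sets_refX)
  ultimately show ?thesis by (simp cong: measurable_cong_sets)
qed

lemma finite_measure_path: "finite_measure (\<P> n)"
proof
  interpret p: product_sigma_finite "\<lambda>k::nat. if k = 0 then init m \<theta> else refX m"
    by (rule product_sigma_finite_path)
  interpret i: prob_space "init m \<theta>" by (rule init_prob)
  have "emeasure (\<P> n) (space (\<P> n)) =
      (\<Prod>k\<le>n. emeasure (if k = 0 then init m \<theta> else refX m) (space (if k = 0 then init m \<theta> else refX m)))"
    unfolding path_base_def space_PiM by (rule p.emeasure_PiM) auto
  also have "\<dots> < \<infinity>"
  proof -
    have "(\<Prod>k\<in>A. c k) < \<infinity>" if "finite A" "\<And>k. c k < \<infinity>" for A :: "nat set" and c :: "nat \<Rightarrow> ennreal"
      using that by (induction rule: finite_induct) (auto simp: ennreal_mult_less_top)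
    then show ?thesis by (auto simp: less_top[symmetric])
  qed
  finally show "emeasure (\<P> n) (space (\<P> n)) \<noteq> \<infinity>" by simp
qed

lemma integrable_path: "bounded_measurable (\<P> n) a \<Longrightarrow> integrable (\<P> n) a"
  by (rule finite_measure.integrable_bounded_measurable[OF finite_measure_path])

lemma path_kern_bounded:
  "i \<le> n \<Longrightarrow> j \<le> n \<Longrightarrow> bounded_measurable (\<P> n) (\<lambda>x. kern m \<theta> y k (x i) (x j))"
  "i \<le> n \<Longrightarrow> j \<le> n \<Longrightarrow> bounded_measurable (\<P> n) (\<lambda>x. g k (x i) (x j))"
  "i \<le> n \<Longrightarrow> j \<le> n \<Longrightarrow> bounded_measurable (\<P> n) (\<lambda>x. g k (x i) (x j) / kern m \<theta> y k (x i) (x j))"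
proof -
  assume ij: "i \<le> n" "j \<le> n"
  note m = f_comp_measurable[OF path_component_measurable[OF ij(1)] path_component_measurable[OF ij(2)], of k]
    g_comp_measurable[OF path_component_measurable[OF ij(1)] path_component_measurable[OF ij(2)], of k]
  have s: "x i \<in> space (refX m)" "x j \<in> space (refX m)" if "x \<in> space (\<P> n)" for x
    using path_in[OF that] ij by (auto simp: space_refX)
  show "bounded_measurable (\<P> n) (\<lambda>x. kern m \<theta> y k (x i) (x j))"
    by (rule bounded_measurableI[OF m(1) f_abs]) (auto simp: s)
  show "bounded_measurable (\<P> n) (\<lambda>x. g k (x i) (x j))"
    by (rule bounded_measurableI[OF m(2) g_abs]) (auto simp: s)
  show "bounded_measurable (\<P> n) (\<lambda>x. g k (x i) (x j) / kern m \<theta> y k (x i) (x j))"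
  proof (rule bounded_measurableI)
    show "\<bar>g k (x i) (x j) / kern m \<theta> y k (x i) (x j)\<bar> \<le> \<Gamma>" if "x \<in> space (\<P> n)" for x
      using g_bound[of "x j" "x i" k] f_pos[of "x j" "x i" k] s[OF that] by (simp add: pos_divide_le_eq)
  qed (intro borel_measurable_divide m)
qed

lemma path_function_bounded:
  "bounded_measurable (refX m) \<psi> \<Longrightarrow> k \<le> n \<Longrightarrow> bounded_measurable (\<P> n) (\<lambda>x. \<psi> (x k))"
  by (rule bounded_measurable_compose[OF _ path_component_measurable])

lemma r_path_Suc: "r_path m \<theta> y (Suc n) x = r_path m \<theta> y n x * kern m \<theta> y n (x (Suc n)) (x n)"
  by (simp add: r_path_def r_step_def kern_def)

lemma path_score_Suc:
  "path_score (Suc n) x = path_score n x + g n (x (Suc n)) (x n) / kern m \<theta> y n (x (Suc n)) (x n)"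
  by (simp add: path_score_def)

lemma r_path_bounded: "k \<le> n \<Longrightarrow> bounded_measurable (\<P> n) (r_path m \<theta> y k)"
proof (induction k)
  case 0
  then show ?case by (simp add: r_path_def[abs_def] bounded_measurable_const)
next
  case (Suc k)
  then show ?case unfolding r_path_Suc[abs_def] by (intro bounded_measurable_mult path_kern_bounded) auto
qed

lemma path_score_bounded: "k \<le> n \<Longrightarrow> bounded_measurable (\<P> n) (path_score k)"
proof (induction k)
  case 0
  have "bounded_measurable (refX m) w" using w_meas w_le by (intro bounded_measurableI) (auto simp: space_refX)
  then show ?case by (simp add: path_score_def[abs_def] path_function_bounded)
next
  case (Suc k)
  then show ?case unfolding path_score_Suc[abs_def] by (intro bounded_measurable_add path_kern_bounded) auto
qed

lemma r_path_pos: "x \<in> space (\<P> n) \<Longrightarrow> k \<le> n \<Longrightarrow> 0 < r_path m \<theta> y k x"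
proof (induction k)
  case 0
  then show ?case by (simp add: r_path_def)
next
  case (Suc k)
  then show ?case unfolding r_path_Suc by (intro mult_pos_pos f_pos) (auto simp: space_refX path_in)
qed

lemma r_path_upd: "r_path m \<theta> y n (x(Suc n := z)) = r_path m \<theta> y n x"
  unfolding r_path_def by (rule prod.cong) auto

lemma path_score_upd: "path_score n (x(Suc n := z)) = path_score n x"
  unfolding path_score_def by (intro arg_cong2[where f="(+)"] sum.cong) auto

lemma path_integral_0:
  assumes "a \<in> borel_measurable (refX m)"
  shows "(LINT x|\<P> 0. a (x 0) :: real) = (LINT x|init m \<theta>. a x)"
proof -
  interpret p: product_sigma_finite "\<lambda>k::nat. if k = 0 then init m \<theta> else refX m"
    by (rule product_sigma_finite_path)
  have "a \<in> borel_measurable (init m \<theta>)"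
    using assms by (simp cong: measurable_cong_sets add: sets_init sets_refX)
  then show ?thesis
    using p.product_integral_singleton[of a 0] by (simp add: path_base_def)
qed

lemma path_integral_Suc:
  assumes F: "bounded_measurable (\<P> (Suc n)) F"
    and eq: "\<And>x z. x \<in> space (\<P> n) \<Longrightarrow> z \<in> setX m \<Longrightarrow> F (x(Suc n := z)) = a x * b x z"
  shows "(LINT x|\<P> (Suc n). F x) = (LINT x|\<P> n. a x * (LINT z|refX m. b x z))"
proof -
  let ?M = "\<lambda>k::nat. if k = 0 then init m \<theta> else refX m"
  interpret p: product_sigma_finite ?M by (rule product_sigma_finite_path)
  have P: "\<P> (Suc n) = Pi\<^sub>M (insert (Suc n) {..n}) ?M"
    unfolding path_base_def by (simp add: atMost_Suc)
  have "(LINT x|\<P> (Suc n). F x) = (LINT x|Pi\<^sub>M {..n} ?M. LINT z|?M (Suc n). F (x(Suc n := z)))"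
    unfolding P by (rule p.product_integral_insert) (use integrable_path[OF F] in \<open>auto simp: P\<close>)
  also have "\<dots> = (LINT x|\<P> n. LINT z|refX m. F (x(Suc n := z)))" by (simp add: path_base_def)
  also have "\<dots> = (LINT x|\<P> n. LINT z|refX m. a x * b x z)"
    by (intro Bochner_Integration.integral_cong refl eq) (auto simp: space_refX)
  finally show ?thesis by simp
qed

definition path_int :: "nat \<Rightarrow> (vec \<Rightarrow> real) \<Rightarrow> real" where
  "path_int n \<psi> = (LINT x|\<P> n. r_path m \<theta> y n x * \<psi> (x n))"

definition path_dint :: "nat \<Rightarrow> (vec \<Rightarrow> real) \<Rightarrow> real" where
  "path_dint n \<psi> = (LINT x|\<P> n. path_score n x * r_path m \<theta> y n x * \<psi> (x n))"

lemma path_int_Suc: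
  assumes \<psi>: "bounded_measurable (refX m) \<psi>"
  shows "path_int (Suc n) \<psi> = path_int n (Fop n \<psi>)"
  unfolding path_int_def Fop_def
  by (rule path_integral_Suc)
    (auto simp: r_path_Suc r_path_upd mult.assoc
      intro!: bounded_measurable_mult path_kern_bounded r_path_bounded path_function_bounded \<psi>)

lemma path_int_add:
  assumes "bounded_measurable (refX m) \<phi>" "bounded_measurable (refX m) \<psi>"
  shows "path_int n (\<lambda>x. \<phi> x + \<psi> x) = path_int n \<phi> + path_int n \<psi>"
  unfolding path_int_def distrib_left
  by (intro Bochner_Integration.integral_add integrable_path bounded_measurable_mult r_path_bounded path_function_bounded assms order_refl)

text \<open>The score splits into the past and the last step g/f. The factor f in the path density
  cancels the denominator of the latter, which leaves \<open>Gop\<close>.\<close>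

lemma path_dint_Suc:
  assumes \<psi>: "bounded_measurable (refX m) \<psi>"
  shows "path_dint (Suc n) \<psi> = path_dint n (Fop n \<psi>) + path_int n (Gop n \<psi>)"
proof -
  let ?F1 = "\<lambda>x. path_score n x * r_path m \<theta> y n x * (kern m \<theta> y n (x (Suc n)) (x n) * \<psi> (x (Suc n)))"
  let ?F2 = "\<lambda>x. r_path m \<theta> y n x * (g n (x (Suc n)) (x n) * \<psi> (x (Suc n)))"
  have F1: "bounded_measurable (\<P> (Suc n)) ?F1" and F2: "bounded_measurable (\<P> (Suc n)) ?F2"
    by (intro bounded_measurable_mult path_kern_bounded r_path_bounded path_score_bounded path_function_bounded \<psi>; simp)+
  have "path_dint (Suc n) \<psi> = (LINT x|\<P> (Suc n). ?F1 x + ?F2 x)"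
    unfolding path_dint_def
  proof (rule Bochner_Integration.integral_cong[OF refl])
    fix x assume "x \<in> space (\<P> (Suc n))"
    then have "0 < kern m \<theta> y n (x (Suc n)) (x n)" by (intro f_pos) (auto simp: space_refX path_in)
    then show "path_score (Suc n) x * r_path m \<theta> y (Suc n) x * \<psi> (x (Suc n)) = ?F1 x + ?F2 x"
      by (simp add: path_score_Suc r_path_Suc distrib_right)
  qed
  also have "\<dots> = (LINT x|\<P> (Suc n). ?F1 x) + (LINT x|\<P> (Suc n). ?F2 x)"
    by (intro Bochner_Integration.integral_add integrable_path F1 F2)
  also have "(LINT x|\<P> (Suc n). ?F1 x) = path_dint n (Fop n \<psi>)"
    unfolding path_dint_def Fop_def by (rule path_integral_Suc[OF F1]) (simp add: r_path_upd path_score_upd)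
  also have "(LINT x|\<P> (Suc n). ?F2 x) = path_int n (Gop n \<psi>)"
    unfolding path_int_def Gop_def by (rule path_integral_Suc[OF F2]) (simp add: r_path_upd)
  finally show ?thesis .
qed

text \<open>Duality between forward measures and backward functions: integrating out the last state
  moves one step from the path to the propagated function, so only k + j matters and k can be
  brought down to 0.\<close>

lemma path_int_fprop:
  assumes \<phi>: "bounded_measurable (refX m) \<phi>"
  shows "path_int k (fprop j k \<phi>) = (LINT x|init m \<theta>. fprop (k + j) 0 \<phi> x)"
proof (induction k arbitrary: j)
  case 0
  show ?case
    using path_integral_0[OF bounded_measurable_borel[OF fprop_bounded_measurable[OF \<phi>]], of j 0]
    by (simp add: path_int_def r_path_def)
next
  case (Suc k)
  have "path_int (Suc k) (fprop j (Suc k) \<phi>) = path_int k (fprop (Suc j) k \<phi>)"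
    by (simp add: path_int_Suc fprop_bounded_measurable[OF \<phi>])
  with Suc[of "Suc j"] show ?case by simp
qed

text \<open>Neither summand is invariant under moving a step, but their sum is: the
  \<open>Gop\<close> term released by the path integral is the one that \<open>dprop\<close> takes
  up.\<close>

lemma path_dint_fprop:
  assumes \<phi>: "bounded_measurable (refX m) \<phi>"
  shows "path_dint k (fprop j k \<phi>) + path_int k (dprop j k \<phi>) =
    (LINT x|init m \<theta>. dprop (k + j) 0 \<phi> x + w x * fprop (k + j) 0 \<phi> x)"
proof (induction k arbitrary: j)
  case 0
  have w: "bounded_measurable (refX m) w" using w_meas w_le by (intro bounded_measurableI) (auto simp: space_refX)
  note bm = bounded_measurable_mult[OF w fprop_bounded_measurable[OF \<phi>, of j 0]] dprop_bounded_measurable[OF \<phi>, of j 0]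
  have i: "integrable (init m \<theta>) a" if "bounded_measurable (refX m) a" for a
  proof -
    interpret prob_space "init m \<theta>" by (rule init_prob)
    have "sets (refX m) = sets (init m \<theta>)" by (simp add: sets_init sets_refX)
    from bounded_measurable_cong_sets[OF this] that show ?thesis by (intro integrable_bounded_measurable) simp
  qed
  show ?case
    using path_integral_0[OF bounded_measurable_borel[OF bm(1)]] path_integral_0[OF bounded_measurable_borel[OF bm(2)]] i[OF bm(1)] i[OF bm(2)]
    by (simp add: path_int_def path_dint_def r_path_def path_score_def)
next
  case (Suc k)
  have "path_dint (Suc k) (fprop j (Suc k) \<phi>) + path_int (Suc k) (dprop j (Suc k) \<phi>) =
      path_dint k (fprop (Suc j) k \<phi>) + path_int k (dprop (Suc j) k \<phi>)"
    by (simp add: path_int_Suc path_dint_Suc path_int_add fprop_bounded_measurable[OF \<phi>] dprop_bounded_measurable[OF \<phi>]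
        Fop_bounded_measurable Gop_bounded_measurable)
  with Suc[of "Suc j"] show ?case by simp
qed

lemma path_int_exact: "bounded_measurable (refX m) \<phi> \<Longrightarrow> path_int n \<phi> = (LINT x|init m \<theta>. fprop n 0 \<phi> x)"
  using path_int_fprop[of \<phi> n 0] by simp

lemma path_dint_exact:
  "bounded_measurable (refX m) \<phi> \<Longrightarrow> path_dint n \<phi> = (LINT x|init m \<theta>. dprop n 0 \<phi> x + w x * fprop n 0 \<phi> x)"
  using path_dint_fprop[of \<phi> n 0] by (simp add: path_int_def)

section \<open>The exact measures expressed by the operators\<close>

definition total :: "nat \<Rightarrow> real" where "total n = path_int n (\<lambda>_. 1)"

lemma total_eq: "total n = (LINT x|\<P> n. r_path m \<theta> y n x)"
  by (simp add: total_def path_int_def)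

lemma total_pos: "0 < total n"
proof -
  interpret b: bounded_ratio "init m \<theta>" "H n 0" "1 / (\<epsilon>\<^sup>2)\<^sup>2"
    by (rule bounded_ratio_H[OF init_prob]) (simp add: sets_init sets_refX)
  show ?thesis
    using b.integral_H_pos by (simp add: total_def path_int_exact bounded_measurable_const H_def)
qed

lemma mass_R: "emeasure (R_path m \<theta> y n) (space (R_path m \<theta> y n)) = ennreal (total n)"
proof -
  have "emeasure (R_path m \<theta> y n) (space (R_path m \<theta> y n)) = (\<integral>\<^sup>+x. ennreal (r_path m \<theta> y n x) \<partial>\<P> n)"
    unfolding R_path_def using bounded_measurable_borel[OF r_path_bounded[OF order_refl]]
    by (auto simp: emeasure_density intro!: nn_integral_cong)
  also have "\<dots> = ennreal (total n)"
    unfolding total_eq by (rule nn_integral_eq_integral[OF integrable_path[OF r_path_bounded[OF order_refl]]])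
      (auto intro!: AE_I2 less_imp_le[OF r_path_pos])
  finally show ?thesis .
qed

lemma P_path_density: "P_path m \<theta> y n = density (\<P> n) (\<lambda>x. ennreal (r_path m \<theta> y n x / total n))"
proof (rule measure_eqI)
  have [measurable]: "r_path m \<theta> y n \<in> borel_measurable (\<P> n)"
    by (rule bounded_measurable_borel[OF r_path_bounded[OF order_refl]])
  show "sets (P_path m \<theta> y n) = sets (density (\<P> n) (\<lambda>x. ennreal (r_path m \<theta> y n x / total n)))"
    by (simp add: P_path_def R_path_def)
  fix A assume "A \<in> sets (P_path m \<theta> y n)"
  then have [measurable]: "A \<in> sets (\<P> n)" by (simp add: P_path_def R_path_def)
  have "1 / ennreal (total n) = ennreal (1 / total n)"
    using total_pos[of n] divide_ennreal[of 1 "total n"] by simp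
  then have "emeasure (P_path m \<theta> y n) A = ennreal (1 / total n) * (\<integral>\<^sup>+x. ennreal (r_path m \<theta> y n x) * indicator A x \<partial>\<P> n)"
    unfolding P_path_def mass_R by (simp add: R_path_def emeasure_density)
  also have "\<dots> = (\<integral>\<^sup>+x. ennreal (1 / total n) * (ennreal (r_path m \<theta> y n x) * indicator A x) \<partial>\<P> n)"
    by (rule nn_integral_cmult[symmetric]) measurable
  also have "\<dots> = (\<integral>\<^sup>+x. ennreal (r_path m \<theta> y n x / total n) * indicator A x \<partial>\<P> n)"
  proof (rule nn_integral_cong)
    fix x assume "x \<in> space (\<P> n)"
    then show "ennreal (1 / total n) * (ennreal (r_path m \<theta> y n x) * indicator A x) = ennreal (r_path m \<theta> y n x / total n) * indicator A x"
      using r_path_pos[of x n n] total_pos[of n]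
      by (simp add: mult.assoc[symmetric] ennreal_mult[symmetric])
  qed
  also have "\<dots> = emeasure (density (\<P> n) (\<lambda>x. ennreal (r_path m \<theta> y n x / total n))) A"
    by (simp add: emeasure_density)
  finally show "emeasure (P_path m \<theta> y n) A = emeasure (density (\<P> n) (\<lambda>x. ennreal (r_path m \<theta> y n x / total n))) A" .
qed

lemma integral_P_path:
  assumes "a \<in> borel_measurable (\<P> n)"
  shows "(LINT x|P_path m \<theta> y n. a x) = (LINT x|\<P> n. r_path m \<theta> y n x / total n * a x)"
  unfolding P_path_density using assms bounded_measurable_borel[OF r_path_bounded[OF order_refl]] total_pos[of n]
  by (intro integral_real_density AE_I2 divide_nonneg_nonneg borel_measurable_divide) (auto intro: less_imp_le[OF r_path_pos])

lemma path_end_measurable: "(\<lambda>x. x n) \<in> \<P> n \<rightarrow>\<^sub>M spX m"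
  using path_component_measurable[of n n] by (simp cong: measurable_cong_sets add: sets_refX)

lemma integral_P_meas:
  assumes \<phi>: "bounded_measurable (refX m) \<phi>"
  shows "(LINT x|P_meas m \<theta> y n. \<phi> x) = (LINT x|init m \<theta>. fprop n 0 \<phi> x) / (LINT x|init m \<theta>. H n 0 x)"
proof -
  have \<phi>m: "\<phi> \<in> borel_measurable (spX m)"
    using bounded_measurable_borel[OF \<phi>] by (simp cong: measurable_cong_sets add: sets_refX)
  have "(\<lambda>x. x n) \<in> P_path m \<theta> y n \<rightarrow>\<^sub>M spX m"
    unfolding P_path_density using path_end_measurable by simp
  then have "(LINT x|P_meas m \<theta> y n. \<phi> x) = (LINT x|P_path m \<theta> y n. \<phi> (x n))"
    unfolding P_meas_def by (rule integral_distr[OF _ \<phi>m])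
  also have "\<dots> = (LINT x|\<P> n. r_path m \<theta> y n x / total n * \<phi> (x n))"
    by (rule integral_P_path[OF measurable_compose[OF path_end_measurable \<phi>m]])
  also have "\<dots> = path_int n \<phi> / total n" by (simp add: path_int_def)
  finally show ?thesis
    by (simp add: total_def path_int_exact \<phi> bounded_measurable_const H_def)
qed

lemma measure_R_total: "measure (R_path m \<theta> y n) (space (R_path m \<theta> y n)) = total n"
  using mass_R[of n] total_pos[of n] by (simp add: measure_def)

text \<open>On path space the signed measure has the density \<open>G\<close> with respect to
  \<open>path_base\<close>, and projection to the last state is covered by
  \<open>signed_integral_distr\<close>. No density on the state space has to be computed.\<close>

lemma signed_integral_Q_meas:
  assumes t: "\<And>x. x \<in> space (\<P> n) \<Longrightarrow> t_path m \<theta> y n x c = path_score n x"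
    and \<phi>: "bounded_measurable (refX m) \<phi>"
  shows "signed_integral (spX m) (Q_meas m \<theta> y n c) \<phi> = law_deriv n 0 \<phi> (init m \<theta>) w"
proof -
  let ?r = "r_path m \<theta> y n" and ?s = "path_score n"
  have bm: "bounded_measurable (\<P> n) ?r" "bounded_measurable (\<P> n) ?s"
    by (rule r_path_bounded path_score_bounded; simp)+
  note [measurable] = bm[THEN bounded_measurable_borel] path_end_measurable
  define mT where "mT = path_dint n (\<lambda>_. 1)"
  define G where "G x = ?s x * ?r x / total n - ?r x / total n * (mT / total n)" for x
  have bG: "bounded_measurable (\<P> n) G"
    unfolding G_def[abs_def] divide_inverse
    by (intro bounded_measurable_diff bounded_measurable_mult bm bounded_measurable_const)
  have Tint: "T_path m \<theta> y n c A = (LINT x|\<P> n. ?s x * ?r x * indicator A x)" for A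
    unfolding T_path_def set_lebesgue_integral_def by (rule Bochner_Integration.integral_cong) (auto simp: t)
  have mass_T: "T_path m \<theta> y n c (space (\<P> n)) = mT"
    unfolding Tint mT_def path_dint_def by (rule Bochner_Integration.integral_cong) auto
  have Gint: "(LINT x|\<P> n. G x * a x) = (LINT x|\<P> n. ?s x * ?r x * a x) / total n -
      (LINT x|\<P> n. ?r x * a x) / total n * (mT / total n)" if a: "bounded_measurable (\<P> n) a" for a
  proof -
    have i: "integrable (\<P> n) (\<lambda>x. ?s x * ?r x * a x)" "integrable (\<P> n) (\<lambda>x. ?r x * a x)"
      by (intro integrable_path bounded_measurable_mult bm a)+
    have "(LINT x|\<P> n. G x * a x) = (LINT x|\<P> n. ?s x * ?r x * a x / total n - ?r x * a x / total n * (mT / total n))"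
      by (rule Bochner_Integration.integral_cong) (simp_all add: G_def algebra_simps)
    also have "\<dots> = (LINT x|\<P> n. ?s x * ?r x * a x / total n) - (LINT x|\<P> n. ?r x * a x / total n * (mT / total n))"
      using i by (intro Bochner_Integration.integral_diff) auto
    finally show ?thesis by simp
  qed
  have Q: "Q_meas m \<theta> y n c D = (LINT x|\<P> n. G x * indicator D (x n))" if D: "D \<in> sets (spX m)" for D
  proof -
    let ?A = "{x \<in> space (\<P> n). x n \<in> D}"
    have A[measurable]: "?A \<in> sets (\<P> n)" using measurable_sets[OF path_end_measurable D] by (simp add: vimage_def Int_def conj_commute)
    have bA: "bounded_measurable (\<P> n) (indicator ?A)" by (rule bounded_measurableI[of _ _ 1]) (auto simp: indicator_def)
    have mP: "measure (P_path m \<theta> y n) ?A = (LINT x|\<P> n. ?r x * indicator ?A x) / total n"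
    proof -
      have "measure (P_path m \<theta> y n) ?A = (LINT x|P_path m \<theta> y n. indicator ?A x)"
        using A sets.sets_into_space[OF A] by (simp add: P_path_density Int_absorb2)
      also have "\<dots> = (LINT x|\<P> n. ?r x / total n * indicator ?A x)"
        by (rule integral_P_path) measurable
      finally show ?thesis by simp
    qed
    have "Q_meas m \<theta> y n c D = (LINT x|\<P> n. G x * indicator ?A x)"
      unfolding Q_meas_def Q_path_def Let_def measure_R_total mass_T Gint[OF bA] mP by (simp only: Tint)
    also have "\<dots> = (LINT x|\<P> n. G x * indicator D (x n))"
      by (rule Bochner_Integration.integral_cong) (auto simp: indicator_def)
    finally show ?thesis .
  qed
  obtain C where C: "\<And>x. x \<in> space (refX m) \<Longrightarrow> \<bar>\<phi> x\<bar> \<le> C" using \<phi> by (auto simp: bounded_measurable_def)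
  have "signed_integral (spX m) (Q_meas m \<theta> y n c) \<phi> = (LINT x|\<P> n. G x * \<phi> (x n))"
  proof (rule signed_integral_distr[OF integrable_path[OF bG] path_end_measurable Q])
    show "\<phi> \<in> borel_measurable (spX m)"
      using bounded_measurable_borel[OF \<phi>] by (simp cong: measurable_cong_sets add: sets_refX)
    show "\<bar>\<phi> x\<bar> \<le> C" if "x \<in> space (spX m)" for x
      using C that by (simp add: space_refX space_spX[OF model])
  qed
  also have "\<dots> = path_dint n \<phi> / total n - path_int n \<phi> / total n * (mT / total n)"
    unfolding Gint[OF path_function_bounded[OF \<phi> order_refl]] path_dint_def path_int_def ..
  also have "\<dots> = law_deriv n 0 \<phi> (init m \<theta>) w"
    unfolding mT_def total_def
    by (simp add: path_dint_exact path_int_exact \<phi> bounded_measurable_const law_deriv_def quot_deriv_def H_def power2_eq_square)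
  finally show ?thesis .
qed

section \<open>The estimators and their biases\<close>

lemma integral_xi_hat:
  assumes \<phi>: "bounded_measurable (refX m) \<phi>" and h: "h \<in> space (\<H> n)"
  shows "(LINT x|xi_hat m N h n. \<phi> x) = particle_filter N 0 n \<phi> (h n)"
proof -
  have "(\<lambda>i. h n i) \<in> uniform_count_measure {1..N} \<rightarrow>\<^sub>M spX m"
    using history_in[OF h order_refl] by (auto simp: space_spX[OF model] uniform_count_measure_def point_measure_def)
  moreover have "\<phi> \<in> borel_measurable (spX m)"
    using bounded_measurable_borel[OF \<phi>] by (simp cong: measurable_cong_sets add: sets_refX)
  ultimately have "(LINT x|xi_hat m N h n. \<phi> x) = (LINT i|uniform_count_measure {1..N}. \<phi> (h n i))"
    unfolding xi_hat_def by (rule integral_distr)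
  also have "\<dots> = (\<Sum>i=1..N. \<phi> (h n i)) / real N" by (subst integral_uniform_count_measure) auto
  also have "\<dots> = particle_filter N 0 n \<phi> (h n)" by (simp add: particle_filter_def H_0)
  finally show ?thesis .
qed

text \<open>The estimator is the image of a signed weighting of the particle indices, so
  \<open>signed_integral_distr\<close> applies with counting measure, also when particles coincide
  and their masses add or cancel.\<close>

lemma signed_integral_zeta_hat:
  assumes wt: "\<And>i. i \<in> {1..N} \<Longrightarrow> weight m N \<theta> y h n i c = wt h n i"
    and \<phi>: "bounded_measurable (refX m) \<phi>" and h: "h \<in> space (\<H> n)"
  shows "signed_integral (spX m) (zeta_hat m N \<theta> y h n c) \<phi> = particle_deriv N 0 n \<phi> (h n) (wt h n)"
proof -
  define G where "G i = (wt h n i - 1 / real N * (\<Sum>j=1..N. wt h n j)) / real N" for i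
  obtain C where C: "\<And>x. x \<in> space (refX m) \<Longrightarrow> \<bar>\<phi> x\<bar> \<le> C" using \<phi> by (auto simp: bounded_measurable_def)
  have "signed_integral (spX m) (zeta_hat m N \<theta> y h n c) \<phi> = (LINT i|count_space {1..N}. G i * \<phi> (h n i))"
  proof (rule signed_integral_distr)
    show "integrable (count_space {1..N}) G" by (rule integrable_count_space) simp
    show "(\<lambda>i. h n i) \<in> count_space {1..N} \<rightarrow>\<^sub>M spX m"
      using history_in[OF h order_refl] by (auto simp: space_spX[OF model])
    show "zeta_hat m N \<theta> y h n c D = (LINT i|count_space {1..N}. G i * indicator D (h n i))" for D
    proof -
      have s: "(\<Sum>j=1..N. weight m N \<theta> y h n j c) = (\<Sum>j=1..N. wt h n j)" by (rule sum.cong) (auto simp: wt)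
      have "zeta_hat m N \<theta> y h n c D =
          1 / real N * (\<Sum>i=1..N. (wt h n i - 1 / real N * (\<Sum>j=1..N. wt h n j)) * indicator D (h n i))"
        unfolding zeta_hat_def s by (intro arg_cong2[where f="(*)"] sum.cong) (auto simp: wt)
      also have "\<dots> = (\<Sum>i=1..N. G i * indicator D (h n i))"
        unfolding sum_distrib_left G_def by (rule sum.cong) auto
      finally show ?thesis by (simp add: lebesgue_integral_count_space_finite)
    qed
    show "\<phi> \<in> borel_measurable (spX m)"
      using bounded_measurable_borel[OF \<phi>] by (simp cong: measurable_cong_sets add: sets_refX)
    show "\<bar>\<phi> x\<bar> \<le> C" if "x \<in> space (spX m)" for x
      using C that by (simp add: space_refX space_spX[OF model])
  qed
  also have "\<dots> = (\<Sum>i=1..N. wt h n i * \<phi> (h n i)) / N - (\<Sum>i=1..N. \<phi> (h n i)) * (\<Sum>j=1..N. wt h n j) / (real N)\<^sup>2"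
  proof -
    have "G i * \<phi> (h n i) = wt h n i * \<phi> (h n i) / N - \<phi> (h n i) * (\<Sum>j=1..N. wt h n j) / (real N)\<^sup>2" for i
      by (simp add: G_def power2_eq_square algebra_simps diff_divide_distrib)
    then show ?thesis
      by (simp only: lebesgue_integral_count_space_finite finite_atLeastAtMost sum_subtractf sum_divide_distrib sum_distrib_right)
  qed
  also have "\<dots> = particle_deriv N 0 n \<phi> (h n) (wt h n)"
    by (simp add: particle_deriv_def quot_deriv_def H_0)
  finally show ?thesis .
qed

lemma xi_bias_le:
  assumes \<phi>: "bounded_measurable (refX m) \<phi>" "\<And>x. x \<in> setX m \<Longrightarrow> \<bar>\<phi> x\<bar> \<le> 1"
  shows "\<bar>xi_bias m N \<theta> y n \<phi>\<bar> \<le> (\<Sum>i\<le>n. 2 * (1 / (\<epsilon>\<^sup>2)\<^sup>2) ^ 3 * \<rho> ^ (n - i) / N)"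
proof -
  interpret prob_space "L n" by (rule prob_law)
  obtain C where C: "\<And>h k. h \<in> space (\<H> k) \<Longrightarrow> n \<le> k \<Longrightarrow> \<bar>particle_filter N 0 n \<phi> (h n)\<bar> \<le> C"
    using particle_filter_bounded[OF \<phi>] by blast
  have i: "integrable (L n) (\<lambda>h. particle_filter N 0 n \<phi> (h n))"
    by (rule integrable_law[OF \<phi>]) (auto intro: particle_filter_measurable[OF \<phi>] C)
  have "xi_bias m N \<theta> y n \<phi> = (LINT h|L n. particle_filter N 0 n \<phi> (h n) -
      (LINT x|init m \<theta>. fprop n 0 \<phi> x) / (LINT x|init m \<theta>. H n 0 x))"
    unfolding xi_bias_def by (rule Bochner_Integration.integral_cong) (auto simp: space_law integral_xi_hat integral_P_meas \<phi>)
  also have "\<dots> = (LINT h|L n. particle_filter N 0 n \<phi> (h n)) -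
      (LINT x|init m \<theta>. fprop n 0 \<phi> x) / (LINT x|init m \<theta>. H n 0 x)"
    using i by (simp add: prob_space)
  finally show ?thesis using particle_filter_total_bias[OF \<phi>, of n 0] by simp
qed

lemma zeta_bias_le:
  assumes \<phi>: "bounded_measurable (refX m) \<phi>" "\<And>x. x \<in> setX m \<Longrightarrow> \<bar>\<phi> x\<bar> \<le> 1"
    and t: "\<And>x. x \<in> space (\<P> n) \<Longrightarrow> t_path m \<theta> y n x c = path_score n x"
    and wt: "\<And>h i. h \<in> space (\<H> n) \<Longrightarrow> i \<in> {1..N} \<Longrightarrow> weight m N \<theta> y h n i c = wt h n i"
  shows "\<bar>zeta_bias m N \<theta> y n \<phi> c\<bar>
    \<le> (\<Sum>i\<le>n. step_const * (real (Suc (n - i)) * \<rho> ^ (n - i) * (1 + (\<Gamma> / (\<epsilon>\<^sup>2)\<^sup>2 + \<rho> ^ i * B))) / N)"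
proof -
  interpret prob_space "L n" by (rule prob_law)
  obtain C where C: "\<And>h k. h \<in> space (\<H> k) \<Longrightarrow> n \<le> k \<Longrightarrow> \<bar>particle_deriv N 0 n \<phi> (h n) (wt h n)\<bar> \<le> C"
    using particle_deriv_history_bounded[OF \<phi>] by blast
  have i: "integrable (L n) (\<lambda>h. particle_deriv N 0 n \<phi> (h n) (wt h n))"
    by (rule integrable_law[OF \<phi>]) (auto intro: particle_deriv_measurable[OF \<phi>] C)
  have "zeta_bias m N \<theta> y n \<phi> c = (LINT h|L n. particle_deriv N 0 n \<phi> (h n) (wt h n) - law_deriv n 0 \<phi> (init m \<theta>) w)"
    unfolding zeta_bias_def
  proof (rule Bochner_Integration.integral_cong[OF refl])
    fix h assume "h \<in> space (L n)"
    then have h: "h \<in> space (\<H> n)" by (simp add: space_law)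
    from signed_integral_zeta_hat[OF wt[OF h] \<phi>(1) h] signed_integral_Q_meas[OF t \<phi>(1)]
    show "signed_integral (spX m) (zeta_hat m N \<theta> y h n c) \<phi> - signed_integral (spX m) (Q_meas m \<theta> y n c) \<phi> =
        particle_deriv N 0 n \<phi> (h n) (wt h n) - law_deriv n 0 \<phi> (init m \<theta>) w" by simp
  qed
  also have "\<dots> = (LINT h|L n. particle_deriv N 0 n \<phi> (h n) (wt h n)) - law_deriv n 0 \<phi> (init m \<theta>) w"
    using i by (simp add: prob_space)
  finally show ?thesis using particle_deriv_total_bias[OF \<phi>, of n 0] by simp
qed

end

section \<open>Gradients in the parameter\<close>

text \<open>This lets a limit over the whole of the space be restricted to a coordinate line; for
  indices below d the modified vector stays extensional.\<close>

lemma tendsto_fun_upd_at: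
  fixes \<theta> :: vec
  assumes "\<theta> \<in> space (Rn d)" "c < d"
  shows "filterlim (\<lambda>s. \<theta>(c := s)) (at \<theta> within space (Rn d)) (at (\<theta> c))"
proof -
  have "continuous_on UNIV (\<lambda>s. (\<theta>(c := s)) i)" for i
    by (cases "i = c") (auto intro: continuous_intros)
  then have "continuous_on UNIV (\<lambda>s::real. \<theta>(c := s))"
    by (rule continuous_on_coordinatewise_then_product)
  then have "\<forall>s. ((\<lambda>s. \<theta>(c := s)) \<longlongrightarrow> \<theta>(c := s)) (at s)"
    by (simp add: continuous_on_def)
  then have "((\<lambda>s. \<theta>(c := s)) \<longlongrightarrow> \<theta>(c := \<theta> c)) (at (\<theta> c))" ..
  moreover have "\<forall>\<^sub>F s in at (\<theta> c). \<theta>(c := s) \<in> space (Rn d) \<and> \<theta>(c := s) \<noteq> \<theta>"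
    unfolding eventually_at_filter
  proof (intro always_eventually allI impI conjI)
    fix s assume "s \<noteq> \<theta> c"
    then show "\<theta>(c := s) \<noteq> \<theta>" by (metis fun_upd_same)
    show "\<theta>(c := s) \<in> space (Rn d)" using assms by (auto simp: Rn_def space_PiM PiE_iff extensional_def)
  qed
  ultimately show ?thesis by (simp add: filterlim_at)
qed

lemma linf_single: "c < d \<Longrightarrow> (\<And>i. i < d \<Longrightarrow> i \<noteq> c \<Longrightarrow> z i = 0) \<Longrightarrow> linf d z = \<bar>z c\<bar>"
  unfolding linf_def
proof (rule Max_eqI)
  fix a assume z: "\<And>i. i < d \<Longrightarrow> i \<noteq> c \<Longrightarrow> z i = 0" and "a \<in> (\<lambda>i. \<bar>z i\<bar>) ` {..<d}"
  then obtain i where "i < d" "a = \<bar>z i\<bar>" by auto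
  then show "a \<le> \<bar>z c\<bar>" using z[of i] by (cases "i = c") auto
qed auto

lemma abs_le_linf: "c < d \<Longrightarrow> \<bar>z c\<bar> \<le> linf d z"
  unfolding linf_def by (rule Max_ge) auto

lemma linf_le: "d \<ge> 1 \<Longrightarrow> (\<And>c. c < d \<Longrightarrow> \<bar>z c\<bar> \<le> D) \<Longrightarrow> linf d z \<le> D"
  unfolding linf_def by (subst Max_le_iff) (auto intro: exI[of _ 0] simp: lessThan_empty_iff)

text \<open>On a coordinate line the linear form has a single term and the norm is |s - \<theta> c|.
  Taking absolute values removes the sign that separates this quotient from the usual difference
  quotient.\<close>

lemma differentiable_Rn_partial:
  assumes f: "differentiable_Rn d f \<theta>" and \<theta>: "\<theta> \<in> space (Rn d)" and c: "c < d"
  shows "((\<lambda>s. f (\<theta>(c := s))) has_real_derivative partial_deriv c f \<theta>) (at (\<theta> c))"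
proof -
  obtain G where G: "((\<lambda>\<theta>'. (f \<theta>' - f \<theta> - (\<Sum>i<d. G i * (\<theta>' i - \<theta> i))) / linf d (\<lambda>i. \<theta>' i - \<theta> i))
        \<longlongrightarrow> 0) (at \<theta> within space (Rn d))"
    using f by (auto simp: differentiable_Rn_def)
  have sum: "(\<Sum>i<d. G i * ((\<theta>(c := s)) i - \<theta> i)) = G c * (s - \<theta> c)" for s
  proof -
    have "(\<Sum>i<d. G i * ((\<theta>(c := s)) i - \<theta> i)) = (\<Sum>i\<in>{c}. G i * ((\<theta>(c := s)) i - \<theta> i))"
      using c by (intro sum.mono_neutral_right) auto
    then show ?thesis by simp
  qed
  have nrm: "linf d (\<lambda>i. (\<theta>(c := s)) i - \<theta> i) = \<bar>s - \<theta> c\<bar>" for s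
    using linf_single[OF c, of "\<lambda>i. (\<theta>(c := s)) i - \<theta> i"] by simp
  have "((\<lambda>s. (f (\<theta>(c := s)) - f \<theta> - G c * (s - \<theta> c)) / \<bar>s - \<theta> c\<bar>) \<longlongrightarrow> 0) (at (\<theta> c))"
    using filterlim_compose[OF G tendsto_fun_upd_at[OF \<theta> c]] unfolding sum nrm .
  then have lim: "((\<lambda>s. \<bar>(f (\<theta>(c := s)) - f \<theta> - G c * (s - \<theta> c)) / \<bar>s - \<theta> c\<bar>\<bar>) \<longlongrightarrow> 0) (at (\<theta> c))"
    by (rule tendsto_rabs_zero)
  have eq: "\<bar>(f (\<theta>(c := s)) - f \<theta> - G c * (s - \<theta> c)) / \<bar>s - \<theta> c\<bar>\<bar> = \<bar>(f (\<theta>(c := s)) - f \<theta>) / (s - \<theta> c) - G c\<bar>"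
    if "s \<noteq> \<theta> c" for s
  proof -
    have "(f (\<theta>(c := s)) - f \<theta>) / (s - \<theta> c) - G c = (f (\<theta>(c := s)) - f \<theta> - G c * (s - \<theta> c)) / (s - \<theta> c)"
      using that by (simp add: diff_divide_distrib)
    then show ?thesis by (simp add: abs_divide)
  qed
  have "((\<lambda>s. \<bar>(f (\<theta>(c := s)) - f \<theta>) / (s - \<theta> c) - G c\<bar>) \<longlongrightarrow> 0) (at (\<theta> c))"
    by (rule Lim_transform_eventually[OF lim]) (unfold eventually_at_filter, intro always_eventually allI impI eq)
  then have "((\<lambda>s. (f (\<theta>(c := s)) - f \<theta>) / (s - \<theta> c)) \<longlongrightarrow> G c) (at (\<theta> c))"
    by (simp only: tendsto_rabs_zero_iff LIM_zero_iff)
  then have "((\<lambda>s. f (\<theta>(c := s))) has_real_derivative G c) (at (\<theta> c))"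
    by (simp add: has_field_derivative_iff)
  then show ?thesis unfolding partial_deriv_def by (metis DERIV_imp_deriv)
qed

text \<open>The derivative is a pointwise limit of difference quotients along one sequence of
  parameters, each measurable in z. Openness of \<open>T\<close> keeps the sequence eventually
  inside \<open>T\<close>.\<close>

lemma partial_deriv_measurable:
  assumes d: "openin (top_of_set (space (Rn d))) T" "\<theta> \<in> T" "c < d"
    and F: "\<And>\<theta>'. \<theta>' \<in> T \<Longrightarrow> F \<theta>' \<in> borel_measurable P"
    and diff: "\<And>z. z \<in> space P \<Longrightarrow> differentiable_Rn d (\<lambda>\<theta>. F \<theta> z) \<theta>"
  shows "(\<lambda>z. partial_deriv c (\<lambda>\<theta>. F \<theta> z) \<theta>) \<in> borel_measurable P"
proof -
  have \<theta>: "\<theta> \<in> space (Rn d)" using d openin_imp_subset by blast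
  obtain U where U: "open U" "T = space (Rn d) \<inter> U" using d(1) by (auto simp: openin_open)
  have "\<forall>\<^sub>F \<theta>' in at \<theta> within space (Rn d). \<theta>' \<in> T"
    using U d(2) by (auto simp: eventually_at_topological)
  then have ev: "\<forall>\<^sub>F s in at (\<theta> c). \<theta>(c := s) \<in> T"
    using tendsto_fun_upd_at[OF \<theta> d(3)] by (rule eventually_compose_filterlim)
  define s where "s n = \<theta> c + inverse (real (Suc n))" for n
  have "s \<longlonglongrightarrow> \<theta> c + 0" unfolding s_def[abs_def] by (intro tendsto_add tendsto_const LIMSEQ_inverse_real_of_nat)
  then have s: "filterlim s (at (\<theta> c)) sequentially" by (simp add: filterlim_at s_def[abs_def])
  from eventually_compose_filterlim[OF ev s] obtain n0 where n0: "\<And>n. n \<ge> n0 \<Longrightarrow> \<theta>(c := s n) \<in> T"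
    by (auto simp: eventually_sequentially)
  \<comment> \<open>Shifted by \<open>n0\<close>, every quotient of the sequence is evaluated at
    parameters in \<open>T\<close>, where measurability is available.\<close>
  have sub: "filterlim (\<lambda>n. s (n + n0)) (at (\<theta> c)) sequentially"
    by (rule filterlim_compose[OF s]) (rule filterlim_add_const_nat_at_top)
  show ?thesis
  proof (rule borel_measurable_LIMSEQ_real)
    fix z assume "z \<in> space P"
    from differentiable_Rn_partial[OF diff[OF this] \<theta> d(3)]
    have "((\<lambda>t. (F (\<theta>(c := t)) z - F \<theta> z) / (t - \<theta> c)) \<longlongrightarrow> partial_deriv c (\<lambda>\<theta>. F \<theta> z) \<theta>) (at (\<theta> c))"
      by (simp add: has_field_derivative_iff)
    from filterlim_compose[OF this sub]
    show "(\<lambda>n. (F (\<theta>(c := s (n + n0))) z - F \<theta> z) / (s (n + n0) - \<theta> c)) \<longlonglongrightarrow> partial_deriv c (\<lambda>\<theta>. F \<theta> z) \<theta>" .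
  next
    show "(\<lambda>z. (F (\<theta>(c := s (n + n0))) z - F \<theta> z) / (s (n + n0) - \<theta> c)) \<in> borel_measurable P" for n
      by (intro borel_measurable_divide borel_measurable_diff borel_measurable_const F n0 d(2)) auto
  qed
qed

definition kern_deriv :: "ssm \<Rightarrow> vec \<Rightarrow> (nat \<Rightarrow> vec) \<Rightarrow> nat \<Rightarrow> nat \<Rightarrow> vec \<Rightarrow> vec \<Rightarrow> real" where
  "kern_deriv m \<theta> y c k x' x = partial_deriv c (\<lambda>\<theta>. transd m \<theta> x' x * obsd m \<theta> (y k) x) \<theta>"

context ssm_run
begin

lemma theta_space: "\<theta> \<in> space (Rn (dimT m))"
  using model theta openin_imp_subset by (auto simp: state_space_model_def)

lemma partials:
  assumes "x \<in> setX m" "x' \<in> setX m" "c < dimT m"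
  shows "((\<lambda>s. transd m (\<theta>(c := s)) x' x) has_real_derivative partial_deriv c (\<lambda>\<theta>. transd m \<theta> x' x) \<theta>) (at (\<theta> c))"
    "((\<lambda>s. obsd m (\<theta>(c := s)) (y k) x) has_real_derivative partial_deriv c (\<lambda>\<theta>. obsd m \<theta> (y k) x) \<theta>) (at (\<theta> c))"
proof -
  have "differentiable_Rn (dimT m) (\<lambda>\<theta>. transd m \<theta> x' x) \<theta>"
    and "differentiable_Rn (dimT m) (\<lambda>\<theta>. obsd m \<theta> (y k) x) \<theta>"
    using model theta obs[of k] assms(1,2) by (simp_all add: state_space_model_def)
  then show "((\<lambda>s. transd m (\<theta>(c := s)) x' x) has_real_derivative partial_deriv c (\<lambda>\<theta>. transd m \<theta> x' x) \<theta>) (at (\<theta> c))"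
    "((\<lambda>s. obsd m (\<theta>(c := s)) (y k) x) has_real_derivative partial_deriv c (\<lambda>\<theta>. obsd m \<theta> (y k) x) \<theta>) (at (\<theta> c))"
    using differentiable_Rn_partial[OF _ theta_space assms(3)] by blast+
qed

lemma kern_deriv_has_derivative:
  assumes "x \<in> setX m" "x' \<in> setX m" "c < dimT m"
  shows "((\<lambda>s. transd m (\<theta>(c := s)) x' x * obsd m (\<theta>(c := s)) (y k) x) has_real_derivative kern_deriv m \<theta> y c k x' x) (at (\<theta> c))"
    and "kern_deriv m \<theta> y c k x' x = partial_deriv c (\<lambda>\<theta>. transd m \<theta> x' x) \<theta> * obsd m \<theta> (y k) x
      + partial_deriv c (\<lambda>\<theta>. obsd m \<theta> (y k) x) \<theta> * transd m \<theta> x' x"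
proof -
  note D = DERIV_mult[OF partials(1)[OF assms] partials(2)[OF assms, of k]]
  show eq: "kern_deriv m \<theta> y c k x' x = partial_deriv c (\<lambda>\<theta>. transd m \<theta> x' x) \<theta> * obsd m \<theta> (y k) x
      + partial_deriv c (\<lambda>\<theta>. obsd m \<theta> (y k) x) \<theta> * transd m \<theta> x' x"
    unfolding kern_deriv_def partial_deriv_def[of c "\<lambda>\<theta>. transd m \<theta> x' x * obsd m \<theta> (y k) x"]
    using DERIV_imp_deriv[OF D] by simp
  show "((\<lambda>s. transd m (\<theta>(c := s)) x' x * obsd m (\<theta>(c := s)) (y k) x) has_real_derivative kern_deriv m \<theta> y c k x' x) (at (\<theta> c))"
    unfolding eq using D by simp
qed

lemma kern_pos: "x \<in> setX m \<Longrightarrow> x' \<in> setX m \<Longrightarrow> 0 < kern m \<theta> y k x' x"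
  using kern_bounds(1)[of x x' k] eps by (meson less_le_trans zero_less_power)

lemma t_step_eq:
  assumes "x \<in> setX m" "x' \<in> setX m" "c < dimT m"
  shows "t_step m \<theta> y (Suc k) x' x c = kern_deriv m \<theta> y c k x' x / kern m \<theta> y k x' x"
proof -
  have "0 < transd m (\<theta>(c := \<theta> c)) x' x * obsd m (\<theta>(c := \<theta> c)) (y k) x"
    using kern_pos[OF assms(1,2), of k] by (simp add: kern_def)
  from DERIV_chain2[OF DERIV_ln[OF this] kern_deriv_has_derivative(1)[OF assms, of k]]
  have "((\<lambda>s. ln (transd m (\<theta>(c := s)) x' x * obsd m (\<theta>(c := s)) (y k) x)) has_real_derivative
      inverse (kern m \<theta> y k x' x) * kern_deriv m \<theta> y c k x' x) (at (\<theta> c))" by (simp add: kern_def)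
  from DERIV_imp_deriv[OF this] show ?thesis
    by (simp add: t_step_def partial_deriv_def r_step_def divide_inverse mult.commute)
qed

text \<open>Since p \<ge> \<epsilon> and q \<ge> \<epsilon>, the bound K of either gradient is at
  most K p/\<epsilon> or K q/\<epsilon>. Each of the two terms of the product rule is then at most
  (K/\<epsilon>) p q.\<close>

lemma kern_deriv_bound:
  assumes K: "bounded_gradients m K" and x: "x \<in> setX m" "x' \<in> setX m" "c < dimT m"
  shows "\<bar>kern_deriv m \<theta> y c k x' x\<bar> \<le> 2 * K / \<epsilon> * kern m \<theta> y k x' x"
proof -
  let ?p = "partial_deriv c (\<lambda>\<theta>. transd m \<theta> x' x) \<theta>" and ?q = "partial_deriv c (\<lambda>\<theta>. obsd m \<theta> (y k) x) \<theta>"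
  have "\<bar>?p\<bar> \<le> K" "\<bar>?q\<bar> \<le> K"
    using K theta obs[of k] x abs_le_linf[OF x(3), of "\<lambda>c. partial_deriv c (\<lambda>\<theta>. transd m \<theta> x' x) \<theta>"]
      abs_le_linf[OF x(3), of "\<lambda>c. partial_deriv c (\<lambda>\<theta>. obsd m \<theta> (y k) x) \<theta>"]
    by (auto simp: bounded_gradients_def intro: order_trans)
  moreover have "0 \<le> K" using calculation by linarith
  moreover have p: "1 \<le> transd m \<theta> x' x / \<epsilon>" "1 \<le> obsd m \<theta> (y k) x / \<epsilon>"
    using transd_bounds(1)[OF x(1,2)] obsd_bounds(1)[OF x(1), of k] eps by simp_all
  ultimately have a: "\<bar>?p\<bar> \<le> K * (transd m \<theta> x' x / \<epsilon>)" "\<bar>?q\<bar> \<le> K * (obsd m \<theta> (y k) x / \<epsilon>)"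
    using mult_left_mono[OF p(1), of K] mult_left_mono[OF p(2), of K] by auto
  have pos: "0 \<le> transd m \<theta> x' x" "0 \<le> obsd m \<theta> (y k) x"
    using transd_bounds(1)[OF x(1,2)] obsd_bounds(1)[OF x(1), of k] eps by simp_all
  have "\<bar>kern_deriv m \<theta> y c k x' x\<bar> \<le> \<bar>?p\<bar> * obsd m \<theta> (y k) x + \<bar>?q\<bar> * transd m \<theta> x' x"
    unfolding kern_deriv_has_derivative(2)[OF x] using pos
    by (intro order_trans[OF abs_triangle_ineq]) (simp add: abs_mult)
  also have "\<dots> \<le> K * (transd m \<theta> x' x / \<epsilon>) * obsd m \<theta> (y k) x + K * (obsd m \<theta> (y k) x / \<epsilon>) * transd m \<theta> x' x"
    using pos by (intro add_mono mult_right_mono a)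
  also have "\<dots> = 2 * K / \<epsilon> * kern m \<theta> y k x' x" by (simp add: kern_def)
  finally show ?thesis .
qed

lemma kern_deriv_measurable:
  assumes c: "c < dimT m"
  shows "(\<lambda>z. kern_deriv m \<theta> y c k (fst z) (snd z)) \<in> borel_measurable (refX m \<Otimes>\<^sub>M refX m)"
proof -
  have o: "openin (top_of_set (space (Rn (dimT m)))) (Theta m)" using model by (simp add: state_space_model_def)
  have s: "sets (refX m \<Otimes>\<^sub>M refX m) = sets (spX m \<Otimes>\<^sub>M spX m)"
    by (rule sets_pair_measure_cong[OF sets_refX sets_refX])
  have z: "fst z \<in> setX m" "snd z \<in> setX m" if "z \<in> space (refX m \<Otimes>\<^sub>M refX m)" for z
    using that by (auto simp: space_pair_measure space_refX)
  have p: "(\<lambda>z. partial_deriv c (\<lambda>\<theta>. transd m \<theta> (fst z) (snd z)) \<theta>) \<in> borel_measurable (refX m \<Otimes>\<^sub>M refX m)"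
    using model theta z transd_section_measurable[OF model]
    by (intro partial_deriv_measurable[OF o theta c, where F="\<lambda>\<theta> z. transd m \<theta> (fst z) (snd z)"])
      (auto simp: state_space_model_def measurable_cong_sets[OF s refl])
  have q: "(\<lambda>x. partial_deriv c (\<lambda>\<theta>. obsd m \<theta> (y k) x) \<theta>) \<in> borel_measurable (refX m)"
    using model theta obs[of k] obsd_section_measurable[OF model _ obs]
    by (intro partial_deriv_measurable[OF o theta c, where F="\<lambda>\<theta> x. obsd m \<theta> (y k) x"])
      (auto simp: state_space_model_def space_refX measurable_cong_sets[OF sets_refX refl])
  have "(\<lambda>z. partial_deriv c (\<lambda>\<theta>. transd m \<theta> (fst z) (snd z)) \<theta> * obsd m \<theta> (y k) (snd z)
      + partial_deriv c (\<lambda>\<theta>. obsd m \<theta> (y k) (snd z)) \<theta> * transd m \<theta> (fst z) (snd z)) \<in> borel_measurable (refX m \<Otimes>\<^sub>M refX m)"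
    by (intro borel_measurable_add borel_measurable_times p transd_measurable
        measurable_compose[OF measurable_snd q] measurable_compose[OF measurable_snd obsd_measurable])
  then show ?thesis
    by (rule measurable_cong[THEN iffD1, rotated]) (use z c in \<open>simp add: kern_deriv_has_derivative(2)\<close>)
qed

end

section \<open>The bias bounds\<close>

lemma sum_rev_atMost:
  fixes a :: "nat \<Rightarrow> real"
  shows "(\<Sum>i\<le>n. a (n - i)) = (\<Sum>i\<le>n. a i)"
  by (rule sum.reindex_bij_witness[of _ "\<lambda>i. n - i" "\<lambda>i. n - i"]) auto

lemma geometric_sum_le:
  fixes r :: real
  assumes "0 < r" "r < 1"
  shows "(\<Sum>i\<le>n. r ^ (n - i)) \<le> 1 / (1 - r)"
proof -
  have "(1 - r) * (\<Sum>i\<le>n. r ^ i) = 1 - r ^ Suc n" by (rule sum_gp_basic)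
  also have "\<dots> \<le> 1" using assms by simp
  finally show ?thesis using assms unfolding sum_rev_atMost[of "\<lambda>i. r ^ i"] by (simp add: field_simps)
qed

lemma geometric_derivative_sum_le:
  fixes r :: real
  assumes "0 < r" "r < 1"
  shows "(\<Sum>i\<le>n. real (Suc (n - i)) * r ^ (n - i)) \<le> 1 / (1 - r)\<^sup>2"
proof -
  \<comment> \<open>The closed form of the differentiated geometric sum, checked by
    induction.\<close>
  have "(1 - r)\<^sup>2 * (\<Sum>i\<le>n. real (Suc i) * r ^ i) = 1 - r ^ Suc n * ((real n + 2) - (real n + 1) * r)"
    by (induction n) (simp_all add: power2_eq_square algebra_simps)
  also have "\<dots> \<le> 1"
  proof -
    have "(real n + 1) * r \<le> (real n + 1) * 1" using assms by (intro mult_left_mono) auto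
    also have "\<dots> \<le> real n + 2" by simp
    finally have "0 \<le> (real n + 2) - (real n + 1) * r" by simp
    then show ?thesis using assms by simp
  qed
  finally show ?thesis using assms unfolding sum_rev_atMost[of "\<lambda>i. real (Suc i) * r ^ i"] by (simp add: field_simps)
qed

text \<open>With t the fourth root of r, (n+1) t^n is one term of a sum bounded by 1/(1-t)^2.
  Squaring spends t^(2n), and the remaining t^(2n) is the n-th power of sqrt r.\<close>

lemma square_power_le:
  fixes r :: real
  assumes r: "0 < r" "r < 1"
  shows "(real (Suc n))\<^sup>2 * r ^ n \<le> 1 / (1 - sqrt (sqrt r)) ^ 4 * sqrt r ^ n"
proof -
  define t where "t = sqrt (sqrt r)"
  have t: "0 < t" "t < 1" using r by (simp_all add: t_def)
  have sr: "sqrt r = t\<^sup>2" and rt: "r = t\<^sup>2 * t\<^sup>2"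
    using r by (simp_all add: t_def)
  have "real (Suc n) * t ^ n \<le> (\<Sum>i\<le>n. real (Suc (n - i)) * t ^ (n - i))"
    using t member_le_sum[of 0 "{..n}" "\<lambda>i. real (Suc (n - i)) * t ^ (n - i)"] by simp
  also have "\<dots> \<le> 1 / (1 - t)\<^sup>2" by (rule geometric_derivative_sum_le[OF t])
  finally have "(real (Suc n) * t ^ n)\<^sup>2 \<le> (1 / (1 - t)\<^sup>2)\<^sup>2" using t by (intro power_mono) auto
  then have "(real (Suc n))\<^sup>2 * (t\<^sup>2) ^ n \<le> 1 / (1 - t) ^ 4"
    by (simp add: power_mult_distrib power_divide flip: power_mult) (simp add: mult.commute)
  from mult_right_mono[OF this, of "(t\<^sup>2) ^ n"] t
  have "(real (Suc n))\<^sup>2 * ((t\<^sup>2) ^ n * (t\<^sup>2) ^ n) \<le> 1 / (1 - t) ^ 4 * (t\<^sup>2) ^ n" by (simp only: mult.assoc zero_le_power zero_le_power2)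
  moreover have "r ^ n = (t\<^sup>2) ^ n * (t\<^sup>2) ^ n" unfolding rt by (rule power_mult_distrib)
  moreover have "sqrt (sqrt r) = t" by (simp add: t_def)
  ultimately show ?thesis by (simp only: sr)
qed

text \<open>The part with \<open>R\<close> sums geometrically. In the part with \<open>B\<close> the
  powers combine to r^n for every i, so the sum is bounded crudely by (n+1)^2 r^n B, and passing to
  sqrt r absorbs the square.\<close>

lemma bias_sum_le:
  fixes r R B S :: real
  assumes r: "0 < r" "r < 1" and B: "0 \<le> B" and R: "0 \<le> R" and S: "0 \<le> S"
  shows "(\<Sum>i\<le>n. S * (real (Suc (n - i)) * r ^ (n - i) * (1 + (R + r ^ i * B))) / real N)
    \<le> S * ((1 + R) / (1 - r)\<^sup>2 + 1 / (1 - sqrt (sqrt r)) ^ 4) * (1 + sqrt r ^ n * B) / real N"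
proof -
  let ?D = "1 / (1 - r)\<^sup>2" and ?C = "1 / (1 - sqrt (sqrt r)) ^ 4"
  have C: "0 \<le> ?C" by simp
  have s: "0 \<le> sqrt r ^ n * B" using r B by simp
  have "(\<Sum>i\<le>n. real (Suc (n - i)) * r ^ (n - i) * (1 + (R + r ^ i * B))) =
      (\<Sum>i\<le>n. (1 + R) * (real (Suc (n - i)) * r ^ (n - i)) + B * (r ^ n * real (Suc (n - i))))"
  proof (rule sum.cong[OF refl])
    fix i assume "i \<in> {..n}"
    then have "r ^ (n - i) * r ^ i = r ^ n" by (simp flip: power_add)
    then have "real (Suc (n - i)) * (r ^ (n - i) * r ^ i) * B = B * (r ^ n * real (Suc (n - i)))" by simp
    then show "real (Suc (n - i)) * r ^ (n - i) * (1 + (R + r ^ i * B)) =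
        (1 + R) * (real (Suc (n - i)) * r ^ (n - i)) + B * (r ^ n * real (Suc (n - i)))"
      by (simp add: algebra_simps)
  qed
  also have "\<dots> = (1 + R) * (\<Sum>i\<le>n. real (Suc (n - i)) * r ^ (n - i)) + B * (r ^ n * (\<Sum>i\<le>n. real (Suc (n - i))))"
    by (simp only: sum.distrib sum_distrib_left)
  also have "\<dots> \<le> (1 + R) * ?D + B * (?C * sqrt r ^ n)"
  proof (intro add_mono mult_left_mono geometric_derivative_sum_le[OF r] B)
    have "(\<Sum>i\<le>n. real (Suc (n - i))) \<le> (\<Sum>i\<le>n. real (Suc n))" by (intro sum_mono) auto
    then have "r ^ n * (\<Sum>i\<le>n. real (Suc (n - i))) \<le> r ^ n * (real (Suc n))\<^sup>2"
      using r by (intro mult_left_mono) (auto simp: power2_eq_square)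
    also have "\<dots> \<le> ?C * sqrt r ^ n" using square_power_le[OF r, of n] by (simp add: mult.commute)
    finally show "r ^ n * (\<Sum>i\<le>n. real (Suc (n - i))) \<le> ?C * sqrt r ^ n" .
  qed (use R in simp)
  also have "\<dots> = (1 + R) * ?D * 1 + ?C * (sqrt r ^ n * B)" by simp
  also have "\<dots> \<le> ((1 + R) * ?D + ?C) * (1 + sqrt r ^ n * B)"
  proof -
    have "0 \<le> (1 + R) * ?D * (sqrt r ^ n * B)" using R by (intro mult_nonneg_nonneg[OF _ s]) auto
    then show ?thesis using C by (simp only: distrib_left distrib_right mult_1_right)
  qed
  finally have "(\<Sum>i\<le>n. real (Suc (n - i)) * r ^ (n - i) * (1 + (R + r ^ i * B))) \<le>
      ((1 + R) / (1 - r)\<^sup>2 + ?C) * (1 + sqrt r ^ n * B)" by simp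
  from mult_left_mono[OF this S] have "S * (\<Sum>i\<le>n. real (Suc (n - i)) * r ^ (n - i) * (1 + (R + r ^ i * B))) / real N \<le>
      S * (((1 + R) / (1 - r)\<^sup>2 + ?C) * (1 + sqrt r ^ n * B)) / real N"
    by (rule divide_right_mono) simp
  then show ?thesis
    by (simp only: sum_distrib_left sum_divide_distrib mult.assoc)
qed

context ssm_run
begin

lemma test_function_bounded:
  assumes "test_function m \<phi>"
  shows "bounded_measurable (refX m) \<phi>" "\<And>x. x \<in> setX m \<Longrightarrow> \<bar>\<phi> x\<bar> \<le> 1"
proof -
  show le: "\<And>x. x \<in> setX m \<Longrightarrow> \<bar>\<phi> x\<bar> \<le> 1"
    using assms by (force simp: test_function_def abs_le_iff image_subset_iff)
  show "bounded_measurable (refX m) \<phi>"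
    using assms le by (intro bounded_measurableI[of _ _ 1])
      (auto simp: test_function_def space_refX measurable_cong_sets[OF sets_refX refl])
qed

lemma wgt0_measurable:
  assumes "c < dimT m"
  shows "(\<lambda>x. wgt0 m \<theta> x c) \<in> borel_measurable (refX m)"
proof -
  have b: "(\<lambda>(\<theta>, x). wgt0 m \<theta> x) \<in> spT m \<Otimes>\<^sub>M spX m \<rightarrow>\<^sub>M Rn (dimT m)"
    using model by (simp add: state_space_model_def)
  have a: "(\<lambda>x. (\<theta>, x)) \<in> spX m \<rightarrow>\<^sub>M spT m \<Otimes>\<^sub>M spX m"
    using theta by (intro measurable_Pair measurable_const measurable_ident) (auto simp: space_spT[OF model])
  from measurable_compose[OF a b] have w: "(\<lambda>x. wgt0 m \<theta> x) \<in> spX m \<rightarrow>\<^sub>M Rn (dimT m)" by simp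
  have "(\<lambda>z. z c) \<in> Rn (dimT m) \<rightarrow>\<^sub>M borel"
    unfolding Rn_def by (rule measurable_component_singleton) (use assms in simp)
  from measurable_compose[OF w this] have "(\<lambda>x. wgt0 m \<theta> x c) \<in> borel_measurable (spX m)" .
  then show ?thesis by (simp add: measurable_cong_sets[OF sets_refX refl])
qed

lemma wgt0_le_norm:
  assumes "bounded_weights m" "x \<in> setX m" "c < dimT m"
  shows "\<bar>wgt0 m \<theta> x c\<bar> \<le> wgt0_norm m \<theta>"
proof -
  have "\<bar>wgt0 m \<theta> x c\<bar> \<le> linf (dimT m) (wgt0 m \<theta> x)" by (rule abs_le_linf[OF assms(3)])
  also have "\<dots> \<le> wgt0_norm m \<theta>"
    unfolding wgt0_norm_def using assms theta by (intro cSUP_upper) (auto simp: bounded_weights_def)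
  finally show ?thesis .
qed

lemma xi_bias_bound:
  assumes N: "N \<ge> 1" and \<phi>: "test_function m \<phi>"
  shows "\<bar>xi_bias m N \<theta> y n \<phi>\<bar> \<le> 2 * (1 / (\<epsilon>\<^sup>2)\<^sup>2) ^ 3 * (1 / (\<epsilon>\<^sup>2)\<^sup>2) / real N"
proof -
  \<comment> \<open>The filter itself involves no gradients or weights, so both are set to zero,
    together with their bounds.\<close>
  interpret ssm_filter m \<epsilon> \<theta> y N "\<lambda>_ _ _. 0" 0 "\<lambda>_. 0" 0
    using N by unfold_locales auto
  have "\<bar>xi_bias m N \<theta> y n \<phi>\<bar> \<le> (\<Sum>i\<le>n. 2 * (1 / (\<epsilon>\<^sup>2)\<^sup>2) ^ 3 * \<rho> ^ (n - i) / N)"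
    by (rule xi_bias_le[OF test_function_bounded[OF \<phi>]])
  also have "\<dots> = 2 * (1 / (\<epsilon>\<^sup>2)\<^sup>2) ^ 3 * (\<Sum>i\<le>n. \<rho> ^ (n - i)) / N"
    by (simp only: sum_distrib_left sum_divide_distrib)
  also have "\<dots> \<le> 2 * (1 / (\<epsilon>\<^sup>2)\<^sup>2) ^ 3 * (1 / (1 - \<rho>)) / N"
    by (intro divide_right_mono mult_left_mono geometric_sum_le rho) auto
  finally show ?thesis by (simp add: \<rho>_def)
qed

lemma zeta_bias_bound:
  assumes N: "N \<ge> 1" and \<phi>: "test_function m \<phi>" and K: "bounded_gradients m K" "0 \<le> K"
    and w: "bounded_weights m" and c: "c < dimT m"
    and \<Gamma>: "\<Gamma> = 2 * K / \<epsilon>" and r: "r = 1 - (\<epsilon>\<^sup>2)\<^sup>2"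
  shows "\<bar>zeta_bias m N \<theta> y n \<phi> c\<bar> \<le>
    (2 * (1 / (\<epsilon>\<^sup>2)\<^sup>2) ^ 3 * (4 * (\<Gamma> / (\<epsilon>\<^sup>2)\<^sup>2) / r + (4 + 2 * \<Gamma>)) + (1 / (\<epsilon>\<^sup>2)\<^sup>2) ^ 4 * (4 * (\<Gamma> / (\<epsilon>\<^sup>2)\<^sup>2 + 1)))
    * ((1 + \<Gamma> / (\<epsilon>\<^sup>2)\<^sup>2) / (1 - r)\<^sup>2 + 1 / (1 - sqrt (sqrt r)) ^ 4) * (1 + sqrt r ^ n * wgt0_norm m \<theta>) / real N"
proof -
  \<comment> \<open>One coordinate of the gradient is treated at a time. The bounds do not depend on
    c, so the passage to the maximum norm costs nothing.\<close>
  interpret ssm_filter m \<epsilon> \<theta> y N "kern_deriv m \<theta> y c" \<Gamma> "\<lambda>x. wgt0 m \<theta> x c" "wgt0_norm m \<theta>"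
    using N K(2) eps kern_deriv_measurable[OF c] kern_deriv_bound[OF K(1) _ _ c] wgt0_measurable[OF c] wgt0_le_norm[OF w _ c]
    by unfold_locales (simp_all add: \<Gamma>)
  have rr: "r = \<rho>" by (simp add: r \<rho>_def)
  have t: "t_path m \<theta> y n x c = path_score n x" if x: "x \<in> space (path_base m \<theta> n)" for x
    unfolding t_path_def path_score_def
  proof (intro arg_cong2[where f="(+)"] sum.cong refl)
    fix k assume "k \<in> {1..n}"
    then have k: "k = Suc (k - 1)" "k \<le> n" "k - 1 \<le> n" by auto
    show "t_step m \<theta> y k (x k) (x (k - 1)) c = kern_deriv m \<theta> y c (k - 1) (x k) (x (k - 1)) / kern m \<theta> y (k - 1) (x k) (x (k - 1))"
      using t_step_eq[OF path_in[OF x k(3)] path_in[OF x k(2)] c, of "k - 1"] k(1) by simp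
  qed
  have wt_eq: "weight m N \<theta> y h k i c = wt h k i" if "h \<in> space (history_space m N n)" "k \<le> n" "i \<in> {1..N}" for h k i
    using that(2,3)
  proof (induction k arbitrary: i)
    case (Suc k)
    then have "weight m N \<theta> y h k j c = wt h k j" if "j \<in> {1..N}" for j using that by simp
    then have "weight m N \<theta> y h (Suc k) i c =
        (\<Sum>j=1..N. kern_deriv m \<theta> y c k (h (Suc k) i) (h k j) + kern m \<theta> y k (h (Suc k) i) (h k j) * wt h k j)
        / (\<Sum>j=1..N. kern m \<theta> y k (h (Suc k) i) (h k j))"
      unfolding weight.simps kern_deriv_def kern_def by (intro arg_cong2[where f="(/)"] sum.cong) auto
    then show ?case by (simp add: next_weight_def)
  qed simp
  have "\<bar>zeta_bias m N \<theta> y n \<phi> c\<bar>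
    \<le> (\<Sum>i\<le>n. step_const * (real (Suc (n - i)) * \<rho> ^ (n - i) * (1 + (\<Gamma> / (\<epsilon>\<^sup>2)\<^sup>2 + \<rho> ^ i * wgt0_norm m \<theta>))) / N)"
    by (rule zeta_bias_le[OF test_function_bounded[OF \<phi>] t wt_eq]) auto
  also have "\<dots> \<le> step_const * ((1 + \<Gamma> / (\<epsilon>\<^sup>2)\<^sup>2) / (1 - \<rho>)\<^sup>2 + 1 / (1 - sqrt (sqrt \<rho>)) ^ 4)
      * (1 + sqrt \<rho> ^ n * wgt0_norm m \<theta>) / real N"
    by (rule bias_sum_le[OF rho B_nonneg _ step_const_nonneg]) (use Gamma in simp)
  finally show ?thesis unfolding rr step_const_def .
qed

end

theorem theorem2p1:
  fixes \<epsilon> :: real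
  assumes "\<epsilon> \<in> {0<..<1}"
  shows
    "(\<exists>L::real. L \<ge> 1 \<and>
        (\<forall>m N. state_space_model m \<and> bounded_densities m \<epsilon> \<and> N \<ge> 2 \<longrightarrow>
          (\<forall>\<theta>\<in>Theta m. \<forall>y \<phi> n.
             (\<forall>k. y k \<in> setY m) \<and> test_function m \<phi> \<and> n \<ge> 1 \<longrightarrow>
             \<bar>xi_bias m N \<theta> y n \<phi>\<bar> \<le> L / real N)))
     \<and>
     (\<forall>(d::nat) (K::real). d \<ge> 1 \<and> K \<ge> 1 \<longrightarrow>
       (\<exists>\<rho> M::real. 0 < \<rho> \<and> \<rho> < 1 \<and> M \<ge> 1 \<and>
         (\<forall>m N. state_space_model m \<and> dimT m = d \<and> bounded_densities m \<epsilon> \<and>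
                bounded_gradients m K \<and> bounded_weights m \<and> N \<ge> 2 \<longrightarrow>
           (\<forall>\<theta>\<in>Theta m. \<forall>y \<phi> n.
              (\<forall>k. y k \<in> setY m) \<and> test_function m \<phi> \<and> n \<ge> 1 \<longrightarrow>
              linf d (zeta_bias m N \<theta> y n \<phi>)
                \<le> M * (1 + \<rho> ^ n * wgt0_norm m \<theta>) / real N))))"
proof (intro conjI allI impI)
  have run: "ssm_run m \<epsilon> \<theta> y"
    if "state_space_model m" "bounded_densities m \<epsilon>" "\<theta> \<in> Theta m" "\<forall>k. y k \<in> setY m" for m \<theta> y
    using that assms by unfold_locales auto
  show "\<exists>L::real. L \<ge> 1 \<and>
        (\<forall>m N. state_space_model m \<and> bounded_densities m \<epsilon> \<and> N \<ge> 2 \<longrightarrow>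
          (\<forall>\<theta>\<in>Theta m. \<forall>y \<phi> n.
             (\<forall>k. y k \<in> setY m) \<and> test_function m \<phi> \<and> n \<ge> 1 \<longrightarrow>
             \<bar>xi_bias m N \<theta> y n \<phi>\<bar> \<le> L / real N))"
  \<comment> \<open>The cube comes from the bias of a ratio with \<beta> = 1/(\<epsilon>^2)^2; the
    last factor is 1/(1 - \<rho>), the sum of the geometric series. Adding 1 secures L \<ge>
    1.\<close>
  proof (intro exI[of _ "1 + 2 * (1 / (\<epsilon>\<^sup>2)\<^sup>2) ^ 3 * (1 / (\<epsilon>\<^sup>2)\<^sup>2)"] conjI allI impI ballI)
    fix m :: ssm and N :: nat and \<theta> :: vec and y :: "nat \<Rightarrow> vec" and \<phi> :: "vec \<Rightarrow> real" and n :: nat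
    assume A: "state_space_model m \<and> bounded_densities m \<epsilon> \<and> N \<ge> 2" "\<theta> \<in> Theta m"
      "(\<forall>k. y k \<in> setY m) \<and> test_function m \<phi> \<and> n \<ge> 1"
    then have "\<bar>xi_bias m N \<theta> y n \<phi>\<bar> \<le> 2 * (1 / (\<epsilon>\<^sup>2)\<^sup>2) ^ 3 * (1 / (\<epsilon>\<^sup>2)\<^sup>2) / real N"
      by (intro ssm_run.xi_bias_bound run) auto
    also have "\<dots> \<le> (1 + 2 * (1 / (\<epsilon>\<^sup>2)\<^sup>2) ^ 3 * (1 / (\<epsilon>\<^sup>2)\<^sup>2)) / real N" by (intro divide_right_mono) auto
    finally show "\<bar>xi_bias m N \<theta> y n \<phi>\<bar> \<le> (1 + 2 * (1 / (\<epsilon>\<^sup>2)\<^sup>2) ^ 3 * (1 / (\<epsilon>\<^sup>2)\<^sup>2)) / real N" .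
  qed simp
  fix d :: nat and K :: real
  assume dK: "d \<ge> 1 \<and> K \<ge> 1"
  define \<Gamma> where "\<Gamma> = 2 * K / \<epsilon>"
  define r where "r = 1 - (\<epsilon>\<^sup>2)\<^sup>2"
  define M where "M = (2 * (1 / (\<epsilon>\<^sup>2)\<^sup>2) ^ 3 * (4 * (\<Gamma> / (\<epsilon>\<^sup>2)\<^sup>2) / r + (4 + 2 * \<Gamma>)) + (1 / (\<epsilon>\<^sup>2)\<^sup>2) ^ 4 * (4 * (\<Gamma> / (\<epsilon>\<^sup>2)\<^sup>2 + 1)))
    * ((1 + \<Gamma> / (\<epsilon>\<^sup>2)\<^sup>2) / (1 - r)\<^sup>2 + 1 / (1 - sqrt (sqrt r)) ^ 4)"
  have r: "0 < r" "r < 1"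
  proof -
    have "(\<epsilon>\<^sup>2)\<^sup>2 < 1" using assms by (simp add: power_less_one_iff abs_square_less_1 flip: power_mult)
    with assms show "0 < r" "r < 1" by (auto simp: r_def)
  qed
  have \<Gamma>: "0 \<le> \<Gamma>" using dK assms by (simp add: \<Gamma>_def)
  have M: "0 \<le> M"
    unfolding M_def using r \<Gamma> assms by (intro mult_nonneg_nonneg add_nonneg_nonneg divide_nonneg_nonneg zero_le_power) auto
  show "\<exists>\<rho> M::real. 0 < \<rho> \<and> \<rho> < 1 \<and> M \<ge> 1 \<and>
         (\<forall>m N. state_space_model m \<and> dimT m = d \<and> bounded_densities m \<epsilon> \<and>
                bounded_gradients m K \<and> bounded_weights m \<and> N \<ge> 2 \<longrightarrow>
           (\<forall>\<theta>\<in>Theta m. \<forall>y \<phi> n.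
              (\<forall>k. y k \<in> setY m) \<and> test_function m \<phi> \<and> n \<ge> 1 \<longrightarrow>
              linf d (zeta_bias m N \<theta> y n \<phi>)
                \<le> M * (1 + \<rho> ^ n * wgt0_norm m \<theta>) / real N))"
  \<comment> \<open>The square root of the contraction rate pays for the quadratic factor in n, and
    1 + M is at least 1.\<close>
  proof (rule exI[of _ "sqrt r"], rule exI[of _ "1 + M"], intro conjI allI impI ballI)
    fix m :: ssm and N :: nat and \<theta> :: vec and y :: "nat \<Rightarrow> vec" and \<phi> :: "vec \<Rightarrow> real" and n :: nat
    assume A: "state_space_model m \<and> dimT m = d \<and> bounded_densities m \<epsilon> \<and>
        bounded_gradients m K \<and> bounded_weights m \<and> N \<ge> 2" "\<theta> \<in> Theta m"
      "(\<forall>k. y k \<in> setY m) \<and> test_function m \<phi> \<and> n \<ge> 1"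
    interpret ssm_run m \<epsilon> \<theta> y using A by (intro run) auto
    show "linf d (zeta_bias m N \<theta> y n \<phi>) \<le> (1 + M) * (1 + sqrt r ^ n * wgt0_norm m \<theta>) / real N"
    proof (rule linf_le)
      fix c assume c: "c < d"
      \<comment> \<open>The norm is a supremum over the states, so its sign is read off from an
        actual state. It is needed when M is enlarged to 1 + M.\<close>
      obtain x where "x \<in> setX m" using setX_nonempty by auto
      then have "0 \<le> wgt0_norm m \<theta>"
        using wgt0_le_norm[of x c] A c order_trans[OF abs_ge_zero] by blast
      then have w: "0 \<le> 1 + sqrt r ^ n * wgt0_norm m \<theta>" using r by simp
      have "\<bar>zeta_bias m N \<theta> y n \<phi> c\<bar> \<le> M * (1 + sqrt r ^ n * wgt0_norm m \<theta>) / real N"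
        unfolding M_def using A dK c by (intro zeta_bias_bound[where K=K]) (auto simp: \<Gamma>_def r_def)
      also have "\<dots> \<le> (1 + M) * (1 + sqrt r ^ n * wgt0_norm m \<theta>) / real N"
        using w by (intro divide_right_mono mult_right_mono) auto
      finally show "\<bar>zeta_bias m N \<theta> y n \<phi> c\<bar> \<le> (1 + M) * (1 + sqrt r ^ n * wgt0_norm m \<theta>) / real N" .
    qed (use dK in simp)
  qed (use r M in auto)
qed

end
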